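(* Let $(M,g,I,J,K)$ be a connected hyperKähler manifold, $\dim M>4$, with an effective tri-holomorphic isometry $X$. Suppose an elementary deformation $\tilde g=g+h\,g_{\mathbb HX}$ of $(M,g,X)$ twists, via data $(h,\lambda,a,F)$ with $$a=\lambda(1+h\|X\|^2)\neq0,\quad F=\lambda\bigl(d(h\alpha_0)+*_3dh\bigr),\quad \lambda\ne0\text{ constant},\quad dh\in\langle\alpha_I,\alpha_J,\alpha_K\rangle,\quad d*_3dh=0$$ on $M'=M\setminus M^X$, to $(\check M,\check g,\check X)$, where $\check g\sim_{\mathcal H}\tilde g$ and $\check X\sim_{\mathcal H}-\frac1aX$. Then $(M,g,X)$ is obtained from a twist of an elementary deformation of $(\check M,\check g,\check X)$ by the data $$\check h\sim_{\mathcal H}-\lambda^2h,\qquad\check\lambda\sim_{\mathcal H}\frac1\lambda,\qquad\check a\sim_{\mathcal H}\frac1a,\qquad\check F\sim_{\mathcal H}\frac1aF.$$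
   Context: Setting. $\omega_A=g(A\cdot,\cdot)$, $A=I,J,K$, $IJ=K=-JI$; $X$ generates a circle action preserving $g,I,J,K$; $M^X$ is its zero set. $\alpha_0=X^\flat$, $\alpha_A=X\lrcorner\,\omega_A$, $\|X\|^2=g(X,X)$, $g_{\mathbb HX}=\alpha_0^2+\alpha_I^2+\alpha_J^2+\alpha_K^2$; $*_3$ is defined on $M'$ by $*_3\alpha_I=\alpha_J\wedge\alpha_K$ and cyclically. The corresponding objects on $\check M$ are defined from $\check g,\check X$ and the induced $\check I,\check J,\check K$, and marked with a check. An elementary (quaternionic) deformation of $(\check M,\check g,\check X)$ by $\check h$ is $\check g+\check h\,g_{\mathbb H\check X}$. Twist. Given a closed $X$-invariant two-form $F$ and nowhere zero function $a$ with $da=-X\lrcorner F$, take a principal circle bundle $\pi_M\colon P\to M$ with principal vector field $Z$ and connection $\theta$, $\theta(Z)=1$, $d\theta=\pi_M^*F$. Put $\mathcal H=\ker\theta$, $X'=\widetilde X+aZ$ with $\widetilde X$ the horizontal lift of $X$. The twist is $W=P/\langle X'\rangle$ (assumed a smooth quotient), with projection $\pi_W$. Invariant tensors $\alpha$ on $M$ and $\alpha_W$ on $W$ are $\mathcal H$-related, $\alpha_W\sim_{\mathcal H}\alpha$, if $\pi_W^*\alpha_W|_{\mathcal H}=\pi_M^*\alpha|_{\mathcal H}$ (for functions: equal pull-backs to $P$; for vector fields: equal lifts to $\mathcal H$). The twist of $(M,\tilde g,I,J,K)$ is $W$ with the $\mathcal H$-related structures. In the statement $W=\check M$. The data $(\check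 h,\check\lambda,\check a,\check F)$ on $\check M$ prescribe the elementary deformation $\check g+\check h\,g_{\mathbb H\check X}$ and the twist with respect to $(\check X,\check a,\check F)$, with $\check a=\check\lambda(1+\check h\|\check X\|^2)$ and $\check F=\check\lambda\bigl(d(\check h\check\alpha_0)+*_3d\check h\bigr)$. *)

theory Defs
  imports "HOL-Analysis.Analysis"
begin

section \<open>Smooth manifolds\<close>

text \<open>
  A smooth manifold is a type of points (Hausdorff and second countable by its sort) together
  with a smooth atlas modelled on a Euclidean space \<open>'e\<close>; its dimension is \<open>DIM('e)\<close>.
\<close>

primrec Ck_on :: "nat \<Rightarrow> ('e::euclidean_space \<Rightarrow> 'f::euclidean_space) \<Rightarrow> 'e set \<Rightarrow> bool" where
  "Ck_on 0 f S \<longleftrightarrow> continuous_on S f"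
| "Ck_on (Suc k) f S \<longleftrightarrow>
     f differentiable_on S \<and> (\<forall>v. Ck_on k (\<lambda>x. frechet_derivative f (at x) v) S)"

text \<open>Only used on open sets \<open>S\<close>.\<close>
definition smooth_on :: "'e::euclidean_space set \<Rightarrow> ('e \<Rightarrow> 'f::euclidean_space) \<Rightarrow> bool" where
  "smooth_on S f \<longleftrightarrow> (\<forall>k. Ck_on k f S)"

type_synonym ('m, 'e) chart = "'m set \<times> ('m \<Rightarrow> 'e)"
type_synonym ('m, 'e) atlas = "('m, 'e) chart set"

definition cinv :: "('m, 'e) chart \<Rightarrow> 'e \<Rightarrow> 'm" where
  "cinv c = inv_into (fst c) (snd c)"

definition smooth_manifold ::
    "('m::{t2_space,second_countable_topology}, 'e::euclidean_space) atlas \<Rightarrow> bool" where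
  "smooth_manifold A \<longleftrightarrow>
     (\<forall>c\<in>A. open (fst c) \<and> open (snd c ` fst c) \<and>
            homeomorphism (fst c) (snd c ` fst c) (snd c) (cinv c)) \<and>
     (\<Union>c\<in>A. fst c) = UNIV \<and>
     (\<forall>c\<in>A. \<forall>d\<in>A. smooth_on (snd c ` (fst c \<inter> fst d)) (\<lambda>y. snd d (cinv c y)))"

definition euclidean_atlas :: "('e::euclidean_space, 'e) atlas" where
  "euclidean_atlas = {(UNIV, \<lambda>x. x)}"

definition prod_atlas :: "('m, 'e) atlas \<Rightarrow> ('n, 'f) atlas \<Rightarrow> ('m \<times> 'n, 'e \<times> 'f) atlas" where
  "prod_atlas A B = {(fst c \<times> fst d, map_prod (snd c) (snd d)) | c d. c \<in> A \<and> d \<in> B}"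

definition smooth_map_on ::
    "('m::topological_space, 'e::euclidean_space) atlas \<Rightarrow> 'm set \<Rightarrow>
     ('n::topological_space, 'f::euclidean_space) atlas \<Rightarrow> ('m \<Rightarrow> 'n) \<Rightarrow> bool" where
  "smooth_map_on A U B f \<longleftrightarrow> continuous_on U f \<and>
     (\<forall>c\<in>A. \<forall>d\<in>B. smooth_on (snd c ` (fst c \<inter> U \<inter> f -` fst d)) (\<lambda>y. snd d (f (cinv c y))))"

abbreviation smooth_fun :: "('m::topological_space, 'e::euclidean_space) atlas \<Rightarrow> ('m \<Rightarrow> real) \<Rightarrow> bool" where
  "smooth_fun A f \<equiv> smooth_map_on A UNIV euclidean_atlas f"


section \<open>Tangent vectors and tensor fields\<close>

text \<open>
  A tangent vector at \<open>p\<close> is represented by its coordinate vector in the chart \<open>chart_at A p\<close>,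
  selected once and for all at \<open>p\<close>. So every tangent space is the model space \<open>'e\<close>, and a tensor
  field is a function of the point with values in tensors on \<open>'e\<close>. Since \<open>chart_at\<close> need not
  vary continuously, smoothness is always expressed in the coordinates of a fixed chart \<open>c\<close>:
  \<open>frame A c p\<close> sends a coordinate vector with respect to \<open>c\<close> to the tangent vector at \<open>p\<close>
  it represents, and \<open>coframe A c p\<close> is its inverse.
\<close>

definition chart_at :: "('m, 'e) atlas \<Rightarrow> 'm \<Rightarrow> ('m, 'e) chart" where
  "chart_at A p = (SOME c. c \<in> A \<and> p \<in> fst c)"

definition frame :: "('m, 'e::euclidean_space) atlas \<Rightarrow> ('m, 'e) chart \<Rightarrow> 'm \<Rightarrow> 'e \<Rightarrow> 'e" where
  "frame A c p = frechet_derivative (\<lambda>y. snd (chart_at A p) (cinv c y)) (at (snd c p))"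

definition coframe :: "('m, 'e::euclidean_space) atlas \<Rightarrow> ('m, 'e) chart \<Rightarrow> 'm \<Rightarrow> 'e \<Rightarrow> 'e" where
  "coframe A c p =
     frechet_derivative (\<lambda>y. snd c (cinv (chart_at A p) y)) (at (snd (chart_at A p) p))"

definition tangent_map ::
    "('m, 'e::euclidean_space) atlas \<Rightarrow> ('n, 'f::euclidean_space) atlas \<Rightarrow> ('m \<Rightarrow> 'n) \<Rightarrow> 'm \<Rightarrow> 'e \<Rightarrow> 'f" where
  "tangent_map A B f p =
     frechet_derivative (\<lambda>y. snd (chart_at B (f p)) (f (cinv (chart_at A p) y)))
       (at (snd (chart_at A p) p))"

type_synonym ('m, 'e) vector_field = "'m \<Rightarrow> 'e"
type_synonym ('m, 'e) form1 = "'m \<Rightarrow> 'e \<Rightarrow> real"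
type_synonym ('m, 'e) tensor2 = "'m \<Rightarrow> 'e \<Rightarrow> 'e \<Rightarrow> real"
type_synonym ('m, 'e) endo_field = "'m \<Rightarrow> 'e \<Rightarrow> 'e"

definition smooth_vector_field :: "('m, 'e::euclidean_space) atlas \<Rightarrow> ('m, 'e) vector_field \<Rightarrow> bool" where
  "smooth_vector_field A X \<longleftrightarrow>
     (\<forall>c\<in>A. smooth_on (snd c ` fst c) (\<lambda>y. coframe A c (cinv c y) (X (cinv c y))))"

definition smooth_form1 :: "('m, 'e::euclidean_space) atlas \<Rightarrow> ('m, 'e) form1 \<Rightarrow> bool" where
  "smooth_form1 A \<alpha> \<longleftrightarrow> (\<forall>p. linear (\<alpha> p)) \<and>
     (\<forall>c\<in>A. \<forall>v. smooth_on (snd c ` fst c) (\<lambda>y. \<alpha> (cinv c y) (frame A c (cinv c y) v)))"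

definition smooth_tensor2 :: "('m, 'e::euclidean_space) atlas \<Rightarrow> ('m, 'e) tensor2 \<Rightarrow> bool" where
  "smooth_tensor2 A g \<longleftrightarrow> (\<forall>p. bilinear (g p)) \<and>
     (\<forall>c\<in>A. \<forall>u v. smooth_on (snd c ` fst c)
        (\<lambda>y. g (cinv c y) (frame A c (cinv c y) u) (frame A c (cinv c y) v)))"

definition smooth_form2 :: "('m, 'e::euclidean_space) atlas \<Rightarrow> ('m, 'e) tensor2 \<Rightarrow> bool" where
  "smooth_form2 A F \<longleftrightarrow> smooth_tensor2 A F \<and> (\<forall>p u v. F p u v = - F p v u)"

definition smooth_endo :: "('m, 'e::euclidean_space) atlas \<Rightarrow> ('m, 'e) endo_field \<Rightarrow> bool" where
  "smooth_endo A J \<longleftrightarrow> (\<forall>p. linear (J p)) \<and>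
     (\<forall>c\<in>A. \<forall>v. smooth_on (snd c ` fst c)
        (\<lambda>y. coframe A c (cinv c y) (J (cinv c y) (frame A c (cinv c y) v))))"


section \<open>Exterior calculus and Lie bracket\<close>

text \<open>
  At \<open>p\<close> everything is computed in the chart \<open>chart_at A p\<close>, whose coordinate vectors at \<open>p\<close>
  are by definition the tangent vectors at \<open>p\<close>. Conventions:
  \<open>(\<alpha> \<and> \<beta>)(u, v) = \<alpha>(u) \<beta>(v) - \<alpha>(v) \<beta>(u)\<close> and
  \<open>d\<alpha>(U, V) = U \<alpha>(V) - V \<alpha>(U) - \<alpha>([U, V])\<close>.
\<close>

definition wedge :: "('e \<Rightarrow> real) \<Rightarrow> ('e \<Rightarrow> real) \<Rightarrow> 'e \<Rightarrow> 'e \<Rightarrow> real" where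
  "wedge \<alpha> \<beta> u v = \<alpha> u * \<beta> v - \<alpha> v * \<beta> u"

definition ext0 :: "('m, 'e::euclidean_space) atlas \<Rightarrow> ('m \<Rightarrow> real) \<Rightarrow> ('m, 'e) form1" where
  "ext0 A f p = frechet_derivative (\<lambda>y. f (cinv (chart_at A p) y)) (at (snd (chart_at A p) p))"

definition ext1 :: "('m, 'e::euclidean_space) atlas \<Rightarrow> ('m, 'e) form1 \<Rightarrow> ('m, 'e) tensor2" where
  "ext1 A \<alpha> p u v =
     (let c = chart_at A p;
          comp = (\<lambda>w y. \<alpha> (cinv c y) (frame A c (cinv c y) w));
          D = (\<lambda>w f. frechet_derivative f (at (snd c p)) w)
      in D u (comp v) - D v (comp u))"

definition ext2 :: "('m, 'e::euclidean_space) atlas \<Rightarrow> ('m, 'e) tensor2 \<Rightarrow> 'm \<Rightarrow> 'e \<Rightarrow> 'e \<Rightarrow> 'e \<Rightarrow> real" where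
  "ext2 A \<omega> p u v w =
     (let c = chart_at A p;
          comp = (\<lambda>a b y. \<omega> (cinv c y) (frame A c (cinv c y) a) (frame A c (cinv c y) b));
          D = (\<lambda>a f. frechet_derivative f (at (snd c p)) a)
      in D u (comp v w) + D v (comp w u) + D w (comp u v))"

definition lie_bracket ::
    "('m, 'e::euclidean_space) atlas \<Rightarrow> ('m, 'e) vector_field \<Rightarrow> ('m, 'e) vector_field \<Rightarrow> ('m, 'e) vector_field" where
  "lie_bracket A X Y p =
     (let c = chart_at A p;
          comp = (\<lambda>V y. coframe A c (cinv c y) (V (cinv c y)));
          D = (\<lambda>w f. frechet_derivative f (at (snd c p)) w)
      in D (X p) (comp Y) - D (Y p) (comp X))"


section \<open>HyperKaehler structures\<close>

definition omega :: "('m, 'e) tensor2 \<Rightarrow> ('m, 'e) endo_field \<Rightarrow> ('m, 'e) tensor2" where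
  "omega g J p u v = g p (J p u) v"

text \<open>The metric is not required to be definite, so that deformed metrics are covered.\<close>
definition almost_hyperhermitian ::
    "('m, 'e::euclidean_space) atlas \<Rightarrow> ('m, 'e) tensor2 \<Rightarrow> ('m, 'e) endo_field \<Rightarrow>
     ('m, 'e) endo_field \<Rightarrow> ('m, 'e) endo_field \<Rightarrow> bool" where
  "almost_hyperhermitian A g I J K \<longleftrightarrow>
     smooth_tensor2 A g \<and> (\<forall>p u v. g p u v = g p v u) \<and>
     (\<forall>p u. (\<forall>v. g p u v = 0) \<longrightarrow> u = 0) \<and>
     smooth_endo A I \<and> smooth_endo A J \<and> smooth_endo A K \<and>
     (\<forall>p v. I p (I p v) = - v \<and> J p (J p v) = - v \<and> K p (K p v) = - v \<and>
            I p (J p v) = K p v \<and> J p (I p v) = - K p v) \<and>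
     (\<forall>p u v. g p (I p u) (I p v) = g p u v \<and> g p (J p u) (J p v) = g p u v \<and>
              g p (K p u) (K p v) = g p u v)"

text \<open>Vanishing of the Nijenhuis tensor.\<close>
definition integrable_acs :: "('m, 'e::euclidean_space) atlas \<Rightarrow> ('m, 'e) endo_field \<Rightarrow> bool" where
  "integrable_acs A J \<longleftrightarrow>
     (\<forall>U V. smooth_vector_field A U \<longrightarrow> smooth_vector_field A V \<longrightarrow>
       (\<forall>p. lie_bracket A (\<lambda>q. J q (U q)) (\<lambda>q. J q (V q)) p
            - J p (lie_bracket A (\<lambda>q. J q (U q)) V p)
            - J p (lie_bracket A U (\<lambda>q. J q (V q)) p)
            - lie_bracket A U V p = 0))"

definition hyperkaehler ::
    "('m::{t2_space,second_countable_topology}, 'e::euclidean_space) atlas \<Rightarrow> ('m, 'e) tensor2 \<Rightarrow>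
     ('m, 'e) endo_field \<Rightarrow> ('m, 'e) endo_field \<Rightarrow> ('m, 'e) endo_field \<Rightarrow> bool" where
  "hyperkaehler A g I J K \<longleftrightarrow>
     smooth_manifold A \<and> almost_hyperhermitian A g I J K \<and>
     (\<forall>p v. v \<noteq> 0 \<longrightarrow> g p v v > 0) \<and>
     integrable_acs A I \<and> integrable_acs A J \<and> integrable_acs A K \<and>
     (\<forall>p u v w. ext2 A (omega g I) p u v w = 0 \<and> ext2 A (omega g J) p u v w = 0 \<and>
                ext2 A (omega g K) p u v w = 0)"


section \<open>Circle actions\<close>

text \<open>An action of \<open>\<real> / T\<int>\<close>, written as a \<open>T\<close>-periodic flow, with generator \<open>X\<close>.\<close>
definition circle_action ::
    "('m::topological_space, 'e::euclidean_space) atlas \<Rightarrow> real \<Rightarrow> (real \<Rightarrow> 'm \<Rightarrow> 'm) \<Rightarrow>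
     ('m, 'e) vector_field \<Rightarrow> bool" where
  "circle_action A T \<phi> X \<longleftrightarrow> T > 0 \<and>
     (\<forall>p. \<phi> 0 p = p) \<and> (\<forall>s t p. \<phi> (s + t) p = \<phi> s (\<phi> t p)) \<and> (\<forall>p. \<phi> T p = p) \<and>
     smooth_map_on (prod_atlas euclidean_atlas A) UNIV A (\<lambda>(t, p). \<phi> t p) \<and>
     smooth_vector_field A X \<and>
     (\<forall>p. ((\<lambda>t. snd (chart_at A p) (\<phi> t p)) has_vector_derivative X p) (at 0))"

definition effective_action :: "real \<Rightarrow> (real \<Rightarrow> 'm \<Rightarrow> 'm) \<Rightarrow> bool" where
  "effective_action T \<phi> \<longleftrightarrow> (\<forall>t. (\<forall>p. \<phi> t p = p) \<longrightarrow> (\<exists>k::int. t = of_int k * T))"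

definition free_action :: "real \<Rightarrow> (real \<Rightarrow> 'm \<Rightarrow> 'm) \<Rightarrow> bool" where
  "free_action T \<phi> \<longleftrightarrow> (\<forall>t p. \<phi> t p = p \<longrightarrow> (\<exists>k::int. t = of_int k * T))"

definition invariant_form1 ::
    "('m, 'e::euclidean_space) atlas \<Rightarrow> (real \<Rightarrow> 'm \<Rightarrow> 'm) \<Rightarrow> ('m, 'e) form1 \<Rightarrow> bool" where
  "invariant_form1 A \<phi> \<alpha> \<longleftrightarrow> (\<forall>t p u. \<alpha> (\<phi> t p) (tangent_map A A (\<phi> t) p u) = \<alpha> p u)"

definition invariant_tensor2 ::
    "('m, 'e::euclidean_space) atlas \<Rightarrow> (real \<Rightarrow> 'm \<Rightarrow> 'm) \<Rightarrow> ('m, 'e) tensor2 \<Rightarrow> bool" where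
  "invariant_tensor2 A \<phi> g \<longleftrightarrow>
     (\<forall>t p u v. g (\<phi> t p) (tangent_map A A (\<phi> t) p u) (tangent_map A A (\<phi> t) p v) = g p u v)"

definition invariant_endo ::
    "('m, 'e::euclidean_space) atlas \<Rightarrow> (real \<Rightarrow> 'm \<Rightarrow> 'm) \<Rightarrow> ('m, 'e) endo_field \<Rightarrow> bool" where
  "invariant_endo A \<phi> J \<longleftrightarrow>
     (\<forall>t p u. J (\<phi> t p) (tangent_map A A (\<phi> t) p u) = tangent_map A A (\<phi> t) p (J p u))"

definition invariant_structure ::
    "('m, 'e::euclidean_space) atlas \<Rightarrow> (real \<Rightarrow> 'm \<Rightarrow> 'm) \<Rightarrow> ('m, 'e) tensor2 \<Rightarrow>
     ('m, 'e) endo_field \<Rightarrow> ('m, 'e) endo_field \<Rightarrow> ('m, 'e) endo_field \<Rightarrow> bool" where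
  "invariant_structure A \<phi> g I J K \<longleftrightarrow>
     invariant_tensor2 A \<phi> g \<and> invariant_endo A \<phi> I \<and> invariant_endo A \<phi> J \<and> invariant_endo A \<phi> K"


section \<open>Elementary deformations\<close>

definition flat :: "('m, 'e) tensor2 \<Rightarrow> ('m, 'e) vector_field \<Rightarrow> ('m, 'e) form1" where
  "flat g X p v = g p (X p) v"

definition alpha :: "('m, 'e) tensor2 \<Rightarrow> ('m, 'e) endo_field \<Rightarrow> ('m, 'e) vector_field \<Rightarrow> ('m, 'e) form1" where
  "alpha g J X p v = omega g J p (X p) v"

definition norm_sq :: "('m, 'e) tensor2 \<Rightarrow> ('m, 'e) vector_field \<Rightarrow> 'm \<Rightarrow> real" where
  "norm_sq g X p = g p (X p) (X p)"

definition g_HX ::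
    "('m, 'e) tensor2 \<Rightarrow> ('m, 'e) endo_field \<Rightarrow> ('m, 'e) endo_field \<Rightarrow> ('m, 'e) endo_field \<Rightarrow>
     ('m, 'e) vector_field \<Rightarrow> ('m, 'e) tensor2" where
  "g_HX g I J K X p u v =
     flat g X p u * flat g X p v + alpha g I X p u * alpha g I X p v
     + alpha g J X p u * alpha g J X p v + alpha g K X p u * alpha g K X p v"

definition elementary_deformation ::
    "('m, 'e) tensor2 \<Rightarrow> ('m, 'e) endo_field \<Rightarrow> ('m, 'e) endo_field \<Rightarrow> ('m, 'e) endo_field \<Rightarrow>
     ('m, 'e) vector_field \<Rightarrow> ('m \<Rightarrow> real) \<Rightarrow> ('m, 'e) tensor2" where
  "elementary_deformation g I J K X h p u v = g p u v + h p * g_HX g I J K X p u v"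

text \<open>
  The linear map on the span of the linearly independent covectors \<open>a\<close>, \<open>b\<close>, \<open>c\<close> with
  \<open>*a = b \<and> c\<close>, \<open>*b = c \<and> a\<close>, \<open>*c = a \<and> b\<close>; meaningless for \<open>\<beta>\<close> outside the span.
\<close>
definition star3 ::
    "('e \<Rightarrow> real) \<Rightarrow> ('e \<Rightarrow> real) \<Rightarrow> ('e \<Rightarrow> real) \<Rightarrow> ('e \<Rightarrow> real) \<Rightarrow> 'e \<Rightarrow> 'e \<Rightarrow> real" where
  "star3 a b c \<beta> = (THE \<eta>. \<exists>x y z.
     \<beta> = (\<lambda>w. x * a w + y * b w + z * c w) \<and>
     \<eta> = (\<lambda>u v. x * wedge b c u v + y * wedge c a u v + z * wedge a b u v))"

definition star_d ::
    "('m, 'e::euclidean_space) atlas \<Rightarrow> ('m, 'e) tensor2 \<Rightarrow> ('m, 'e) endo_field \<Rightarrow> ('m, 'e) endo_field \<Rightarrow>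
     ('m, 'e) endo_field \<Rightarrow> ('m, 'e) vector_field \<Rightarrow> ('m \<Rightarrow> real) \<Rightarrow> ('m, 'e) tensor2" where
  "star_d A g I J K X h p =
     star3 (alpha g I X p) (alpha g J X p) (alpha g K X p) (ext0 A h p)"

text \<open>The conditions at points with \<open>X p \<noteq> 0\<close> are those on the open set \<open>M'\<close>.\<close>
definition elementary_twist_data ::
    "('m::topological_space, 'e::euclidean_space) atlas \<Rightarrow> ('m, 'e) tensor2 \<Rightarrow> ('m, 'e) endo_field \<Rightarrow>
     ('m, 'e) endo_field \<Rightarrow> ('m, 'e) endo_field \<Rightarrow> ('m, 'e) vector_field \<Rightarrow>
     ('m \<Rightarrow> real) \<Rightarrow> real \<Rightarrow> ('m \<Rightarrow> real) \<Rightarrow> ('m, 'e) tensor2 \<Rightarrow> bool" where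
  "elementary_twist_data A g I J K X h lam a F \<longleftrightarrow>
     smooth_fun A h \<and> lam \<noteq> 0 \<and>
     (\<forall>p. X p \<noteq> 0 \<longrightarrow>
        a p = lam * (1 + h p * norm_sq g X p) \<and> a p \<noteq> 0 \<and>
        (\<exists>x y z. ext0 A h p =
           (\<lambda>w. x * alpha g I X p w + y * alpha g J X p w + z * alpha g K X p w)) \<and>
        (\<forall>u v. F p u v =
           lam * (ext1 A (\<lambda>q w. h q * flat g X q w) p u v + star_d A g I J K X h p u v)) \<and>
        (\<forall>u v w. ext2 A (star_d A g I J K X h) p u v w = 0))"


section \<open>The twist construction\<close>

definition twist_data ::
    "('m::topological_space, 'e::euclidean_space) atlas \<Rightarrow> real \<Rightarrow> (real \<Rightarrow> 'm \<Rightarrow> 'm) \<Rightarrow>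
     ('m, 'e) vector_field \<Rightarrow> ('m \<Rightarrow> real) \<Rightarrow> ('m, 'e) tensor2 \<Rightarrow> bool" where
  "twist_data A T \<phi> X a F \<longleftrightarrow>
     circle_action A T \<phi> X \<and>
     smooth_form2 A F \<and> (\<forall>p u v w. ext2 A F p u v w = 0) \<and> invariant_tensor2 A \<phi> F \<and>
     smooth_fun A a \<and> (\<forall>p. a p \<noteq> 0) \<and>
     (\<forall>p v. ext0 A a p v = - F p (X p) v)"

text \<open>
  Local triviality: over \<open>U\<close> there are a smooth section \<open>s\<close> and a smooth equivariant map \<open>\<tau>\<close> to the
  unit circle with \<open>\<tau> \<circ> s = 1\<close>. Then \<open>p \<mapsto> (\<pi> p, \<tau> p)\<close> is an equivariant smooth trivialisation
  with smooth inverse \<open>(x, cis (2 * pi * t / S)) \<mapsto> \<psi> t (s x)\<close>.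
\<close>
definition principal_circle_bundle ::
    "('p::{t2_space,second_countable_topology}, 'q::euclidean_space) atlas \<Rightarrow>
     ('m::{t2_space,second_countable_topology}, 'e::euclidean_space) atlas \<Rightarrow>
     ('p \<Rightarrow> 'm) \<Rightarrow> real \<Rightarrow> (real \<Rightarrow> 'p \<Rightarrow> 'p) \<Rightarrow> ('p, 'q) vector_field \<Rightarrow> bool" where
  "principal_circle_bundle B A \<pi> S \<psi> Z \<longleftrightarrow>
     smooth_manifold B \<and> smooth_manifold A \<and> smooth_map_on B UNIV A \<pi> \<and>
     circle_action B S \<psi> Z \<and> free_action S \<psi> \<and>
     (\<forall>p q. \<pi> p = \<pi> q \<longleftrightarrow> (\<exists>t. q = \<psi> t p)) \<and>
     (\<forall>x. \<exists>U s (\<tau> :: 'p \<Rightarrow> complex). open U \<and> x \<in> U \<and>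
        smooth_map_on A U B s \<and> (\<forall>y\<in>U. \<pi> (s y) = y) \<and>
        smooth_map_on B (\<pi> -` U) euclidean_atlas \<tau> \<and>
        (\<forall>p\<in>\<pi> -` U. norm (\<tau> p) = 1 \<and> (\<forall>t. \<tau> (\<psi> t p) = cis (2 * pi * t / S) * \<tau> p)) \<and>
        (\<forall>y\<in>U. \<tau> (s y) = 1))"

definition principal_connection ::
    "('p, 'q::euclidean_space) atlas \<Rightarrow> (real \<Rightarrow> 'p \<Rightarrow> 'p) \<Rightarrow> ('p, 'q) vector_field \<Rightarrow> ('p, 'q) form1 \<Rightarrow> bool" where
  "principal_connection B \<psi> Z \<theta> \<longleftrightarrow>
     smooth_form1 B \<theta> \<and> invariant_form1 B \<psi> \<theta> \<and> (\<forall>p. \<theta> p (Z p) = 1)"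

text \<open>The vector of \<open>ker \<theta>\<close> at \<open>p\<close> lying over the tangent vector \<open>w\<close> at \<open>\<pi> p\<close>.\<close>
definition hlift ::
    "('p, 'q::euclidean_space) atlas \<Rightarrow> ('m, 'e::euclidean_space) atlas \<Rightarrow> ('p \<Rightarrow> 'm) \<Rightarrow>
     ('p, 'q) form1 \<Rightarrow> 'p \<Rightarrow> 'e \<Rightarrow> 'q" where
  "hlift B A \<pi> \<theta> p w = (THE u. \<theta> p u = 0 \<and> tangent_map B A \<pi> p u = w)"

text \<open>The vector field \<open>X'\<close>: horizontal lift of \<open>X\<close> plus \<open>a Z\<close>.\<close>
definition lifted_field ::
    "('p, 'q::euclidean_space) atlas \<Rightarrow> ('m, 'e::euclidean_space) atlas \<Rightarrow> ('p \<Rightarrow> 'm) \<Rightarrow>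
     ('p, 'q) form1 \<Rightarrow> ('p, 'q) vector_field \<Rightarrow> ('m, 'e) vector_field \<Rightarrow> ('m \<Rightarrow> real) \<Rightarrow>
     ('p, 'q) vector_field" where
  "lifted_field B A \<pi> \<theta> Z X a p = hlift B A \<pi> \<theta> p (X (\<pi> p)) + a (\<pi> p) *\<^sub>R Z p"

text \<open>
  \<open>W\<close> (atlas \<open>C\<close>) is the twist of \<open>M\<close> (atlas \<open>A\<close>) with respect to \<open>(X, a, F)\<close>, via the circle
  bundle \<open>P\<close> (atlas \<open>B\<close>) over \<open>M\<close> with projection \<open>\<pi>\<^sub>M\<close>, action \<open>\<psi>\<close> generated by \<open>Z\<close>, and
  connection \<open>\<theta>\<close>. The field \<open>X'\<close> generates a free circle action \<open>\<rho>\<close> on \<open>P\<close>, and \<open>\<pi>\<^sub>W\<close> is the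
  smooth quotient map onto \<open>W = P / \<langle>X'\<rangle>\<close>.
\<close>
definition is_twist ::
    "('m::{t2_space,second_countable_topology}, 'e::euclidean_space) atlas \<Rightarrow>
     ('p::{t2_space,second_countable_topology}, 'q::euclidean_space) atlas \<Rightarrow>
     ('w::{t2_space,second_countable_topology}, 'f::euclidean_space) atlas \<Rightarrow>
     ('p \<Rightarrow> 'm) \<Rightarrow> ('p \<Rightarrow> 'w) \<Rightarrow>
     real \<Rightarrow> (real \<Rightarrow> 'm \<Rightarrow> 'm) \<Rightarrow> ('m, 'e) vector_field \<Rightarrow> ('m \<Rightarrow> real) \<Rightarrow> ('m, 'e) tensor2 \<Rightarrow>
     real \<Rightarrow> (real \<Rightarrow> 'p \<Rightarrow> 'p) \<Rightarrow> ('p, 'q) vector_field \<Rightarrow> ('p, 'q) form1 \<Rightarrow>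
     real \<Rightarrow> (real \<Rightarrow> 'p \<Rightarrow> 'p) \<Rightarrow> bool" where
  "is_twist A B C \<pi>M \<pi>W T \<phi> X a F S \<psi> Z \<theta> R \<rho> \<longleftrightarrow>
     twist_data A T \<phi> X a F \<and>
     principal_circle_bundle B A \<pi>M S \<psi> Z \<and>
     principal_connection B \<psi> Z \<theta> \<and>
     (\<forall>p u v. ext1 B \<theta> p u v = F (\<pi>M p) (tangent_map B A \<pi>M p u) (tangent_map B A \<pi>M p v)) \<and>
     principal_circle_bundle B C \<pi>W R \<rho> (lifted_field B A \<pi>M \<theta> Z X a)"

text \<open>
  The relations \<open>\<alpha>\<^sub>W \<sim>\<^sub>H \<alpha>\<close> for \<open>H = ker \<theta>\<close>. The arguments \<open>A\<close>, \<open>\<pi>M\<close> refer to the object given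
  last, and \<open>C\<close>, \<open>\<pi>W\<close> to the one before it.
\<close>

definition fun_related :: "('p \<Rightarrow> 'm) \<Rightarrow> ('p \<Rightarrow> 'w) \<Rightarrow> ('w \<Rightarrow> real) \<Rightarrow> ('m \<Rightarrow> real) \<Rightarrow> bool" where
  "fun_related \<pi>M \<pi>W fW f \<longleftrightarrow> (\<forall>p. fW (\<pi>W p) = f (\<pi>M p))"

definition vector_related ::
    "('m, 'e::euclidean_space) atlas \<Rightarrow> ('p, 'q::euclidean_space) atlas \<Rightarrow> ('w, 'f::euclidean_space) atlas \<Rightarrow>
     ('p \<Rightarrow> 'm) \<Rightarrow> ('p \<Rightarrow> 'w) \<Rightarrow> ('p, 'q) form1 \<Rightarrow>
     ('w, 'f) vector_field \<Rightarrow> ('m, 'e) vector_field \<Rightarrow> bool" where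
  "vector_related A B C \<pi>M \<pi>W \<theta> XW X \<longleftrightarrow>
     (\<forall>p. hlift B C \<pi>W \<theta> p (XW (\<pi>W p)) = hlift B A \<pi>M \<theta> p (X (\<pi>M p)))"

definition tensor2_related ::
    "('m, 'e::euclidean_space) atlas \<Rightarrow> ('p, 'q::euclidean_space) atlas \<Rightarrow> ('w, 'f::euclidean_space) atlas \<Rightarrow>
     ('p \<Rightarrow> 'm) \<Rightarrow> ('p \<Rightarrow> 'w) \<Rightarrow> ('p, 'q) form1 \<Rightarrow>
     ('w, 'f) tensor2 \<Rightarrow> ('m, 'e) tensor2 \<Rightarrow> bool" where
  "tensor2_related A B C \<pi>M \<pi>W \<theta> gW g \<longleftrightarrow>
     (\<forall>p u v. \<theta> p u = 0 \<longrightarrow> \<theta> p v = 0 \<longrightarrow>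
        gW (\<pi>W p) (tangent_map B C \<pi>W p u) (tangent_map B C \<pi>W p v) =
        g (\<pi>M p) (tangent_map B A \<pi>M p u) (tangent_map B A \<pi>M p v))"

definition endo_related ::
    "('m, 'e::euclidean_space) atlas \<Rightarrow> ('p, 'q::euclidean_space) atlas \<Rightarrow> ('w, 'f::euclidean_space) atlas \<Rightarrow>
     ('p \<Rightarrow> 'm) \<Rightarrow> ('p \<Rightarrow> 'w) \<Rightarrow> ('p, 'q) form1 \<Rightarrow>
     ('w, 'f) endo_field \<Rightarrow> ('m, 'e) endo_field \<Rightarrow> bool" where
  "endo_related A B C \<pi>M \<pi>W \<theta> JW J \<longleftrightarrow>
     (\<forall>p u. \<theta> p u = 0 \<longrightarrow>
        hlift B C \<pi>W \<theta> p (JW (\<pi>W p) (tangent_map B C \<pi>W p u)) =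
        hlift B A \<pi>M \<theta> p (J (\<pi>M p) (tangent_map B A \<pi>M p u)))"

text \<open>The structure on \<open>W\<close> is the twist of the \<open>\<phi>\<close>-invariant structure on \<open>M\<close>.\<close>
definition twisted_structure ::
    "('m, 'e::euclidean_space) atlas \<Rightarrow> ('p, 'q::euclidean_space) atlas \<Rightarrow> ('w, 'f::euclidean_space) atlas \<Rightarrow>
     ('p \<Rightarrow> 'm) \<Rightarrow> ('p \<Rightarrow> 'w) \<Rightarrow> ('p, 'q) form1 \<Rightarrow> (real \<Rightarrow> 'm \<Rightarrow> 'm) \<Rightarrow>
     ('m, 'e) tensor2 \<Rightarrow> ('m, 'e) endo_field \<Rightarrow> ('m, 'e) endo_field \<Rightarrow> ('m, 'e) endo_field \<Rightarrow>
     ('w, 'f) tensor2 \<Rightarrow> ('w, 'f) endo_field \<Rightarrow> ('w, 'f) endo_field \<Rightarrow> ('w, 'f) endo_field \<Rightarrow> bool" where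
  "twisted_structure A B C \<pi>M \<pi>W \<theta> \<phi> g I J K gW IW JW KW \<longleftrightarrow>
     almost_hyperhermitian A g I J K \<and> invariant_structure A \<phi> g I J K \<and>
     almost_hyperhermitian C gW IW JW KW \<and>
     tensor2_related A B C \<pi>M \<pi>W \<theta> gW g \<and>
     endo_related A B C \<pi>M \<pi>W \<theta> IW I \<and>
     endo_related A B C \<pi>M \<pi>W \<theta> JW J \<and>
     endo_related A B C \<pi>M \<pi>W \<theta> KW K"

end

theory Submission
  imports Defs
begin

text \<open>
  Both circle actions on \<open>P\<close> commute, so the roles of \<open>M\<close> and \<open>W\<close> can be exchanged: the principal
  action \<open>\<psi>\<close> descends to \<open>W\<close>, where it is generated by \<open>XW\<close>, and \<open>\<theta> / a\<close> is a connection for the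
  other projection with the same kernel \<open>H\<close>. Its curvature descends to \<open>FW\<close>, because
  \<open>da = - X \<rfloor> F\<close> is exactly Cartan's formula for the invariance of \<open>\<theta>\<close> under \<open>X'\<close>. All pointwise
  identities are checked through the isomorphism \<open>\<Phi>\<close> of tangent spaces of \<open>M\<close> and \<open>W\<close> given by \<open>H\<close>,
  under which \<open>\<alpha>\<^sub>A\<close> on \<open>W\<close> corresponds to \<open>- \<alpha>\<^sub>A / \<lambda>\<close> on \<open>M\<close>. In local sections \<open>s\<close> of \<open>P\<close>, the form
  \<open>FW\<close> is the differential of the pull-back of \<open>\<theta> / a\<close>, which gives its smoothness and closedness, and
  hence also \<open>d *\<^sub>3 dhW = 0\<close>.
\<close>

section \<open>Smooth functions on Euclidean spaces\<close>

text \<open>The constants come from one computation. Since \<open>X\<close>, \<open>I X\<close>,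
  \<open>J X\<close>, \<open>K X\<close> are orthogonal and of equal length, the deformed metric
  pairs with each of them as 1 + h |X|^2 = a / \<lambda> times the original one; contracting with -X
  / a therefore gives -\<alpha> / \<lambda>. So \<open>g_HX\<close> on W corresponds to
  \<open>g_HX\<close> / \<lambda>^2 on M, and undoing the deformation forces the function
  -\<lambda>^2 h. Then 1 + hW |XW|^2 corresponds to 1 - \<lambda> h |X|^2 / a = \<lambda> / a, and
  the constant 1 / \<lambda> turns this into 1 / a.

  The obstacle is that two choices involved need not be continuous: tangent vectors at a point are
  read in a chart picked separately for that point, and objects on W are defined through an
  arbitrary point of the fibre. Hence the preparation: a chain rule and naturality of d for maps
  smooth near a point, and local sections of P, through which smoothness on W is recovered.\<close>

abbreviation (input) "\<D> f x \<equiv> frechet_derivative f (at x)"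

text \<open>The induction passes to directional derivatives of both functions, so one implication is
  proved for arbitrary functions and the equivalence follows by symmetry. Openness makes the
  derivative at a point of \<open>S\<close> depend only on values in \<open>S\<close>.\<close>

lemma Ck_on_cong:
  fixes f g :: "'e::euclidean_space \<Rightarrow> 'f::euclidean_space"
  assumes "open S" "\<And>x. x \<in> S \<Longrightarrow> f x = g x"
  shows "Ck_on k f S \<longleftrightarrow> Ck_on k g S"
proof -
  have "Ck_on k f S \<Longrightarrow> Ck_on k g S" if "\<And>x. x \<in> S \<Longrightarrow> f x = g x" for f g :: "'e \<Rightarrow> 'f"
    using that
  proof (induction k arbitrary: f g)
    case 0
    then show ?case by (metis Ck_on.simps(1) continuous_on_cong)
  next
    case (Suc k)
    have fd: "f differentiable at x" if "x \<in> S" for x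
      using Suc.prems(1) that \<open>open S\<close> by (auto simp: differentiable_on_def at_within_open_NO_MATCH)
    have eq: "\<D> f x v = \<D> g x v" if "x \<in> S" for x v
      by (simp add: frechet_derivative_transform_within_open[OF fd[OF that] \<open>open S\<close> that Suc.prems(2)])
    have "g differentiable (at x within S)" if "x \<in> S" for x
      using fd[OF that] Suc.prems(2) that \<open>open S\<close>
      by (meson differentiable_at_withinI differentiable_def has_derivative_transform_within_open)
    then have "g differentiable_on S" by (simp add: differentiable_on_def)
    moreover have "Ck_on k (\<lambda>x. \<D> g x v) S" for v
      by (rule Suc.IH[of "\<lambda>x. \<D> f x v"]) (use Suc.prems(1) eq in auto)
    ultimately show ?case by simp
  qed
  with assms show ?thesis by metis
qed

lemma Ck_on_subset:
  assumes "Ck_on k f S" "T \<subseteq> S"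
  shows "Ck_on k f T"
  using assms
  by (induction k arbitrary: f) (auto intro: continuous_on_subset differentiable_on_subset)

text \<open>Locality is what allows smoothness on an open set to be replaced by smoothness near each
  of its points, see \<open>smooth_on_iff_near\<close>.\<close>

lemma Ck_on_UN:
  assumes "\<And>x. x \<in> S \<Longrightarrow> \<exists>T. open T \<and> x \<in> T \<and> Ck_on k f T"
  shows "Ck_on k f S"
  using assms
proof (induction k arbitrary: f)
  case 0
  have "continuous (at x within S) f" if x: "x \<in> S" for x
  proof -
    obtain T where "open T" "x \<in> T" "continuous_on T f" using 0[OF x] by auto
    then have "isCont f x" by (simp add: continuous_on_eq_continuous_at)
    then show ?thesis by (rule continuous_at_imp_continuous_at_within)
  qed
  then show ?case by (simp add: continuous_on_eq_continuous_within)
next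
  case (Suc k)
  have "f differentiable (at x within S)" if x: "x \<in> S" for x
  proof -
    obtain T where "open T" "x \<in> T" "f differentiable_on T" using Suc.prems[OF x] by auto
    then have "f differentiable at x" by (simp add: differentiable_on_def at_within_open_NO_MATCH)
    then show ?thesis by (rule differentiable_at_withinI)
  qed
  moreover have "Ck_on k (\<lambda>x. \<D> f x v) S" for v
  proof (rule Suc.IH)
    fix x assume "x \<in> S"
    from Suc.prems[OF this] obtain T where "open T" "x \<in> T" "Ck_on (Suc k) f T" by blast
    then show "\<exists>T. open T \<and> x \<in> T \<and> Ck_on k (\<lambda>x. \<D> f x v) T"
      by (intro exI[of _ T]) simp
  qed
  ultimately show ?case by (simp add: differentiable_on_def)
qed

lemma Ck_on_SucD: "Ck_on (Suc k) f S \<Longrightarrow> Ck_on k f S"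
  by (induction k arbitrary: f) (auto simp: differentiable_imp_continuous_on)

lemma Ck_on_differentiable: "Ck_on (Suc k) f S \<Longrightarrow> open S \<Longrightarrow> x \<in> S \<Longrightarrow> f differentiable at x"
  by (auto simp: differentiable_on_def at_within_open_NO_MATCH)

lemma Ck_on_const: "Ck_on k (\<lambda>_. c) S"
  by (induction k arbitrary: c) auto

lemma frechet_derivative_eqI: "(f has_derivative D) (at x) \<Longrightarrow> \<D> f x = D"
  using frechet_derivative_at by metis

text \<open>Serves the closure lemmas below: once the derivative is given by a formula in
  \<open>f\<close>, \<open>g\<close> and their derivatives, the induction hypothesis applies to that
  formula.\<close>

lemma Ck_on_SucI:
  assumes "open S" and D: "\<And>x. x \<in> S \<Longrightarrow> (f has_derivative D x) (at x)"
    and "\<And>v. Ck_on k (\<lambda>x. D x v) S"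
  shows "Ck_on (Suc k) f S"
proof -
  have "f differentiable_on S"
    using D by (meson differentiable_def differentiable_on_def has_derivative_at_withinI)
  moreover have "Ck_on k (\<lambda>x. \<D> f x v) S" for v
    using Ck_on_cong[OF \<open>open S\<close>, of "\<lambda>x. \<D> f x v" "\<lambda>x. D x v" k]
      assms(3) frechet_derivative_eqI[OF D] by simp
  ultimately show ?thesis by simp
qed

lemma Ck_on_bounded_linear:
  assumes "bounded_linear L" "open S" "Ck_on k f S"
  shows "Ck_on k (\<lambda>x. L (f x)) S"
  using assms(3)
proof (induction k arbitrary: f)
  case 0
  then show ?case using bounded_linear.continuous_on[OF assms(1)] by simp
next
  case (Suc k)
  have "((\<lambda>x. L (f x)) has_derivative (\<lambda>v. L (\<D> f x v))) (at x)" if "x \<in> S" for x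
    using bounded_linear.has_derivative[OF assms(1)] Ck_on_differentiable[OF Suc.prems assms(2) that]
      frechet_derivative_works by blast
  then show ?case
    by (rule Ck_on_SucI[OF assms(2)]) (use Suc in auto)
qed

lemma Ck_on_add:
  assumes "open S" "Ck_on k f S" "Ck_on k g S"
  shows "Ck_on k (\<lambda>x. f x + g x) S"
  using assms(2,3)
proof (induction k arbitrary: f g)
  case (Suc k)
  have "((\<lambda>x. f x + g x) has_derivative (\<lambda>v. \<D> f x v + \<D> g x v)) (at x)"
    if "x \<in> S" for x
    using Ck_on_differentiable[OF Suc.prems(1) assms(1) that] Ck_on_differentiable[OF Suc.prems(2) assms(1) that]
    by (intro has_derivative_add) (simp_all add: frechet_derivative_works)
  then show ?case by (rule Ck_on_SucI[OF assms(1)]) (use Suc in auto)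
qed (auto intro: continuous_on_add)

lemma Ck_on_bounded_bilinear:
  assumes "bounded_bilinear P" "open S" "Ck_on k f S" "Ck_on k g S"
  shows "Ck_on k (\<lambda>x. P (f x) (g x)) S"
  using assms(3,4)
proof (induction k arbitrary: f g)
  case 0
  then show ?case using bounded_bilinear.continuous_on[OF assms(1)] by simp
next
  case (Suc k)
  have "((\<lambda>x. P (f x) (g x)) has_derivative
     (\<lambda>v. P (f x) (\<D> g x v) + P (\<D> f x v) (g x))) (at x)" if "x \<in> S" for x
    using Ck_on_differentiable[OF Suc.prems(1) assms(2) that] Ck_on_differentiable[OF Suc.prems(2) assms(2) that]
    by (intro bounded_bilinear.FDERIV[OF assms(1)]) (simp_all add: frechet_derivative_works)
  then show ?case
  proof (rule Ck_on_SucI[OF assms(2)])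
    fix v
    show "Ck_on k (\<lambda>x. P (f x) (\<D> g x v) + P (\<D> f x v) (g x)) S"
      using Suc.prems Ck_on_SucD[OF Suc.prems(1)] Ck_on_SucD[OF Suc.prems(2)]
      by (intro Ck_on_add Suc.IH assms(2)) auto
  qed
qed

lemma Ck_on_sum:
  assumes "open S" "finite J" "\<And>i. i \<in> J \<Longrightarrow> Ck_on k (f i) S"
  shows "Ck_on k (\<lambda>x. \<Sum>i\<in>J. f i x) S"
  using assms(2,3) by (induction J rule: finite_induct) (auto intro: Ck_on_const Ck_on_add assms(1))

lemma Ck_on_inverse:
  fixes f :: "'e::euclidean_space \<Rightarrow> real"
  assumes "open S" "Ck_on k f S" "\<And>x. x \<in> S \<Longrightarrow> f x \<noteq> 0"
  shows "Ck_on k (\<lambda>x. inverse (f x)) S"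
  using assms(2)
proof (induction k)
  case 0
  then show ?case using assms(3) by (auto intro: continuous_on_inverse)
next
  case (Suc k)
  have "((\<lambda>x. inverse (f x)) has_derivative (\<lambda>v. - (inverse (f x) * \<D> f x v * inverse (f x)))) (at x)"
    if "x \<in> S" for x
    using Ck_on_differentiable[OF Suc.prems assms(1) that] assms(3)[OF that]
    by (intro Deriv.has_derivative_inverse) (simp_all add: frechet_derivative_works)
  then show ?case
  proof (rule Ck_on_SucI[OF assms(1)])
    fix v
    have "Ck_on k (\<lambda>x. inverse (f x)) S" "Ck_on k (\<lambda>x. \<D> f x v) S"
      using Suc.IH[OF Ck_on_SucD[OF Suc.prems]] Suc.prems by auto
    then show "Ck_on k (\<lambda>x. - (inverse (f x) * \<D> f x v * inverse (f x))) S"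
      by (intro Ck_on_bounded_linear[OF bounded_linear_minus[OF bounded_linear_ident]]
          Ck_on_bounded_bilinear[OF bounded_bilinear_mult] assms(1))
  qed
qed

lemma linear_componentwise_expansion:
  fixes L :: "'a::euclidean_space \<Rightarrow> 'b::real_vector"
  assumes "linear L"
  shows "L v = (\<Sum>b\<in>Basis. (v \<bullet> b) *\<^sub>R L b)"
proof -
  have "L (\<Sum>b\<in>Basis. (v \<bullet> b) *\<^sub>R b) = (\<Sum>b\<in>Basis. (v \<bullet> b) *\<^sub>R L b)"
    using assms by (simp add: linear_sum linear_cmul)
  then show ?thesis by (simp add: euclidean_representation)
qed

lemma Ck_on_compose:
  fixes f :: "'e::euclidean_space \<Rightarrow> 'f::euclidean_space" and g :: "'f \<Rightarrow> 'g::euclidean_space"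
  assumes "open S" "open T" "Ck_on k f S" "Ck_on k g T" "f ` S \<subseteq> T"
  shows "Ck_on k (\<lambda>x. g (f x)) S"
  using assms(3,4)
proof (induction k arbitrary: g)
  case 0
  then show ?case using assms(5) by (auto intro: continuous_on_compose2)
next
  case (Suc k)
  \<comment> \<open>In the chain rule the direction fed to the derivative of \<open>g\<close> moves
    with \<open>x\<close>, while \<open>Ck_on\<close> controls derivatives only in fixed directions.
    The basis expansion moves the dependence on \<open>x\<close> into scalar coefficients.\<close>
  let ?D = "\<lambda>x v. \<Sum>b\<in>Basis. (\<D> f x v \<bullet> b) *\<^sub>R \<D> g (f x) b"
  have "((\<lambda>x. g (f x)) has_derivative ?D x) (at x)" if "x \<in> S" for x
  proof -
    have "f x \<in> T" using that assms(5) by auto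
    have g: "g differentiable at (f x)" by (rule Ck_on_differentiable[OF Suc.prems(2) assms(2) \<open>f x \<in> T\<close>])
    have f: "f differentiable at x" by (rule Ck_on_differentiable[OF Suc.prems(1) assms(1) that])
    have "((\<lambda>x. g (f x)) has_derivative (\<lambda>v. \<D> g (f x) (\<D> f x v))) (at x)"
      using f g unfolding frechet_derivative_works by (rule has_derivative_compose)
    moreover have "\<D> g (f x) (\<D> f x v) = ?D x v" for v
      by (rule linear_componentwise_expansion[OF linear_frechet_derivative[OF g]])
    ultimately show ?thesis by simp
  qed
  then show ?case
  proof (rule Ck_on_SucI[OF assms(1)])
    fix v
    have "Ck_on k (\<lambda>x. \<D> g (f x) b) S" for b
      using Suc.IH[of "\<lambda>y. \<D> g y b"] Suc.prems Ck_on_SucD[OF Suc.prems(1)] by simp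
    moreover have "Ck_on k (\<lambda>x. \<D> f x v) S" using Suc.prems by simp
    ultimately show "Ck_on k (\<lambda>x. ?D x v) S"
      by (intro Ck_on_sum Ck_on_bounded_bilinear[OF bounded_bilinear_scaleR]
          Ck_on_bounded_linear[OF bounded_linear_inner_left] assms(1)) auto
  qed
qed

lemma Ck_on_ident: "open S \<Longrightarrow> Ck_on k (\<lambda>x. x) S"
  by (cases k) (auto simp: Ck_on_const continuous_on_id intro!: differentiable_on_ident)

lemma Ck_on_Pair:
  assumes "open S" "Ck_on k f S" "Ck_on k g S"
  shows "Ck_on k (\<lambda>x. (f x, g x)) S"
proof -
  have "Ck_on k (\<lambda>x. (f x, 0) + (0, g x)) S"
    by (intro Ck_on_add Ck_on_bounded_linear[OF _ assms(1,2), of "\<lambda>x. (x, 0)"]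
          Ck_on_bounded_linear[OF _ assms(1,3), of "\<lambda>x. (0, x)"] assms(1) bounded_linear_Pair
          bounded_linear_ident bounded_linear_zero)
  then show ?thesis by simp
qed

text \<open>Asking for a whole neighbourhood makes the notion closed under taking derivatives, and
  it ignores the arbitrary values that coordinate expressions take outside the image of a
  chart.\<close>

definition smooth_near :: "('e::euclidean_space \<Rightarrow> 'f::euclidean_space) \<Rightarrow> 'e \<Rightarrow> bool" where
  "smooth_near f x \<longleftrightarrow> (\<exists>S. open S \<and> x \<in> S \<and> smooth_on S f)"

lemma smooth_on_iff_near:
  assumes "open S" shows "smooth_on S f \<longleftrightarrow> (\<forall>x\<in>S. smooth_near f x)"
proof
  assume "smooth_on S f" then show "\<forall>x\<in>S. smooth_near f x"
    using assms unfolding smooth_near_def by blast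
next
  assume *: "\<forall>x\<in>S. smooth_near f x"
  have "Ck_on k f S" for k
    by (rule Ck_on_UN) (use * in \<open>auto simp: smooth_near_def smooth_on_def\<close>)
  then show "smooth_on S f" by (simp add: smooth_on_def)
qed

lemma smooth_near_eventually:
  assumes "smooth_near f x" shows "eventually (smooth_near f) (nhds x)"
  using assms unfolding eventually_nhds smooth_near_def by blast

lemma smooth_near_cong:
  assumes "smooth_near f x" "eventually (\<lambda>y. f y = g y) (nhds x)"
  shows "smooth_near g x"
proof -
  obtain S T where "open S" "x \<in> S" "smooth_on S f" "open T" "x \<in> T" "\<forall>y\<in>T. f y = g y"
    using assms unfolding smooth_near_def eventually_nhds by blast
  then have "Ck_on k g (S \<inter> T)" for k
    using Ck_on_cong[of "S \<inter> T" f g k] Ck_on_subset[of k f S "S \<inter> T"] by (auto simp: smooth_on_def)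
  then show ?thesis using \<open>open S\<close> \<open>open T\<close> \<open>x \<in> S\<close> \<open>x \<in> T\<close> unfolding smooth_near_def smooth_on_def
    by (intro exI[of _ "S \<inter> T"]) auto
qed

lemma smooth_near_differentiable: "smooth_near f x \<Longrightarrow> f differentiable at x"
  unfolding smooth_near_def smooth_on_def using Ck_on_differentiable by blast

lemma smooth_near_has_derivative:
  "smooth_near f x \<Longrightarrow> (f has_derivative \<D> f x) (at x)"
  using smooth_near_differentiable frechet_derivative_works by blast

lemma smooth_near_isCont: "smooth_near f x \<Longrightarrow> isCont f x"
  by (simp add: smooth_near_differentiable differentiable_imp_continuous_within)

lemma smooth_near_frechet: "smooth_near f x \<Longrightarrow> smooth_near (\<lambda>y. \<D> f y v) x"
  unfolding smooth_near_def smooth_on_def by (metis Ck_on.simps(2))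

lemma smooth_near_const: "smooth_near (\<lambda>_. c) x"
  unfolding smooth_near_def smooth_on_def using Ck_on_const open_UNIV by blast

lemma smooth_near_ident: "smooth_near (\<lambda>x. x) x"
  unfolding smooth_near_def smooth_on_def using Ck_on_ident open_UNIV by blast

lemma smooth_near_bounded_linear:
  "bounded_linear L \<Longrightarrow> smooth_near f x \<Longrightarrow> smooth_near (\<lambda>x. L (f x)) x"
  unfolding smooth_near_def smooth_on_def using Ck_on_bounded_linear by blast

lemma smooth_near_linear: "linear L \<Longrightarrow> smooth_near L x"
  for L :: "'e::euclidean_space \<Rightarrow> 'f::euclidean_space"
  using smooth_near_bounded_linear[OF _ smooth_near_ident] by (simp add: linear_conv_bounded_linear)

lemma smooth_near_fst: "smooth_near fst x" and smooth_near_snd: "smooth_near snd x"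
  by (intro smooth_near_linear bounded_linear.linear bounded_linear_fst bounded_linear_snd)+

lemma smooth_near_binop:
  assumes "\<And>k S. open S \<Longrightarrow> Ck_on k f S \<Longrightarrow> Ck_on k g S \<Longrightarrow> Ck_on k h S"
    "smooth_near f x" "smooth_near g x"
  shows "smooth_near h x"
proof -
  obtain S T where *: "open S" "x \<in> S" "smooth_on S f" "open T" "x \<in> T" "smooth_on T g"
    using assms unfolding smooth_near_def by blast
  then have "smooth_on (S \<inter> T) h"
    using assms(1)[of "S \<inter> T"] Ck_on_subset[of _ _ _ "S \<inter> T"] unfolding smooth_on_def
    by (metis Int_lower1 Int_lower2 open_Int)
  then show ?thesis using * unfolding smooth_near_def by blast
qed

lemma smooth_near_add: "smooth_near f x \<Longrightarrow> smooth_near g x \<Longrightarrow> smooth_near (\<lambda>x. f x + g x) x"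
  by (rule smooth_near_binop[of f g]) (rule Ck_on_add)

lemma smooth_near_bilinear:
  "bounded_bilinear P \<Longrightarrow> smooth_near f x \<Longrightarrow> smooth_near g x \<Longrightarrow> smooth_near (\<lambda>x. P (f x) (g x)) x"
  by (rule smooth_near_binop[of f g]) (rule Ck_on_bounded_bilinear)

lemmas smooth_near_mult = smooth_near_bilinear[OF bounded_bilinear_mult]
lemmas smooth_near_scaleR = smooth_near_bilinear[OF bounded_bilinear_scaleR]
lemmas smooth_near_inner = smooth_near_bounded_linear[OF bounded_linear_inner_left]
lemmas smooth_near_minus = smooth_near_bounded_linear[OF bounded_linear_minus[OF bounded_linear_ident]]

lemma smooth_near_diff: "smooth_near f x \<Longrightarrow> smooth_near g x \<Longrightarrow> smooth_near (\<lambda>x. f x - g x) x"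
  using smooth_near_add[OF _ smooth_near_minus] by fastforce

lemma smooth_near_Pair: "smooth_near f x \<Longrightarrow> smooth_near g x \<Longrightarrow> smooth_near (\<lambda>x. (f x, g x)) x"
  by (rule smooth_near_binop[of f g]) (rule Ck_on_Pair)

lemma smooth_near_sum:
  "(\<And>i. i \<in> J \<Longrightarrow> smooth_near (f i) x) \<Longrightarrow> smooth_near (\<lambda>x. \<Sum>i\<in>J. f i x) x"
  by (induction J rule: infinite_finite_induct) (auto intro: smooth_near_const smooth_near_add)

lemma smooth_near_compose:
  assumes "smooth_near g (f x)" "smooth_near f x"
  shows "smooth_near (\<lambda>x. g (f x)) x"
proof -
  obtain S T where S: "open S" "x \<in> S" "smooth_on S f" and T: "open T" "f x \<in> T" "smooth_on T g"
    using assms unfolding smooth_near_def by blast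
  obtain U where U: "open U" "x \<in> U" "f ` U \<subseteq> T"
    using smooth_near_isCont[OF assms(2)] T(1,2) unfolding continuous_at_open by (auto simp: image_subset_iff)
  have "Ck_on k (\<lambda>x. g (f x)) (S \<inter> U)" for k
    by (rule Ck_on_compose[of _ T]) (use S T U Ck_on_subset[of k f S "S \<inter> U"] in \<open>auto simp: smooth_on_def\<close>)
  then have "smooth_on (S \<inter> U) (\<lambda>x. g (f x))" by (simp add: smooth_on_def)
  then show ?thesis using S U unfolding smooth_near_def by blast
qed

lemma smooth_near_inverse:
  fixes f :: "'e::euclidean_space \<Rightarrow> real"
  assumes "smooth_near f x" "f x \<noteq> 0"
  shows "smooth_near (\<lambda>x. inverse (f x)) x"
proof -
  have "smooth_near inverse (f x)"
    unfolding smooth_near_def smooth_on_def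
    using Ck_on_inverse[OF _ Ck_on_ident, of "-{0::real}"] assms(2) by (intro exI[of _ "-{0}"]) auto
  from smooth_near_compose[OF this assms(1)] show ?thesis .
qed

text \<open>Mean value theorem twice: along \<open>u\<close> it turns the difference of
  \<open>f\<close> over two opposite edges of the parallelogram into a difference of derivatives in
  direction \<open>u\<close>; along \<open>v\<close> it turns that into one mixed second derivative
  at an inner point.\<close>

lemma second_difference:
  fixes f :: "'e::euclidean_space \<Rightarrow> real"
  assumes "s > 0"
    and fu: "\<And>\<sigma> \<tau>. 0 \<le> \<sigma> \<Longrightarrow> \<sigma> \<le> s \<Longrightarrow> 0 \<le> \<tau> \<Longrightarrow> \<tau> \<le> s \<Longrightarrow>
        (f has_derivative Df (x + \<sigma> *\<^sub>R u + \<tau> *\<^sub>R v)) (at (x + \<sigma> *\<^sub>R u + \<tau> *\<^sub>R v))"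
    and fvu: "\<And>\<sigma> \<tau>. 0 \<le> \<sigma> \<Longrightarrow> \<sigma> \<le> s \<Longrightarrow> 0 \<le> \<tau> \<Longrightarrow> \<tau> \<le> s \<Longrightarrow>
        ((\<lambda>y. Df y u) has_derivative Dg (x + \<sigma> *\<^sub>R u + \<tau> *\<^sub>R v)) (at (x + \<sigma> *\<^sub>R u + \<tau> *\<^sub>R v))"
  shows "\<exists>\<sigma> \<tau>. 0 \<le> \<sigma> \<and> \<sigma> \<le> s \<and> 0 \<le> \<tau> \<and> \<tau> \<le> s \<and>
     f (x + s *\<^sub>R u + s *\<^sub>R v) - f (x + s *\<^sub>R u) - f (x + s *\<^sub>R v) + f x = s * s * Dg (x + \<sigma> *\<^sub>R u + \<tau> *\<^sub>R v) v"
proof -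
  let ?p = "\<lambda>\<sigma> \<tau>. x + \<sigma> *\<^sub>R u + \<tau> *\<^sub>R v"
  define G where "G \<sigma> = f (?p \<sigma> s) - f (?p \<sigma> 0)" for \<sigma>
  have dp: "((\<lambda>\<sigma>. ?p \<sigma> \<tau>) has_derivative (\<lambda>k. k *\<^sub>R u)) (at \<sigma>)" for \<sigma> \<tau>
    by (auto intro!: derivative_eq_intros)
  have dq: "((\<lambda>\<tau>. ?p \<sigma> \<tau>) has_derivative (\<lambda>k. k *\<^sub>R v)) (at \<tau>)" for \<sigma> \<tau>
    by (auto intro!: derivative_eq_intros)
  have G': "(G has_derivative (\<lambda>k. Df (?p \<sigma> s) (k *\<^sub>R u) - Df (?p \<sigma> 0) (k *\<^sub>R u))) (at \<sigma>)"
    if "0 \<le> \<sigma>" "\<sigma> \<le> s" for \<sigma>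
    unfolding G_def using that \<open>s > 0\<close>
    by (intro has_derivative_diff has_derivative_compose[OF dp, where g=f]) (rule fu; simp)+
  have "(G has_real_derivative (Df (?p \<sigma> s) u - Df (?p \<sigma> 0) u)) (at \<sigma>)"
    if "0 \<le> \<sigma>" "\<sigma> \<le> s" for \<sigma>
    unfolding has_field_derivative_def
  proof -
    have "(\<lambda>k. Df (?p \<sigma> s) (k *\<^sub>R u) - Df (?p \<sigma> 0) (k *\<^sub>R u)) = (*) (Df (?p \<sigma> s) u - Df (?p \<sigma> 0) u)"
      using that linear_cmul[OF has_derivative_linear[OF fu[of \<sigma> s]]]
        linear_cmul[OF has_derivative_linear[OF fu[of \<sigma> 0]]] \<open>s > 0\<close>
      by (intro ext) (simp add: algebra_simps)
    with G'[OF that] show "(G has_derivative (*) (Df (?p \<sigma> s) u - Df (?p \<sigma> 0) u)) (at \<sigma>)" by simp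
  qed
  from MVT2[OF \<open>s > 0\<close> this] obtain \<sigma> where \<sigma>: "0 < \<sigma>" "\<sigma> < s"
    "G s - G 0 = (s - 0) * (Df (?p \<sigma> s) u - Df (?p \<sigma> 0) u)" by blast
  have D': "((\<lambda>\<tau>. Df (?p \<sigma> \<tau>) u) has_derivative (\<lambda>k. Dg (?p \<sigma> \<tau>) (k *\<^sub>R v))) (at \<tau>)"
    if "0 \<le> \<tau>" "\<tau> \<le> s" for \<tau>
    using that \<sigma> by (intro has_derivative_compose[OF dq, where g="\<lambda>y. Df y u"]) (rule fvu; simp)
  have "((\<lambda>\<tau>. Df (?p \<sigma> \<tau>) u) has_real_derivative Dg (?p \<sigma> \<tau>) v) (at \<tau>)"
    if "0 \<le> \<tau>" "\<tau> \<le> s" for \<tau>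
    unfolding has_field_derivative_def
  proof -
    have "(\<lambda>k. Dg (?p \<sigma> \<tau>) (k *\<^sub>R v)) = (*) (Dg (?p \<sigma> \<tau>) v)"
      using that linear_cmul[OF has_derivative_linear[OF fvu[of \<sigma> \<tau>]]] \<sigma>(1,2)
      by (intro ext) (simp add: mult.commute)
    with D'[OF that] show "((\<lambda>\<tau>. Df (?p \<sigma> \<tau>) u) has_derivative (*) (Dg (?p \<sigma> \<tau>) v)) (at \<tau>)" by simp
  qed
  from MVT2[OF \<open>s > 0\<close> this] obtain \<tau> where \<tau>: "0 < \<tau>" "\<tau> < s"
    "Df (?p \<sigma> s) u - Df (?p \<sigma> 0) u = (s - 0) * Dg (?p \<sigma> \<tau>) v" by blast
  have "f (?p s s) - f (?p s 0) - f (?p 0 s) + f (?p 0 0) = s * s * Dg (?p \<sigma> \<tau>) v"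
    using \<sigma>(3) \<tau>(3) by (simp add: G_def)
  then show ?thesis using \<sigma>(1,2) \<tau>(1,2) by (intro exI[of _ \<sigma>] exI[of _ \<tau>]) auto
qed

text \<open>The second difference is symmetric in \<open>u\<close> and \<open>v\<close>. Reading it
  in both orders gives the two mixed derivatives at two points near \<open>x\<close>, and continuity
  brings both back to \<open>x\<close>.\<close>

lemma frechet_derivative_commute_real:
  fixes f :: "'e::euclidean_space \<Rightarrow> real"
  assumes "smooth_near f x"
  shows "\<D> (\<lambda>y. \<D> f y u) x v =
    \<D> (\<lambda>y. \<D> f y v) x u"
proof -
  define d where "d u y = \<D> f y u" for u y
  define dd where "dd u v y = \<D> (d u) y v" for u v y
  have sd: "smooth_near (d u) y" if "smooth_near f y" for u y
    unfolding d_def using smooth_near_frechet that by blast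
  have sdd: "smooth_near (dd u v) y" if "smooth_near f y" for u v y
    unfolding dd_def using smooth_near_frechet sd that by blast
  have "\<bar>dd u v x - dd v u x\<bar> \<le> 2 * \<epsilon>" if "\<epsilon> > 0" for \<epsilon>
  proof -
    have "\<forall>\<^sub>F y in nhds x. \<bar>dd u v y - dd u v x\<bar> < \<epsilon>" for u v
      using smooth_near_isCont[OF sdd[OF assms], of u v] that
      unfolding isCont_def tendsto_at_iff_tendsto_nhds unfolding tendsto_iff dist_real_def by simp
    then have "\<forall>\<^sub>F y in nhds x. smooth_near f y \<and> \<bar>dd u v y - dd u v x\<bar> < \<epsilon> \<and> \<bar>dd v u y - dd v u x\<bar> < \<epsilon>"
      using smooth_near_eventually[OF assms] by (simp add: eventually_conj_iff)
    then obtain r where r: "r > 0" and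
      near: "\<And>y. dist y x < r \<Longrightarrow> smooth_near f y \<and> \<bar>dd u v y - dd u v x\<bar> < \<epsilon> \<and> \<bar>dd v u y - dd v u x\<bar> < \<epsilon>"
      unfolding eventually_nhds_metric by metis
    define N where "N = norm u + norm v + 1"
    \<comment> \<open>Small enough for the parallelogram with sides \<open>s u\<close> and
      \<open>s v\<close> to stay within distance \<open>r\<close> of \<open>x\<close>; the summand 1
      in \<open>N\<close> avoids division by zero.\<close>
    define s where "s = r / (2 * N)"
    have "N > 0" unfolding N_def by (smt (verit) norm_ge_zero)
    then have "s > 0" "s * N = r / 2" using r by (simp_all add: s_def)
    then have s: "s > 0" "s * (norm u + norm v + 1) = r / 2" by (simp_all add: N_def)
    have close: "dist (x + \<sigma> *\<^sub>R u + \<tau> *\<^sub>R v) x < r" if "0 \<le> \<sigma>" "\<sigma> \<le> s" "0 \<le> \<tau>" "\<tau> \<le> s" for \<sigma> \<tau>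
    proof -
      have "dist (x + \<sigma> *\<^sub>R u + \<tau> *\<^sub>R v) x \<le> \<sigma> * norm u + \<tau> * norm v"
        using that norm_triangle_ineq[of "\<sigma> *\<^sub>R u" "\<tau> *\<^sub>R v"] by (simp add: dist_norm)
      also have "\<dots> \<le> s * norm u + s * norm v" using that by (intro add_mono mult_right_mono) auto
      also have "\<dots> < r" using s r by (simp add: algebra_simps)
      finally show ?thesis .
    qed
    have close': "dist (x + \<sigma> *\<^sub>R v + \<tau> *\<^sub>R u) x < r" if "0 \<le> \<sigma>" "\<sigma> \<le> s" "0 \<le> \<tau>" "\<tau> \<le> s" for \<sigma> \<tau>
      using close[OF that(3,4,1,2)] by (simp add: algebra_simps)
    let ?\<Delta> = "f (x + s *\<^sub>R u + s *\<^sub>R v) - f (x + s *\<^sub>R u) - f (x + s *\<^sub>R v) + f x"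
    let ?\<Delta>' = "f (x + s *\<^sub>R v + s *\<^sub>R u) - f (x + s *\<^sub>R v) - f (x + s *\<^sub>R u) + f x"
    have H: "(f has_derivative (\<lambda>u. d u y)) (at y)" "(d u has_derivative (\<lambda>v. dd u v y)) (at y)"
      if "smooth_near f y" for y u
      using smooth_near_has_derivative[OF that] smooth_near_has_derivative[OF sd[OF that]]
      by (simp_all add: d_def dd_def)
    obtain \<sigma> \<tau> where 1: "0 \<le> \<sigma>" "\<sigma> \<le> s" "0 \<le> \<tau>" "\<tau> \<le> s" "?\<Delta> = s * s * dd u v (x + \<sigma> *\<^sub>R u + \<tau> *\<^sub>R v)"
      using second_difference[OF s(1) H(1)[OF near[THEN conjunct1, OF close]] H(2)[OF near[THEN conjunct1, OF close]]]
      by blast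
    obtain \<sigma>' \<tau>' where 2: "0 \<le> \<sigma>'" "\<sigma>' \<le> s" "0 \<le> \<tau>'" "\<tau>' \<le> s" "?\<Delta>' = s * s * dd v u (x + \<sigma>' *\<^sub>R v + \<tau>' *\<^sub>R u)"
      using second_difference[OF s(1) H(1)[OF near[THEN conjunct1, OF close']] H(2)[OF near[THEN conjunct1, OF close']]]
      by blast
    have "?\<Delta> = ?\<Delta>'" by (simp add: algebra_simps)
    then have "dd u v (x + \<sigma> *\<^sub>R u + \<tau> *\<^sub>R v) = dd v u (x + \<sigma>' *\<^sub>R v + \<tau>' *\<^sub>R u)"
      using 1(5) 2(5) s(1) by simp
    then show ?thesis using near[OF close[OF 1(1-4)]] near[OF close'[OF 2(1-4)]] by linarith
  qed
  \<comment> \<open>With this \<epsilon> the bound says that a nonnegative number is at most half of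
    itself.\<close>
  from this[of "\<bar>dd u v x - dd v u x\<bar> / 4"] have "dd u v x = dd v u x"
    by (cases "dd u v x = dd v u x") simp_all
  then show ?thesis by (simp add: dd_def d_def[abs_def])
qed

lemma frechet_derivative_commute:
  fixes f :: "'e::euclidean_space \<Rightarrow> 'f::euclidean_space"
  assumes "smooth_near f x"
  shows "\<D> (\<lambda>y. \<D> f y u) x v =
    \<D> (\<lambda>y. \<D> f y v) x u"
proof (rule euclidean_eqI)
  fix b :: 'f assume "b \<in> Basis"
  have inner: "\<D> (\<lambda>y. g y \<bullet> b) y w = \<D> g y w \<bullet> b"
    if "smooth_near g y" for g :: "'e \<Rightarrow> 'f" and y w
    by (intro fun_cong[OF frechet_derivative_eqI] has_derivative_inner_left smooth_near_has_derivative that)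
  have ev: "\<D> (\<lambda>y. \<D> (\<lambda>z. f z \<bullet> b) y u) x =
      \<D> (\<lambda>y. \<D> f y u \<bullet> b) x" for u
  proof -
    obtain S where S: "open S" "x \<in> S" "\<And>y. y \<in> S \<Longrightarrow> smooth_near f y"
      using smooth_near_eventually[OF assms] unfolding eventually_nhds by blast
    show ?thesis
      by (rule frechet_derivative_transform_within_open
          [OF smooth_near_differentiable[OF smooth_near_frechet[OF smooth_near_inner[OF assms]]] S(1,2)])
        (simp add: inner S(3))
  qed
  show "\<D> (\<lambda>y. \<D> f y u) x v \<bullet> b =
     \<D> (\<lambda>y. \<D> f y v) x u \<bullet> b"
    using frechet_derivative_commute_real[OF smooth_near_inner[OF assms, of b], of u v]
    by (simp add: ev inner[OF smooth_near_frechet[OF assms]])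
qed

section \<open>Manifolds\<close>

abbreviation (input) "\<E> \<equiv> euclidean_atlas"

lemma
  assumes "smooth_manifold A" "c \<in> A"
  shows open_chart: "open (fst c)" and open_chart_image: "open (snd c ` fst c)"
    and cinv_chart: "p \<in> fst c \<Longrightarrow> cinv c (snd c p) = p"
    and cinv_in: "y \<in> snd c ` fst c \<Longrightarrow> cinv c y \<in> fst c"
    and chart_cinv: "y \<in> snd c ` fst c \<Longrightarrow> snd c (cinv c y) = y"
    and continuous_on_chart: "continuous_on (fst c) (snd c)"
    and continuous_on_cinv: "continuous_on (snd c ` fst c) (cinv c)"
  using assms unfolding smooth_manifold_def homeomorphism_def by force+

lemma chart_at_in:
  assumes "smooth_manifold A"
  shows "chart_at A p \<in> A" "p \<in> fst (chart_at A p)"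
proof -
  have "\<exists>c. c \<in> A \<and> p \<in> fst c" using assms unfolding smooth_manifold_def by blast
  then have "chart_at A p \<in> A \<and> p \<in> fst (chart_at A p)"
    unfolding chart_at_def by (rule someI_ex)
  then show "chart_at A p \<in> A" "p \<in> fst (chart_at A p)" by auto
qed

lemma isCont_chart: "smooth_manifold A \<Longrightarrow> c \<in> A \<Longrightarrow> p \<in> fst c \<Longrightarrow> isCont (snd c) p"
  using continuous_on_chart open_chart by (metis continuous_on_eq_continuous_at)

lemma isCont_cinv: "smooth_manifold A \<Longrightarrow> c \<in> A \<Longrightarrow> y \<in> snd c ` fst c \<Longrightarrow> isCont (cinv c) y"
  using continuous_on_cinv open_chart_image by (metis continuous_on_eq_continuous_at)

lemma isCont_eventually:
  assumes "isCont f x" "open S" "f x \<in> S"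
  shows "eventually (\<lambda>y. f y \<in> S) (nhds x)"
  using assms unfolding continuous_at_open eventually_nhds by blast

lemma open_chart_image_subset:
  assumes "smooth_manifold A" "c \<in> A" "open V"
  shows "open (snd c ` (fst c \<inter> V))"
proof -
  have "snd c ` (fst c \<inter> V) = snd c ` fst c \<inter> cinv c -` V"
    using cinv_chart[OF assms(1,2)] cinv_in[OF assms(1,2)] chart_cinv[OF assms(1,2)] by force
  then show ?thesis
    using continuous_open_preimage[OF continuous_on_cinv[OF assms(1,2)] open_chart_image[OF assms(1,2)] assms(3)]
    by simp
qed

text \<open>A pointwise version of \<open>smooth_map_on\<close>, so that maps meaningful only
  locally, such as charts and sections, compose without any bookkeeping of domains.\<close>

definition smooth_at ::
    "('m::topological_space, 'e::euclidean_space) atlas \<Rightarrow> ('n::topological_space, 'f::euclidean_space) atlas \<Rightarrow>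
     ('m \<Rightarrow> 'n) \<Rightarrow> 'm \<Rightarrow> bool" where
  "smooth_at A B f p \<longleftrightarrow> (\<exists>U. open U \<and> p \<in> U \<and> smooth_map_on A U B f)"

lemma smooth_at_isCont: "smooth_at A B f p \<Longrightarrow> isCont f p"
  unfolding smooth_at_def smooth_map_on_def by (metis continuous_on_eq_continuous_at)

lemma smooth_at_eventually: "smooth_at A B f p \<Longrightarrow> eventually (smooth_at A B f) (nhds p)"
  unfolding smooth_at_def eventually_nhds by blast

lemma smooth_at_chart:
  assumes A: "smooth_manifold A" "c \<in> A" "p \<in> fst c" and B: "smooth_manifold B" "d \<in> B" "f p \<in> fst d"
    and f: "smooth_at A B f p"
  shows "smooth_near (\<lambda>y. snd d (f (cinv c y))) (snd c p)"
proof -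
  obtain U where U: "open U" "p \<in> U" "smooth_map_on A U B f" using f unfolding smooth_at_def by blast
  have "open (U \<inter> f -` fst d)"
    using U open_chart[OF B(1,2)] unfolding smooth_map_on_def by (auto intro: continuous_open_preimage)
  then have "open (snd c ` (fst c \<inter> (U \<inter> f -` fst d)))" by (rule open_chart_image_subset[OF A(1,2)])
  moreover have "smooth_on (snd c ` (fst c \<inter> U \<inter> f -` fst d)) (\<lambda>y. snd d (f (cinv c y)))"
    using U A B unfolding smooth_map_on_def by blast
  moreover have "snd c p \<in> snd c ` (fst c \<inter> (U \<inter> f -` fst d))" using U A B by auto
  ultimately show ?thesis using smooth_on_iff_near by (metis Int_assoc)
qed

lemma smooth_near_transition:
  assumes A: "smooth_manifold A" "c \<in> A" "d \<in> A" "p \<in> fst c" "p \<in> fst d"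
  shows "smooth_near (\<lambda>y. snd d (cinv c y)) (snd c p)"
proof -
  have "open (snd c ` (fst c \<inter> fst d))" using open_chart_image_subset A open_chart by blast
  moreover have "smooth_on (snd c ` (fst c \<inter> fst d)) (\<lambda>y. snd d (cinv c y))"
    using A unfolding smooth_manifold_def by blast
  ultimately show ?thesis using A smooth_on_iff_near by blast
qed

lemma smooth_map_on_iff:
  assumes A: "smooth_manifold A" and B: "smooth_manifold B" and U: "open U"
  shows "smooth_map_on A U B f \<longleftrightarrow> (\<forall>p\<in>U. smooth_at A B f p)"
proof
  assume *: "\<forall>p\<in>U. smooth_at A B f p"
  then have cont: "continuous_on U f" using smooth_at_isCont U continuous_on_eq_continuous_at by blast
  moreover have "smooth_on (snd c ` (fst c \<inter> U \<inter> f -` fst d)) (\<lambda>y. snd d (f (cinv c y)))"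
    if cd: "c \<in> A" "d \<in> B" for c d
  proof -
    have "open (U \<inter> f -` fst d)"
      using U open_chart[OF B cd(2)] cont by (auto intro: continuous_open_preimage)
    then have "open (snd c ` (fst c \<inter> (U \<inter> f -` fst d)))" by (rule open_chart_image_subset[OF A cd(1)])
    moreover have "smooth_near (\<lambda>y. snd d (f (cinv c y))) y" if "y \<in> snd c ` (fst c \<inter> (U \<inter> f -` fst d))" for y
      using that smooth_at_chart[OF A cd(1) _ B cd(2)] * by blast
    ultimately show ?thesis using smooth_on_iff_near by (metis Int_assoc)
  qed
  ultimately show "smooth_map_on A U B f" unfolding smooth_map_on_def by blast
qed (use U in \<open>auto simp: smooth_at_def\<close>)

text \<open>One pair of charts suffices, because every other coordinate expression differs by smooth
  transition maps on both sides. Continuity at \<open>p\<close> ensures that nearby values stay in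
  the chart \<open>d\<close>.\<close>

lemma smooth_atI:
  assumes A: "smooth_manifold A" "c \<in> A" "p \<in> fst c" and B: "smooth_manifold B" "d \<in> B" "f p \<in> fst d"
    and "isCont f p" and near: "smooth_near (\<lambda>y. snd d (f (cinv c y))) (snd c p)"
  shows "smooth_at A B f p"
proof -
  let ?r = "\<lambda>y. snd d (f (cinv c y))"
  obtain N where N: "open N" "snd c p \<in> N" "\<And>y. y \<in> N \<Longrightarrow> smooth_near ?r y"
    using smooth_near_eventually[OF near] unfolding eventually_nhds by blast
  obtain U0 where U0: "open U0" "p \<in> U0" "\<And>x. x \<in> U0 \<Longrightarrow> f x \<in> fst d"
    using isCont_eventually[OF \<open>isCont f p\<close> open_chart[OF B(1,2)] B(3)] unfolding eventually_nhds by blast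
  define U where "U = U0 \<inter> (fst c \<inter> snd c -` N)"
  have "open (fst c \<inter> snd c -` N)"
    by (rule continuous_open_preimage[OF continuous_on_chart[OF A(1,2)] open_chart[OF A(1,2)] N(1)])
  then have U: "open U" "p \<in> U" using U0 N A by (auto simp: U_def)
  have f_eq: "f x = cinv d (?r (snd c x))" if "x \<in> U" for x
    using that U0(3) cinv_chart[OF A(1,2)] cinv_chart[OF B(1,2)] by (simp add: U_def)
  \<comment> \<open>Continuity is assumed at \<open>p\<close> only; near \<open>p\<close> it is
    recovered by writing \<open>f\<close> as an inverse chart after its smooth coordinate
    expression.\<close>
  have cont: "continuous_on U f"
  proof -
    have "isCont (\<lambda>x. cinv d (?r (snd c x))) x" if "x \<in> U" for x
    proof -
      have "isCont ?r (snd c x)" using that N smooth_near_isCont by (auto simp: U_def)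
      moreover have "isCont (snd c) x" using that isCont_chart[OF A(1,2)] by (auto simp: U_def)
      ultimately have "isCont (\<lambda>x. ?r (snd c x)) x" by (rule isCont_o2[rotated])
      moreover have "?r (snd c x) \<in> snd d ` fst d" using that U0 cinv_chart[OF A(1,2)] by (auto simp: U_def)
      ultimately show ?thesis using isCont_cinv[OF B(1,2)] isCont_o2 by fastforce
    qed
    then have "continuous_on U (\<lambda>x. cinv d (?r (snd c x)))"
      using U continuous_on_eq_continuous_at by blast
    then show ?thesis by (rule continuous_on_eq) (rule f_eq[symmetric])
  qed
  moreover have "smooth_on (snd c' ` (fst c' \<inter> U \<inter> f -` fst d')) (\<lambda>y. snd d' (f (cinv c' y)))"
    if cd: "c' \<in> A" "d' \<in> B" for c' d'
  proof -
    have "open (U \<inter> f -` fst d')"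
      using U open_chart[OF B(1) cd(2)] cont by (auto intro: continuous_open_preimage)
    then have op: "open (snd c' ` (fst c' \<inter> (U \<inter> f -` fst d')))" by (rule open_chart_image_subset[OF A(1) cd(1)])
    moreover have "smooth_near (\<lambda>y. snd d' (f (cinv c' y))) y"
      if y: "y \<in> snd c' ` (fst c' \<inter> (U \<inter> f -` fst d'))" for y
    proof -
      obtain x where x: "x \<in> fst c'" "x \<in> U" "f x \<in> fst d'" "y = snd c' x" using y by blast
      have xx: "x \<in> fst c" "f x \<in> fst d" "snd c x \<in> N" using x by (auto simp: U_def U0)
      have r: "?r (snd c x) = snd d (f x)" using cinv_chart[OF A(1,2) xx(1)] by simp
      have "smooth_near (\<lambda>y. snd c (cinv c' y)) y"
        unfolding x(4) by (rule smooth_near_transition) (use A cd x xx in auto)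
      moreover have "smooth_near ?r (snd c (cinv c' y))"
        using cinv_chart[OF A(1) cd(1) x(1)] N(3) xx x by simp
      ultimately have s2: "smooth_near (\<lambda>y. ?r (snd c (cinv c' y))) y" by (rule smooth_near_compose[rotated])
      have "smooth_near (\<lambda>y. snd d' (cinv d y)) (snd d (f x))"
        by (rule smooth_near_transition) (use B cd x xx in auto)
      moreover have "?r (snd c (cinv c' y)) = snd d (f x)"
        using r cinv_chart[OF A(1) cd(1) x(1)] x by simp
      ultimately have "smooth_near (\<lambda>y. snd d' (cinv d y)) (?r (snd c (cinv c' y)))" by simp
      from smooth_near_compose[OF this s2]
      have "smooth_near (\<lambda>y. snd d' (cinv d (?r (snd c (cinv c' y))))) y" .
      moreover have "snd d' (cinv d (?r (snd c (cinv c' y)))) = snd d' (f (cinv c' y))"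
        if "y \<in> snd c' ` (fst c' \<inter> (U \<inter> f -` fst d'))" for y
        using that f_eq cinv_chart[OF A(1) cd(1)] by fastforce
      then have "\<forall>\<^sub>F y in nhds y. snd d' (cinv d (?r (snd c (cinv c' y)))) = snd d' (f (cinv c' y))"
        unfolding eventually_nhds using op y by (intro exI[of _ "snd c' ` (fst c' \<inter> (U \<inter> f -` fst d'))"]) simp
      ultimately show ?thesis by (rule smooth_near_cong)
    qed
    ultimately show ?thesis using smooth_on_iff_near by (metis Int_assoc)
  qed
  ultimately have "smooth_map_on A U B f" unfolding smooth_map_on_def by blast
  then show ?thesis using U unfolding smooth_at_def by blast
qed

lemma smooth_at_cong:
  assumes "smooth_manifold A" "smooth_manifold B" "smooth_at A B f p" "eventually (\<lambda>q. f q = g q) (nhds p)"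
  shows "smooth_at A B g p"
proof -
  let ?c = "chart_at A p" and ?d = "chart_at B (f p)"
  note c = chart_at_in[OF assms(1), of p] and d = chart_at_in[OF assms(2), of "f p"]
  have "f p = g p" using assms(4) by (rule eventually_nhds_x_imp_x)
  have "isCont (cinv ?c) (snd ?c p)" using isCont_cinv[OF assms(1) c(1)] c(2) by blast
  then have "filterlim (cinv ?c) (nhds p) (nhds (snd ?c p))"
    using cinv_chart[OF assms(1) c] by (metis continuous_within tendsto_at_iff_tendsto_nhds)
  from eventually_compose_filterlim[OF assms(4) this]
  have "eventually (\<lambda>y. snd ?d (f (cinv ?c y)) = snd ?d (g (cinv ?c y))) (nhds (snd ?c p))"
    by eventually_elim simp
  from smooth_near_cong[OF smooth_at_chart[OF assms(1) c assms(2) d assms(3)] this]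
  have "smooth_near (\<lambda>y. snd ?d (g (cinv ?c y))) (snd ?c p)" .
  moreover have "isCont g p" using smooth_at_isCont[OF assms(3)] isCont_cong[OF assms(4)] by blast
  ultimately show ?thesis
    using smooth_atI[OF assms(1) c assms(2) d(1)] d(2) \<open>f p = g p\<close> by metis
qed

lemma eventually_cinv:
  assumes "smooth_manifold A" "c \<in> A" "p \<in> fst c" "eventually P (nhds p)"
  shows "eventually (\<lambda>y. P (cinv c y)) (nhds (snd c p))"
proof -
  have "isCont (cinv c) (snd c p)" using isCont_cinv[OF assms(1,2)] assms(3) by blast
  then have "filterlim (cinv c) (nhds p) (nhds (snd c p))"
    using cinv_chart[OF assms(1-3)] by (metis continuous_within tendsto_at_iff_tendsto_nhds)
  from eventually_compose_filterlim[OF assms(4) this] show ?thesis .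
qed

text \<open>All three tangent maps are read in the charts picked at \<open>p\<close>,
  \<open>f p\<close> and \<open>g (f p)\<close>, so the middle charts match and the Euclidean chain
  rule applies to expressions that compose correctly near \<open>p\<close>.\<close>

lemma
  assumes A: "smooth_manifold A" and B: "smooth_manifold B" and D: "smooth_manifold D"
    and f: "smooth_at A B f p" and g: "smooth_at B D g (f p)"
  shows smooth_at_compose: "smooth_at A D (\<lambda>x. g (f x)) p"
    and tangent_map_compose:
      "tangent_map A D (\<lambda>x. g (f x)) p u = tangent_map B D g (f p) (tangent_map A B f p u)"
proof -
  let ?c = "chart_at A p" and ?d = "chart_at B (f p)" and ?e = "chart_at D (g (f p))"
  note c = chart_at_in[OF A, of p] and d = chart_at_in[OF B, of "f p"] and e = chart_at_in[OF D, of "g (f p)"]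
  let ?rf = "\<lambda>y. snd ?d (f (cinv ?c y))" and ?rg = "\<lambda>y. snd ?e (g (cinv ?d y))"
    and ?rh = "\<lambda>y. snd ?e (g (f (cinv ?c y)))"
  have rf: "smooth_near ?rf (snd ?c p)" by (rule smooth_at_chart[OF A c B d f])
  have rg: "smooth_near ?rg (snd ?d (f p))" by (rule smooth_at_chart[OF B d D e g])
  have rfp: "?rf (snd ?c p) = snd ?d (f p)" using cinv_chart[OF A c] by simp
  have "eventually (\<lambda>x. f x \<in> fst ?d) (nhds p)"
    by (rule isCont_eventually[OF smooth_at_isCont[OF f] open_chart[OF B d(1)] d(2)])
  from eventually_cinv[OF A c this]
  have ev: "eventually (\<lambda>y. ?rg (?rf y) = ?rh y) (nhds (snd ?c p))"
    by eventually_elim (simp add: cinv_chart[OF B d(1)])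
  have comp: "smooth_near (\<lambda>y. ?rg (?rf y)) (snd ?c p)"
    by (rule smooth_near_compose[OF _ rf]) (use rg rfp in simp)
  have "isCont (\<lambda>x. g (f x)) p"
    using smooth_at_isCont[OF f] smooth_at_isCont[OF g] by (rule isCont_o2)
  then show "smooth_at A D (\<lambda>x. g (f x)) p"
    by (rule smooth_atI[where f="\<lambda>x. g (f x)", OF A c D e]) (rule smooth_near_cong[OF comp ev])
  have "(?rf has_derivative tangent_map A B f p) (at (snd ?c p))"
    unfolding tangent_map_def by (rule smooth_near_has_derivative[OF rf])
  moreover have "(?rg has_derivative tangent_map B D g (f p)) (at (?rf (snd ?c p)))"
    unfolding tangent_map_def rfp by (rule smooth_near_has_derivative[OF rg])
  ultimately have der: "((\<lambda>y. ?rg (?rf y)) has_derivative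
      (\<lambda>u. tangent_map B D g (f p) (tangent_map A B f p u))) (at (snd ?c p))"
    by (rule has_derivative_compose)
  have "(?rh has_derivative (\<lambda>u. tangent_map B D g (f p) (tangent_map A B f p u))) (at (snd ?c p))"
  proof -
    obtain S where "open S" "snd ?c p \<in> S" "\<And>y. y \<in> S \<Longrightarrow> ?rg (?rf y) = ?rh y"
      using ev unfolding eventually_nhds by blast
    with der show ?thesis by (rule has_derivative_transform_within_open)
  qed
  from frechet_derivative_eqI[OF this] show
    "tangent_map A D (\<lambda>x. g (f x)) p u = tangent_map B D g (f p) (tangent_map A B f p u)"
    unfolding tangent_map_def[of A D] by simp
qed

lemma linear_tangent_map:
  assumes "smooth_manifold A" "smooth_manifold B" "smooth_at A B f p"
  shows "linear (tangent_map A B f p)"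
  unfolding tangent_map_def
  by (rule linear_frechet_derivative[OF smooth_near_differentiable[OF smooth_at_chart[OF
      assms(1) chart_at_in[OF assms(1)] assms(2) chart_at_in[OF assms(2)] assms(3)]]])

lemma tangent_map_cong:
  assumes "smooth_manifold A" "smooth_manifold B" "smooth_at A B f p" "eventually (\<lambda>q. f q = g q) (nhds p)"
  shows "tangent_map A B f p = tangent_map A B g p"
proof -
  note c = chart_at_in[OF assms(1), of p]
  have "f p = g p" using assms(4) by (rule eventually_nhds_x_imp_x)
  from eventually_cinv[OF assms(1) c assms(4)]
  obtain S where "open S" "snd (chart_at A p) p \<in> S" "\<And>y. y \<in> S \<Longrightarrow> f (cinv (chart_at A p) y) = g (cinv (chart_at A p) y)"
    unfolding eventually_nhds by blast
  then show ?thesis unfolding tangent_map_def \<open>f p = g p\<close>[symmetric]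
    by (intro frechet_derivative_transform_within_open[of _ _ S]
        smooth_near_differentiable[OF smooth_at_chart[OF assms(1) c assms(2) chart_at_in[OF assms(2)] assms(3)]]) auto
qed

lemma smooth_at_ident: "smooth_manifold A \<Longrightarrow> smooth_at A A (\<lambda>x. x) p"
  by (rule smooth_atI[OF _ chart_at_in _ chart_at_in])
    (auto intro!: smooth_near_transition chart_at_in)

lemma tangent_map_ident:
  assumes A: "smooth_manifold A"
  shows "tangent_map A A (\<lambda>x. x) p u = u"
proof -
  note c = chart_at_in[OF A, of p]
  have "\<D> (\<lambda>y. y) (snd (chart_at A p) p) =
      \<D> (\<lambda>y. snd (chart_at A p) (cinv (chart_at A p) y)) (snd (chart_at A p) p)"
    by (rule frechet_derivative_transform_within_open[OF _ open_chart_image[OF A c(1)]])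
      (use c chart_cinv[OF A c(1)] in auto)
  then show ?thesis unfolding tangent_map_def by (metis frechet_derivative_ident)
qed

lemma smooth_at_const:
  assumes "smooth_manifold A" "smooth_manifold B"
  shows "smooth_at A B (\<lambda>_. q) p"
  by (rule smooth_atI[OF assms(1) chart_at_in[OF assms(1)] assms(2) chart_at_in[OF assms(2)]])
    (simp_all add: smooth_near_const)

lemma tangent_map_const: "tangent_map A B (\<lambda>_. q) p u = 0"
  unfolding tangent_map_def by simp

section \<open>Euclidean space as a manifold; frames as tangent maps of charts\<close>

lemma cinv_UNIV: "cinv (UNIV, \<lambda>x. x) = (\<lambda>x. x)"
  by (rule ext) (simp add: cinv_def)

lemma manifold_euclidean: "smooth_manifold \<E>"
  unfolding smooth_manifold_def euclidean_atlas_def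
  by (auto simp: cinv_UNIV homeomorphism_def continuous_on_id smooth_on_def Ck_on_ident)

lemma chart_at_euclidean: "chart_at \<E> p = (UNIV, \<lambda>x. x)"
  unfolding chart_at_def euclidean_atlas_def by (auto intro: some_equality)

lemma smooth_at_euclidean_iff: "smooth_at \<E> \<E> f x \<longleftrightarrow> smooth_near f x"
proof
  show "smooth_near f x" if "smooth_at \<E> \<E> f x"
    using smooth_at_chart[OF manifold_euclidean _ _ manifold_euclidean _ _ that,
        of "(UNIV, \<lambda>x. x)" "(UNIV, \<lambda>x. x)"] by (simp add: euclidean_atlas_def cinv_UNIV)
  show "smooth_at \<E> \<E> f x" if "smooth_near f x"
    by (rule smooth_atI[OF manifold_euclidean _ _ manifold_euclidean,
        of "(UNIV, \<lambda>x. x)" _ "(UNIV, \<lambda>x. x)"])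
      (use that in \<open>auto simp: euclidean_atlas_def cinv_UNIV smooth_near_isCont\<close>)
qed

lemma tangent_map_euclidean:
  "tangent_map \<E> \<E> f x = \<D> f x"
  by (simp add: tangent_map_def chart_at_euclidean cinv_UNIV)

lemma tangent_map_from_euclidean:
  "tangent_map \<E> B f x = \<D> (\<lambda>y. snd (chart_at B (f x)) (f y)) x"
  by (simp add: tangent_map_def chart_at_euclidean cinv_UNIV)

lemma ext0_eq_tangent_map: "ext0 A f p = tangent_map A \<E> f p"
  by (simp add: tangent_map_def ext0_def chart_at_euclidean)

text \<open>Once \<open>frame\<close> and \<open>coframe\<close> are recognised as tangent maps of
  the inverse chart and of the chart, their being mutually inverse is the chain rule. Later
  arguments about coordinates can then be phrased with \<open>tangent_map\<close> alone.\<close>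

lemma
  assumes "smooth_manifold A" "c \<in> A" "p \<in> fst c"
  shows smooth_at_chart_map: "smooth_at A \<E> (snd c) p"
    and smooth_at_cinv: "smooth_at \<E> A (cinv c) (snd c p)"
    and frame_eq_tangent_map: "frame A c p = tangent_map \<E> A (cinv c) (snd c p)"
    and coframe_eq_tangent_map: "coframe A c p = tangent_map A \<E> (snd c) p"
    and frame_coframe: "frame A c p (coframe A c p v) = v"
    and coframe_frame: "coframe A c p (frame A c p w) = w"
proof -
  note E = manifold_euclidean
  have near: "smooth_near (\<lambda>y. snd c (cinv c y)) (snd c p)"
    by (rule smooth_near_transition) (use assms in auto)
  show 1: "smooth_at A \<E> (snd c) p"
    by (rule smooth_atI[OF assms E, of "(UNIV, \<lambda>x. x)"])
      (use near isCont_chart[OF assms] in \<open>auto simp: euclidean_atlas_def\<close>)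
  show 2: "smooth_at \<E> A (cinv c) (snd c p)"
    by (rule smooth_atI[OF E, of "(UNIV, \<lambda>x. x)" _ A c])
      (use near isCont_cinv[OF assms(1,2)] assms cinv_in[OF assms(1,2)] in \<open>auto simp: euclidean_atlas_def cinv_UNIV\<close>)
  show 3: "frame A c p = tangent_map \<E> A (cinv c) (snd c p)"
    by (simp add: frame_def tangent_map_from_euclidean cinv_chart[OF assms])
  show 4: "coframe A c p = tangent_map A \<E> (snd c) p"
    by (simp add: coframe_def tangent_map_def chart_at_euclidean)
  have "tangent_map A A (\<lambda>x. cinv c (snd c x)) p v = frame A c p (coframe A c p v)"
    unfolding 3 4 by (rule tangent_map_compose[OF assms(1) E assms(1) 1 2])
  moreover have "tangent_map A A (\<lambda>x. x) p = tangent_map A A (\<lambda>x. cinv c (snd c x)) p"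
    by (rule tangent_map_cong[OF assms(1) assms(1) smooth_at_ident[OF assms(1)]])
      (use open_chart[OF assms(1,2)] assms(3) cinv_chart[OF assms(1,2)] in \<open>auto simp: eventually_nhds\<close>)
  ultimately show "frame A c p (coframe A c p v) = v" using tangent_map_ident[OF assms(1)] by metis
  have one: "smooth_at A \<E> (snd c) (cinv c (snd c p))" using 1 cinv_chart[OF assms] by simp
  have "tangent_map \<E> \<E> (\<lambda>y. snd c (cinv c y)) (snd c p) w = coframe A c p (frame A c p w)"
    unfolding 3 4 using tangent_map_compose[OF E assms(1) E 2 one] cinv_chart[OF assms] by simp
  moreover have "tangent_map \<E> \<E> (\<lambda>y. y) (snd c p) =
      tangent_map \<E> \<E> (\<lambda>y. snd c (cinv c y)) (snd c p)"
    by (rule tangent_map_cong[OF E E smooth_at_ident[OF E]])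
      (use open_chart_image[OF assms(1,2)] assms(3) chart_cinv[OF assms(1,2)] in \<open>auto simp: eventually_nhds\<close>)
  ultimately show "coframe A c p (frame A c p w) = w" using tangent_map_ident[OF E] by metis
qed

lemma smooth_at_cinv_image:
  "smooth_manifold A \<Longrightarrow> c \<in> A \<Longrightarrow> y \<in> snd c ` fst c \<Longrightarrow> smooth_at \<E> A (cinv c) y"
  using smooth_at_cinv[of A c "cinv c y"] by (simp only: cinv_in chart_cinv)

lemma eventually_chart_image:
  "smooth_manifold A \<Longrightarrow> c \<in> A \<Longrightarrow> p \<in> fst c \<Longrightarrow> \<forall>\<^sub>F y in nhds (snd c p). y \<in> snd c ` fst c"
  by (intro eventually_nhds_in_open open_chart_image) auto

lemma frame_chart_at: "smooth_manifold A \<Longrightarrow> frame A (chart_at A p) p v = v"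
  using tangent_map_ident[of A p v] by (simp add: frame_def tangent_map_def)

lemma linear_frame: "smooth_manifold A \<Longrightarrow> c \<in> A \<Longrightarrow> p \<in> fst c \<Longrightarrow> linear (frame A c p)"
  by (simp add: frame_eq_tangent_map linear_tangent_map manifold_euclidean smooth_at_cinv)

section \<open>Products\<close>

lemma cinv_prod:
  assumes "inj_on (snd c) (fst c)" "inj_on (snd d) (fst d)" "x \<in> snd c ` fst c" "y \<in> snd d ` fst d"
  shows "cinv (fst c \<times> fst d, map_prod (snd c) (snd d)) (x, y) = (cinv c x, cinv d y)"
proof -
  obtain p q where "x = snd c p" "p \<in> fst c" "y = snd d q" "q \<in> fst d" using assms by blast
  moreover have "inj_on (map_prod (snd c) (snd d)) (fst c \<times> fst d)" using assms by (simp add: map_prod_inj_on)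
  then have "inv_into (fst c \<times> fst d) (map_prod (snd c) (snd d)) (map_prod (snd c) (snd d) (p, q)) = (p, q)"
    using calculation by (intro inv_into_f_f) auto
  ultimately show ?thesis using assms by (simp add: cinv_def)
qed

lemma inj_on_chart: "smooth_manifold A \<Longrightarrow> c \<in> A \<Longrightarrow> inj_on (snd c) (fst c)"
  by (rule inj_on_inverseI) (rule cinv_chart)

lemma prod_atlasI: "c \<in> A \<Longrightarrow> d \<in> B \<Longrightarrow> (fst c \<times> fst d, map_prod (snd c) (snd d)) \<in> prod_atlas A B"
  unfolding prod_atlas_def by blast

lemma image_map_prod_Times: "map_prod f g ` (S \<times> T) = (f ` S) \<times> (g ` T)"
  by auto

text \<open>Needed because a circle action is required to be smooth jointly in time and point, on
  the product of the real line with the manifold.\<close>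

lemma smooth_manifold_prod:
  assumes A: "smooth_manifold A" and B: "smooth_manifold B"
  shows "smooth_manifold (prod_atlas A B)"
proof -
  have cp: "cinv (fst c \<times> fst d, map_prod (snd c) (snd d)) (x, y) = (cinv c x, cinv d y)"
    if "c \<in> A" "d \<in> B" "x \<in> snd c ` fst c" "y \<in> snd d ` fst d" for c d x y
    by (rule cinv_prod[OF inj_on_chart[OF A that(1)] inj_on_chart[OF B that(2)] that(3,4)])
  have hom: "open (fst k)" "open (snd k ` fst k)" "homeomorphism (fst k) (snd k ` fst k) (snd k) (cinv k)"
    if kin: "k \<in> prod_atlas A B" for k
  proof -
    obtain c d where k: "k = (fst c \<times> fst d, map_prod (snd c) (snd d))" and cd: "c \<in> A" "d \<in> B"
      using kin unfolding prod_atlas_def by blast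
    show "open (fst k)" using open_Times[OF open_chart[OF A cd(1)] open_chart[OF B cd(2)]] by (simp add: k)
    show "open (snd k ` fst k)" using open_Times[OF open_chart_image[OF A cd(1)] open_chart_image[OF B cd(2)]]
      by (simp add: k image_map_prod_Times)
    show "homeomorphism (fst k) (snd k ` fst k) (snd k) (cinv k)"
      unfolding k fst_conv snd_conv image_map_prod_Times homeomorphism_def
    proof (intro conjI ballI)
      fix x assume "x \<in> fst c \<times> fst d"
      then show "cinv (fst c \<times> fst d, map_prod (snd c) (snd d)) (map_prod (snd c) (snd d) x) = x"
        using cp[OF cd] cinv_chart[OF A cd(1)] cinv_chart[OF B cd(2)] by force
    next
      fix y assume "y \<in> snd c ` fst c \<times> snd d ` fst d"
      then show "map_prod (snd c) (snd d) (cinv (fst c \<times> fst d, map_prod (snd c) (snd d)) y) = y"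
        using cp[OF cd] chart_cinv[OF A cd(1)] chart_cinv[OF B cd(2)] by (cases y) simp
    next
      show "cinv (fst c \<times> fst d, map_prod (snd c) (snd d)) ` (snd c ` fst c \<times> snd d ` fst d) = fst c \<times> fst d"
      proof -
        have "cinv (fst c \<times> fst d, map_prod (snd c) (snd d)) ` (snd c ` fst c \<times> snd d ` fst d) =
          map_prod (cinv c) (cinv d) ` (snd c ` fst c \<times> snd d ` fst d)"
          by (intro image_cong) (use cp[OF cd] in auto)
        also have "\<dots> = (cinv c ` snd c ` fst c) \<times> (cinv d ` snd d ` fst d)" by auto
        also have "\<dots> = fst c \<times> fst d"
          using cinv_chart[OF A cd(1)] cinv_chart[OF B cd(2)] by (simp add: image_image)
        finally show ?thesis .
      qed
    next
      show "continuous_on (fst c \<times> fst d) (map_prod (snd c) (snd d))"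
        unfolding map_prod_def case_prod_unfold
        by (intro continuous_on_Pair continuous_on_compose2[OF continuous_on_chart[OF A cd(1)]]
            continuous_on_compose2[OF continuous_on_chart[OF B cd(2)]] continuous_intros) auto
      have "continuous_on (snd c ` fst c \<times> snd d ` fst d) (\<lambda>y. (cinv c (fst y), cinv d (snd y)))"
        by (intro continuous_on_Pair continuous_on_compose2[OF continuous_on_cinv[OF A cd(1)]]
            continuous_on_compose2[OF continuous_on_cinv[OF B cd(2)]] continuous_intros) auto
      then show "continuous_on (snd c ` fst c \<times> snd d ` fst d) (cinv (fst c \<times> fst d, map_prod (snd c) (snd d)))"
        by (rule continuous_on_eq) (use cp[OF cd] in auto)
    qed auto
  qed
  have cover: "(\<Union>k\<in>prod_atlas A B. fst k) = UNIV"
  proof -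
    have "\<exists>k\<in>prod_atlas A B. x \<in> fst k" for x
      by (rule bexI[OF _ prod_atlasI[OF chart_at_in(1)[OF A, of "fst x"] chart_at_in(1)[OF B, of "snd x"]]])
        (simp add: mem_Times_iff chart_at_in A B)
    then show ?thesis by blast
  qed
  have trans: "smooth_on (snd k ` (fst k \<inter> fst l)) (\<lambda>y. snd l (cinv k y))"
    if k: "k \<in> prod_atlas A B" and l: "l \<in> prod_atlas A B" for k l
  proof -
    obtain c d where kk: "k = (fst c \<times> fst d, map_prod (snd c) (snd d))" and cd: "c \<in> A" "d \<in> B"
      using k unfolding prod_atlas_def by blast
    obtain c' d' where ll: "l = (fst c' \<times> fst d', map_prod (snd c') (snd d'))" and cd': "c' \<in> A" "d' \<in> B"
      using l unfolding prod_atlas_def by blast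
    have eq: "snd k ` (fst k \<inter> fst l) = (snd c ` (fst c \<inter> fst c')) \<times> (snd d ` (fst d \<inter> fst d'))"
      unfolding kk ll by auto
    have op: "open (snd c ` (fst c \<inter> fst c'))" "open (snd d ` (fst d \<inter> fst d'))"
      by (rule open_chart_image_subset[OF A cd(1) open_chart[OF A cd'(1)]],
        rule open_chart_image_subset[OF B cd(2) open_chart[OF B cd'(2)]])
    have "smooth_near (\<lambda>y. snd l (cinv k y)) y" if y: "y \<in> snd k ` (fst k \<inter> fst l)" for y
    proof (rule smooth_near_cong)
      have "fst y \<in> snd c ` (fst c \<inter> fst c')" "snd y \<in> snd d ` (fst d \<inter> fst d')" using y unfolding eq by auto
      then have "smooth_near (\<lambda>y. snd c' (cinv c y)) (fst y)" "smooth_near (\<lambda>y. snd d' (cinv d y)) (snd y)"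
        using smooth_near_transition[OF A cd(1) cd'(1)] smooth_near_transition[OF B cd(2) cd'(2)] by auto
      then show "smooth_near (\<lambda>y. (snd c' (cinv c (fst y)), snd d' (cinv d (snd y)))) y"
        by (intro smooth_near_Pair smooth_near_compose[of "\<lambda>y. snd c' (cinv c y)" fst]
            smooth_near_compose[of "\<lambda>y. snd d' (cinv d y)" snd] smooth_near_fst smooth_near_snd)
      have "(snd c' (cinv c (fst z)), snd d' (cinv d (snd z))) = snd l (cinv k z)"
        if "z \<in> (snd c ` (fst c \<inter> fst c')) \<times> (snd d ` (fst d \<inter> fst d'))" for z
      proof -
        have "fst z \<in> snd c ` fst c" "snd z \<in> snd d ` fst d" using that by auto
        from cp[OF cd this] show ?thesis by (simp add: kk ll)
      qed
      then show "\<forall>\<^sub>F y in nhds y. (snd c' (cinv c (fst y)), snd d' (cinv d (snd y))) = snd l (cinv k y)"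
        unfolding eventually_nhds using y[unfolded eq] open_Times[OF op] by blast
    qed
    moreover have "open (snd k ` (fst k \<inter> fst l))" using op open_Times eq by metis
    ultimately show ?thesis using smooth_on_iff_near by blast
  qed
  show ?thesis unfolding smooth_manifold_def using hom cover trans by blast
qed

lemma
  assumes A: "smooth_manifold A" and B: "smooth_manifold B"
  shows smooth_at_fst: "smooth_at (prod_atlas A B) A fst p"
    and smooth_at_snd: "smooth_at (prod_atlas A B) B snd p"
proof -
  let ?c = "chart_at A (fst p)" and ?d = "chart_at B (snd p)"
  note c = chart_at_in[OF A, of "fst p"] and d = chart_at_in[OF B, of "snd p"]
  let ?k = "(fst ?c \<times> fst ?d, map_prod (snd ?c) (snd ?d))"
  have k: "?k \<in> prod_atlas A B" "p \<in> fst ?k"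
    using c d unfolding prod_atlas_def by (blast, simp add: mem_Times_iff)
  have ck: "cinv ?k (x, y) = (cinv ?c x, cinv ?d y)" if "x \<in> snd ?c ` fst ?c" "y \<in> snd ?d ` fst ?d" for x y
    by (rule cinv_prod[OF inj_on_chart[OF A c(1)] inj_on_chart[OF B d(1)] that])
  have op: "open ((snd ?c ` fst ?c) \<times> (snd ?d ` fst ?d))"
    by (rule open_Times[OF open_chart_image[OF A c(1)] open_chart_image[OF B d(1)]])
  have in_op: "snd ?k p \<in> (snd ?c ` fst ?c) \<times> (snd ?d ` fst ?d)" using c d by (cases p) auto
  show "smooth_at (prod_atlas A B) A fst p"
  proof (rule smooth_atI[where f=fst, OF smooth_manifold_prod[OF A B] k A c])
    show "isCont fst p" by (intro continuous_intros)
    show "smooth_near (\<lambda>y. snd ?c (fst (cinv ?k y))) (snd ?k p)"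
    proof (rule smooth_near_cong)
      show "smooth_near fst (snd ?k p)" by (rule smooth_near_fst)
      show "\<forall>\<^sub>F y in nhds (snd ?k p). fst y = snd ?c (fst (cinv ?k y))"
        unfolding eventually_nhds using op in_op ck chart_cinv[OF A c(1)]
        by (intro exI[of _ "(snd ?c ` fst ?c) \<times> (snd ?d ` fst ?d)"]) auto
    qed
  qed
  show "smooth_at (prod_atlas A B) B snd p"
  proof (rule smooth_atI[where f=snd, OF smooth_manifold_prod[OF A B] k B d])
    show "isCont snd p" by (intro continuous_intros)
    show "smooth_near (\<lambda>y. snd ?d (snd (cinv ?k y))) (snd ?k p)"
    proof (rule smooth_near_cong)
      show "smooth_near snd (snd ?k p)" by (rule smooth_near_snd)
      show "\<forall>\<^sub>F y in nhds (snd ?k p). snd y = snd ?d (snd (cinv ?k y))"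
        unfolding eventually_nhds using op in_op ck chart_cinv[OF B d(1)]
        by (intro exI[of _ "(snd ?c ` fst ?c) \<times> (snd ?d ` fst ?d)"]) auto
    qed
  qed
qed

lemma smooth_at_Pair:
  assumes A: "smooth_manifold A" and B: "smooth_manifold B" and D: "smooth_manifold D"
    and f: "smooth_at D A f p" and g: "smooth_at D B g p"
  shows "smooth_at D (prod_atlas A B) (\<lambda>x. (f x, g x)) p"
proof -
  let ?c = "chart_at A (f p)" and ?d = "chart_at B (g p)"
  note c = chart_at_in[OF A, of "f p"] and d = chart_at_in[OF B, of "g p"] and e = chart_at_in[OF D, of p]
  let ?k = "(fst ?c \<times> fst ?d, map_prod (snd ?c) (snd ?d))"
  have k: "?k \<in> prod_atlas A B" "(f p, g p) \<in> fst ?k"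
    using c d unfolding prod_atlas_def by (blast, simp)
  show ?thesis
  proof (rule smooth_atI[where f="\<lambda>x. (f x, g x)", OF D e smooth_manifold_prod[OF A B] k])
    show "isCont (\<lambda>x. (f x, g x)) p" using smooth_at_isCont f g by (metis continuous_Pair)
    show "smooth_near (\<lambda>y. snd ?k (f (cinv (chart_at D p) y), g (cinv (chart_at D p) y))) (snd (chart_at D p) p)"
      by (simp, intro smooth_near_Pair smooth_at_chart[OF D e A c f] smooth_at_chart[OF D e B d g])
  qed
qed

section \<open>Differential forms\<close>

abbreviation (input) "comp1 A c \<alpha> v y \<equiv> \<alpha> (cinv c y) (frame A c (cinv c y) v)"
abbreviation (input) "comp2 A c \<omega> u v y \<equiv> \<omega> (cinv c y) (frame A c (cinv c y) u) (frame A c (cinv c y) v)"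

definition pull1 ::
    "('m, 'e::euclidean_space) atlas \<Rightarrow> ('n, 'f::euclidean_space) atlas \<Rightarrow> ('m \<Rightarrow> 'n) \<Rightarrow> ('n, 'f) form1 \<Rightarrow> ('m, 'e) form1" where
  "pull1 A B f \<alpha> p u = \<alpha> (f p) (tangent_map A B f p u)"

lemma smooth_on_chart_iff:
  assumes "smooth_manifold A" "c \<in> A"
  shows "smooth_on (snd c ` fst c) F \<longleftrightarrow> (\<forall>p\<in>fst c. smooth_near F (snd c p))"
  using smooth_on_iff_near[OF open_chart_image[OF assms]] by simp

lemma smooth_form1_iff:
  assumes "smooth_manifold A"
  shows "smooth_form1 A \<alpha> \<longleftrightarrow> (\<forall>p. linear (\<alpha> p)) \<and>
    (\<forall>c\<in>A. \<forall>p\<in>fst c. \<forall>v. smooth_near (\<lambda>y. comp1 A c \<alpha> v y) (snd c p))"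
  unfolding smooth_form1_def using smooth_on_chart_iff[OF assms] by blast

lemma smooth_tensor2_iff:
  assumes "smooth_manifold A"
  shows "smooth_tensor2 A g \<longleftrightarrow> (\<forall>p. bilinear (g p)) \<and>
    (\<forall>c\<in>A. \<forall>p\<in>fst c. \<forall>u v.
      smooth_near (\<lambda>y. comp2 A c g u v y) (snd c p))"
  unfolding smooth_tensor2_def using smooth_on_chart_iff[OF assms] by blast

lemma smooth_vector_field_iff:
  assumes "smooth_manifold A"
  shows "smooth_vector_field A X \<longleftrightarrow>
    (\<forall>c\<in>A. \<forall>p\<in>fst c. smooth_near (\<lambda>y. coframe A c (cinv c y) (X (cinv c y))) (snd c p))"
  unfolding smooth_vector_field_def using smooth_on_chart_iff[OF assms] by blast

lemma smooth_endo_iff: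
  assumes "smooth_manifold A"
  shows "smooth_endo A J \<longleftrightarrow> (\<forall>p. linear (J p)) \<and>
    (\<forall>c\<in>A. \<forall>p\<in>fst c. \<forall>v.
      smooth_near (\<lambda>y. coframe A c (cinv c y) (comp1 A c J v y)) (snd c p))"
  unfolding smooth_endo_def using smooth_on_chart_iff[OF assms] by blast

lemma smooth_fun_iff:
  "smooth_manifold A \<Longrightarrow> smooth_fun A k \<longleftrightarrow> (\<forall>p. smooth_at A \<E> k p)"
  using smooth_map_on_iff[OF _ manifold_euclidean open_UNIV, of A k] by simp

lemma smooth_fun_chart:
  assumes A: "smooth_manifold A" "c \<in> A" "p \<in> fst c" and k: "smooth_at A \<E> k p"
  shows "smooth_near (\<lambda>y. k (cinv c y)) (snd c p)"
  using smooth_at_chart[OF A manifold_euclidean _ _ k, of "(UNIV, \<lambda>x. x)"]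
  by (simp add: euclidean_atlas_def)

lemma linear_form_frame:
  assumes "linear L" "linear (M :: 'a::euclidean_space \<Rightarrow> 'b::real_vector)"
  shows "L (M v) = (\<Sum>b\<in>Basis. (v \<bullet> b) * (L (M b) :: real))"
  using linear_componentwise_expansion[OF linear_compose[OF assms(2,1)], of v] by simp

lemma tangent_map_euclidean_frame:
  assumes B: "smooth_manifold B" "d \<in> B" "f z \<in> fst d" and f: "smooth_at \<E> B f z"
  shows "tangent_map \<E> B f z w = frame B d (f z) (\<D> (\<lambda>x. snd d (f x)) z w)"
    and "smooth_near (\<lambda>x. snd d (f x)) z"
proof -
  note E = manifold_euclidean
  have "tangent_map \<E> \<E> (\<lambda>x. snd d (f x)) z w = coframe B d (f z) (tangent_map \<E> B f z w)"
    unfolding coframe_eq_tangent_map[OF B]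
    by (rule tangent_map_compose[OF E B(1) E f smooth_at_chart_map[OF B]])
  then show "tangent_map \<E> B f z w = frame B d (f z) (\<D> (\<lambda>x. snd d (f x)) z w)"
    by (simp add: tangent_map_euclidean frame_coframe[OF B])
  show "smooth_near (\<lambda>x. snd d (f x)) z"
    using smooth_at_compose[OF E B(1) E f smooth_at_chart_map[OF B]] by (simp add: smooth_at_euclidean_iff)
qed

text \<open>Holds on a neighbourhood, not just at \<open>y\<close>, so that it may be
  differentiated: both the smoothness of pull-backs and the naturality of d start from this
  formula.\<close>

lemma pull1_coordinates:
  assumes B: "smooth_manifold B" "d \<in> B" "f y \<in> fst d" and f: "smooth_at \<E> B f y"
    and \<alpha>: "\<And>q. linear (\<alpha> q)"
  shows "\<forall>\<^sub>F z in nhds y. \<forall>w. pull1 \<E> B f \<alpha> z w =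
    (\<Sum>b\<in>Basis. (\<D> (\<lambda>x. snd d (f x)) z w \<bullet> b) *
      \<alpha> (cinv d (snd d (f z))) (frame B d (cinv d (snd d (f z))) b))"
  using smooth_at_eventually[OF f] isCont_eventually[OF smooth_at_isCont[OF f] open_chart[OF B(1,2)] B(3)]
proof eventually_elim
  case (elim z)
  show ?case
    unfolding pull1_def tangent_map_euclidean_frame(1)[OF B(1,2) elim(2,1)] cinv_chart[OF B(1,2) elim(2)]
    using linear_form_frame[OF \<alpha> linear_frame[OF B(1,2) elim(2)]] by blast
qed

lemma smooth_near_pull1:
  assumes B: "smooth_manifold B" and f: "smooth_at \<E> B f y" and \<alpha>: "smooth_form1 B \<alpha>"
  shows "smooth_near (\<lambda>z. pull1 \<E> B f \<alpha> z w) y"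
proof -
  let ?d = "chart_at B (f y)"
  note d = chart_at_in[OF B, of "f y"]
  have lin: "\<And>q. linear (\<alpha> q)" using \<alpha> by (simp add: smooth_form1_def)
  have a: "smooth_near (\<lambda>x. comp1 B ?d \<alpha> b x) (snd ?d (f y))" for b
    using \<alpha> d unfolding smooth_form1_iff[OF B] by blast
  have G: "smooth_near (\<lambda>x. snd ?d (f x)) y" by (rule tangent_map_euclidean_frame(2)[OF B d f])
  have "smooth_near (\<lambda>z. \<Sum>b\<in>Basis. (\<D> (\<lambda>x. snd ?d (f x)) z w \<bullet> b) *
      \<alpha> (cinv ?d (snd ?d (f z))) (frame B ?d (cinv ?d (snd ?d (f z))) b)) y"
    by (intro smooth_near_sum smooth_near_mult smooth_near_inner smooth_near_frechet[OF G]
        smooth_near_compose[OF a G])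
  then show ?thesis
    by (rule smooth_near_cong) (rule eventually_mono[OF pull1_coordinates[where \<alpha>=\<alpha>, OF B d f lin]], simp)
qed

lemma frechet_derivative_cong:
  assumes "smooth_near f x" "\<forall>\<^sub>F y in nhds x. f y = g y"
  shows "\<D> f x = \<D> g x"
proof -
  obtain S where "open S" "x \<in> S" "\<And>y. y \<in> S \<Longrightarrow> f y = g y" using assms(2) unfolding eventually_nhds by blast
  then show ?thesis by (rule frechet_derivative_transform_within_open[OF smooth_near_differentiable[OF assms(1)]])
qed

lemma frechet_derivative_sum_mult:
  fixes f g :: "'b \<Rightarrow> 'e::euclidean_space \<Rightarrow> real"
  assumes "\<And>b. b \<in> J \<Longrightarrow> smooth_near (f b) x" "\<And>b. b \<in> J \<Longrightarrow> smooth_near (g b) x"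
  shows "\<D> (\<lambda>y. \<Sum>b\<in>J. f b y * g b y) x u =
    (\<Sum>b\<in>J. f b x * \<D> (g b) x u + \<D> (f b) x u * g b x)"
  by (intro fun_cong[OF frechet_derivative_eqI] has_derivative_sum has_derivative_mult smooth_near_has_derivative assms)

lemma ext1_euclidean:
  "ext1 \<E> \<gamma> y u v = \<D> (\<lambda>z. \<gamma> z v) y u - \<D> (\<lambda>z. \<gamma> z u) y v"
  by (simp add: ext1_def chart_at_euclidean cinv_UNIV frame_def)

text \<open>Differentiating the coordinate formula gives terms with first derivatives of the
  coefficients, which form the right-hand side, and terms with second derivatives of
  \<open>f\<close>, which cancel on antisymmetrising.\<close>

lemma ext1_pull1_euclidean:
  assumes B: "smooth_manifold B" and f: "smooth_at \<E> B f y" and \<alpha>: "smooth_form1 B \<alpha>"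
  shows "ext1 \<E> (pull1 \<E> B f \<alpha>) y u v = ext1 B \<alpha> (f y) (tangent_map \<E> B f y u) (tangent_map \<E> B f y v)"
proof -
  let ?d = "chart_at B (f y)"
  note d = chart_at_in[OF B, of "f y"]
  have lin: "\<And>q. linear (\<alpha> q)" using \<alpha> by (simp add: smooth_form1_def)
  define G where "G x = snd ?d (f x)" for x
  define a where "a b x = comp1 B ?d \<alpha> b x" for b x
  define DG where "DG w z = \<D> G z w" for w z
  define D2 where "D2 w u = \<D> (DG w) y u" for w u
  define Da where "Da b U = \<D> (a b) (G y) U" for b U
  have a: "smooth_near (a b) (G y)" for b
    using \<alpha> d unfolding smooth_form1_iff[OF B] a_def[abs_def] G_def by blast
  have G: "smooth_near G y" unfolding G_def[abs_def] by (rule tangent_map_euclidean_frame(2)[OF B d f])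
  have DG: "smooth_near (DG w) y" for w unfolding DG_def[abs_def] by (rule smooth_near_frechet[OF G])
  have tm: "tangent_map \<E> B f y w = DG w y" for w
    by (simp add: tangent_map_from_euclidean DG_def G_def[abs_def])
  have Dp: "\<D> (\<lambda>z. pull1 \<E> B f \<alpha> z w) y u =
      (\<Sum>b\<in>Basis. (DG w y \<bullet> b) * Da b (DG u y) + (D2 w u \<bullet> b) * a b (G y))" for w u
  proof -
    have "\<D> (\<lambda>z. pull1 \<E> B f \<alpha> z w) y =
        \<D> (\<lambda>z. \<Sum>b\<in>Basis. (DG w z \<bullet> b) * a b (G z)) y"
      by (rule frechet_derivative_cong[OF smooth_near_pull1[OF B f \<alpha>]])
        (rule eventually_mono[OF pull1_coordinates[where \<alpha>=\<alpha>, OF B d f lin]], simp add: DG_def G_def[abs_def] a_def)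
    then have "\<D> (\<lambda>z. pull1 \<E> B f \<alpha> z w) y u =
        \<D> (\<lambda>z. \<Sum>b\<in>Basis. (DG w z \<bullet> b) * a b (G z)) y u" by simp
    also have "\<dots> = (\<Sum>b\<in>Basis. (DG w y \<bullet> b) * \<D> (\<lambda>z. a b (G z)) y u +
        \<D> (\<lambda>z. DG w z \<bullet> b) y u * a b (G y))"
      by (rule frechet_derivative_sum_mult) (intro smooth_near_inner DG smooth_near_compose[OF a G])+
    finally have 1: "\<D> (\<lambda>z. pull1 \<E> B f \<alpha> z w) y u =
        (\<Sum>b\<in>Basis. (DG w y \<bullet> b) * \<D> (\<lambda>z. a b (G z)) y u +
        \<D> (\<lambda>z. DG w z \<bullet> b) y u * a b (G y))" .
    have 2: "\<D> (\<lambda>z. a b (G z)) y u = Da b (DG u y)" for b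
      unfolding Da_def DG_def
      by (intro fun_cong[OF frechet_derivative_eqI] has_derivative_compose[OF smooth_near_has_derivative[OF G]]
          smooth_near_has_derivative[OF a])
    have 3: "\<D> (\<lambda>z. DG w z \<bullet> b) y u = D2 w u \<bullet> b" for b
      unfolding D2_def
      by (intro fun_cong[OF frechet_derivative_eqI] has_derivative_inner_left smooth_near_has_derivative DG)
    show ?thesis unfolding 1 2 3 ..
  qed
  \<comment> \<open>Symmetry of second derivatives: this removes the only terms that are not
    tensorial in the tangent map.\<close>
  have sym: "D2 v u = D2 u v"
    unfolding D2_def DG_def[abs_def] by (rule frechet_derivative_commute[OF G])
  have Dq: "\<D> (a W) (G y) U = (\<Sum>b\<in>Basis. (W \<bullet> b) * Da b U)" for U W
  proof -
    have "\<forall>\<^sub>F x in nhds (G y). a W x = (\<Sum>b\<in>Basis. (W \<bullet> b) * a b x)"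
      unfolding eventually_nhds
    proof (intro exI conjI ballI)
      show "open (snd ?d ` fst ?d)" by (rule open_chart_image[OF B d(1)])
      show "G y \<in> snd ?d ` fst ?d" using d by (simp add: G_def)
      fix x assume "x \<in> snd ?d ` fst ?d"
      then have "cinv ?d x \<in> fst ?d" by (rule cinv_in[OF B d(1)])
      then show "a W x = (\<Sum>b\<in>Basis. (W \<bullet> b) * a b x)"
        unfolding a_def by (rule linear_form_frame[OF lin linear_frame[OF B d(1)]])
    qed
    from frechet_derivative_cong[OF a this]
    have "\<D> (a W) (G y) U = \<D> (\<lambda>x. \<Sum>b\<in>Basis. (W \<bullet> b) * a b x) (G y) U"
      by simp
    also have "\<dots> = (\<Sum>b\<in>Basis. (W \<bullet> b) * Da b U)"
      unfolding Da_def
      by (intro fun_cong[OF frechet_derivative_eqI] has_derivative_sum has_derivative_mult_right smooth_near_has_derivative a)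
    finally show ?thesis .
  qed
  have "ext1 B \<alpha> (f y) U W = \<D> (a W) (G y) U - \<D> (a U) (G y) W" for U W
    unfolding ext1_def Let_def a_def[abs_def] G_def ..
  then show ?thesis
    unfolding ext1_euclidean Dp Dq tm by (simp add: sum.distrib sym)
qed

lemma pull1_cinv:
  assumes "smooth_manifold A" "c \<in> A" "y \<in> snd c ` fst c"
  shows "pull1 \<E> A (cinv c) \<alpha> y w = comp1 A c \<alpha> w y"
  unfolding pull1_def
  using frame_eq_tangent_map[OF assms(1,2) cinv_in[OF assms]] chart_cinv[OF assms] by simp

lemma ext1_chart_at:
  assumes A: "smooth_manifold A" and near: "\<And>w. smooth_near (\<lambda>y. pull1 \<E> A (cinv (chart_at A p)) \<alpha> y w) (snd (chart_at A p) p)"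
  shows "ext1 A \<alpha> p u v = ext1 \<E> (pull1 \<E> A (cinv (chart_at A p)) \<alpha>) (snd (chart_at A p) p) u v"
proof -
  let ?c = "chart_at A p"
  note c = chart_at_in[OF A, of p]
  have "\<D> (\<lambda>y. pull1 \<E> A (cinv ?c) \<alpha> y w) (snd ?c p) =
      \<D> (\<lambda>y. comp1 A ?c \<alpha> w y) (snd ?c p)" for w
    by (rule frechet_derivative_cong[OF near])
      (rule eventually_mono[OF eventually_chart_image[OF A c]], rule pull1_cinv[OF A c(1)])
  then show ?thesis unfolding ext1_euclidean by (simp add: ext1_def Let_def)
qed

lemma pull1_pull1:
  assumes "smooth_manifold A" "smooth_manifold B" "smooth_manifold D" "smooth_at A B f p" "smooth_at B D g (f p)"
  shows "pull1 A B f (pull1 B D g \<alpha>) p = pull1 A D (\<lambda>x. g (f x)) \<alpha> p"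
  by (rule ext) (simp add: pull1_def tangent_map_compose[OF assms])

lemma smooth_near_pull1_cinv:
  assumes A: "smooth_manifold A" and B: "smooth_manifold B" and f: "smooth_at A B f p"
    and \<alpha>: "smooth_form1 B \<alpha>" and c: "c \<in> A" "p \<in> fst c"
  shows "\<forall>\<^sub>F y in nhds (snd c p). \<forall>w. pull1 \<E> A (cinv c) (pull1 A B f \<alpha>) y w = pull1 \<E> B (\<lambda>y. f (cinv c y)) \<alpha> y w"
    and "smooth_near (\<lambda>y. pull1 \<E> A (cinv c) (pull1 A B f \<alpha>) y w) (snd c p)"
    and "smooth_at \<E> B (\<lambda>y. f (cinv c y)) (snd c p)"
proof -
  note E = manifold_euclidean
  have fc: "smooth_at \<E> B (\<lambda>y. f (cinv c y)) y" if "y \<in> snd c ` fst c" "smooth_at A B f (cinv c y)" for y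
  proof -
    have "smooth_at \<E> A (cinv c) y"
      by (rule smooth_at_cinv_image[OF A c(1) that(1)])
    from smooth_at_compose[OF E A B this that(2)] show ?thesis .
  qed
  show f': "smooth_at \<E> B (\<lambda>y. f (cinv c y)) (snd c p)"
    by (rule fc) (use c cinv_chart[OF A c] f in auto)
  have in_chart: "\<forall>\<^sub>F y in nhds (snd c p). y \<in> snd c ` fst c"
    by (rule eventually_chart_image[OF A c])
  show ev: "\<forall>\<^sub>F y in nhds (snd c p). \<forall>w. pull1 \<E> A (cinv c) (pull1 A B f \<alpha>) y w = pull1 \<E> B (\<lambda>y. f (cinv c y)) \<alpha> y w"
    using in_chart eventually_cinv[OF A c smooth_at_eventually[OF f]]
  proof eventually_elim
    case (elim y)
    have "smooth_at \<E> A (cinv c) y"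
      by (rule smooth_at_cinv_image[OF A c(1) elim(1)])
    from pull1_pull1[OF E A B this elim(2)] show ?case by simp
  qed
  show "smooth_near (\<lambda>y. pull1 \<E> A (cinv c) (pull1 A B f \<alpha>) y w) (snd c p)"
    by (rule smooth_near_cong[OF smooth_near_pull1[OF B f' \<alpha>, of w]]) (use ev in \<open>auto elim: eventually_mono\<close>)
qed

text \<open>Reduces to a Euclidean source by composing with the inverse of the chart picked at
  \<open>p\<close>: in that chart both \<open>ext1 A\<close> and the tangent vectors at
  \<open>p\<close> are read, and its frame at \<open>p\<close> is the identity.\<close>

lemma ext1_pull1:
  assumes A: "smooth_manifold A" and B: "smooth_manifold B" and f: "smooth_at A B f p" and \<alpha>: "smooth_form1 B \<alpha>"
  shows "ext1 A (pull1 A B f \<alpha>) p u v = ext1 B \<alpha> (f p) (tangent_map A B f p u) (tangent_map A B f p v)"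
proof -
  note E = manifold_euclidean
  let ?c = "chart_at A p"
  note c = chart_at_in[OF A, of p]
  note near = smooth_near_pull1_cinv[OF A B f \<alpha> c]
  have p: "cinv ?c (snd ?c p) = p" by (rule cinv_chart[OF A c])
  have "\<D> (\<lambda>y. pull1 \<E> A (cinv ?c) (pull1 A B f \<alpha>) y w) (snd ?c p) =
      \<D> (\<lambda>y. pull1 \<E> B (\<lambda>y. f (cinv ?c y)) \<alpha> y w) (snd ?c p)" for w
    by (rule frechet_derivative_cong[OF near(2)]) (use near(1) in \<open>auto elim: eventually_mono\<close>)
  then have "ext1 A (pull1 A B f \<alpha>) p u v = ext1 \<E> (pull1 \<E> B (\<lambda>y. f (cinv ?c y)) \<alpha>) (snd ?c p) u v"
    unfolding ext1_chart_at[OF A near(2)] ext1_euclidean by simp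
  moreover have "tangent_map \<E> B (\<lambda>y. f (cinv ?c y)) (snd ?c p) w = tangent_map A B f p w" for w
  proof -
    have "smooth_at A B f (cinv ?c (snd ?c p))" using f p by simp
    from tangent_map_compose[OF E A B smooth_at_cinv[OF A c] this]
    show ?thesis using p frame_chart_at[OF A, of p w] frame_eq_tangent_map[OF A c] by simp
  qed
  ultimately show ?thesis using ext1_pull1_euclidean[OF B near(3) \<alpha>] p by simp
qed

lemma smooth_form1_pull1I:
  assumes A: "smooth_manifold A" and lin: "\<And>p. linear (\<alpha> p)"
    and near: "\<And>c p w. c \<in> A \<Longrightarrow> p \<in> fst c \<Longrightarrow> smooth_near (\<lambda>y. pull1 \<E> A (cinv c) \<alpha> y w) (snd c p)"
  shows "smooth_form1 A \<alpha>"
  unfolding smooth_form1_iff[OF A]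
proof (intro conjI allI ballI lin)
  fix c p v assume c: "c \<in> A" "p \<in> fst c"
  show "smooth_near (\<lambda>y. comp1 A c \<alpha> v y) (snd c p)"
    by (rule smooth_near_cong[OF near[OF c, of v]])
      (rule eventually_mono[OF eventually_chart_image[OF A c]], rule pull1_cinv[OF A c(1)])
qed

lemma smooth_form1_pull1:
  assumes A: "smooth_manifold A" and B: "smooth_manifold B" and f: "\<And>p. smooth_at A B f p" and \<alpha>: "smooth_form1 B \<alpha>"
  shows "smooth_form1 A (pull1 A B f \<alpha>)"
proof (rule smooth_form1_pull1I[OF A])
  show "linear (pull1 A B f \<alpha> p)" for p
    using linear_compose[OF linear_tangent_map[OF A B f], of "\<alpha> (f p)" p] \<alpha>
    by (simp add: smooth_form1_def pull1_def[abs_def] o_def)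
qed (rule smooth_near_pull1_cinv(2)[OF A B f \<alpha>])

lemma smooth_form1_scale:
  assumes A: "smooth_manifold A" and k: "\<And>p. smooth_at A \<E> k p" and \<alpha>: "smooth_form1 A \<alpha>"
  shows "smooth_form1 A (\<lambda>p w. k p * \<alpha> p w)"
  unfolding smooth_form1_iff[OF A]
proof (intro conjI allI ballI)
  show "linear (\<lambda>w. k p * \<alpha> p w)" for p
    using \<alpha> linear_compose_scale_right[of "\<alpha> p" "k p"] by (simp add: smooth_form1_def)
  fix c p v assume c: "c \<in> A" "p \<in> fst c"
  show "smooth_near (\<lambda>y. k (cinv c y) * comp1 A c \<alpha> v y) (snd c p)"
    using \<alpha> c unfolding smooth_form1_iff[OF A]
    by (intro smooth_near_mult smooth_fun_chart[OF A c k]) auto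
qed

lemma ext1_diff:
  assumes A: "smooth_manifold A" and \<alpha>: "smooth_form1 A \<alpha>" and \<beta>: "smooth_form1 A \<beta>"
  shows "ext1 A (\<lambda>p w. \<alpha> p w - \<beta> p w) p u v = ext1 A \<alpha> p u v - ext1 A \<beta> p u v"
proof -
  let ?c = "chart_at A p"
  have near: "smooth_near (\<lambda>y. comp1 A ?c \<alpha> w y) (snd ?c p)"
    if "smooth_form1 A \<alpha>" for \<alpha> w
    using that chart_at_in[OF A, of p] unfolding smooth_form1_iff[OF A] by blast
  have "\<D> (\<lambda>y. comp1 A ?c \<alpha> w y - comp1 A ?c \<beta> w y) (snd ?c p) u
     = \<D> (\<lambda>y. comp1 A ?c \<alpha> w y) (snd ?c p) u
      - \<D> (\<lambda>y. comp1 A ?c \<beta> w y) (snd ?c p) u" for u w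
    by (intro fun_cong[OF frechet_derivative_eqI] has_derivative_diff smooth_near_has_derivative near \<alpha> \<beta>)
  then show ?thesis by (simp add: ext1_def Let_def)
qed

lemma ext1_scale:
  assumes A: "smooth_manifold A" and k: "smooth_at A \<E> k p" and \<alpha>: "smooth_form1 A \<alpha>"
  shows "ext1 A (\<lambda>q w. k q * \<alpha> q w) p u v = wedge (ext0 A k p) (\<alpha> p) u v + k p * ext1 A \<alpha> p u v"
proof -
  let ?c = "chart_at A p"
  note c = chart_at_in[OF A, of p]
  have near: "smooth_near (\<lambda>y. comp1 A ?c \<alpha> w y) (snd ?c p)" for w
    using \<alpha> c unfolding smooth_form1_iff[OF A] by blast
  have k': "smooth_near (\<lambda>y. k (cinv ?c y)) (snd ?c p)" by (rule smooth_fun_chart[OF A c k])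
  have "\<D> (\<lambda>y. k (cinv ?c y) * comp1 A ?c \<alpha> w y) (snd ?c p) u
     = k p * \<D> (\<lambda>y. comp1 A ?c \<alpha> w y) (snd ?c p) u
      + ext0 A k p u * \<alpha> p w" for u w
  proof -
    have p: "cinv ?c (snd ?c p) = p" "frame A ?c p w = w" using cinv_chart[OF A c] frame_chart_at[OF A] by auto
    have "((\<lambda>y. k (cinv ?c y) * comp1 A ?c \<alpha> w y) has_derivative
      (\<lambda>u. k (cinv ?c (snd ?c p)) * \<D> (\<lambda>y. comp1 A ?c \<alpha> w y) (snd ?c p) u
      + \<D> (\<lambda>y. k (cinv ?c y)) (snd ?c p) u *
         \<alpha> (cinv ?c (snd ?c p)) (frame A ?c (cinv ?c (snd ?c p)) w))) (at (snd ?c p))"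
      by (intro has_derivative_mult smooth_near_has_derivative near k')
    from fun_cong[OF frechet_derivative_eqI[OF this], of u] show ?thesis by (simp add: p ext0_def)
  qed
  then show ?thesis by (simp add: ext1_def Let_def wedge_def algebra_simps)
qed

text \<open>Near \<open>p\<close>, in the chart \<open>c\<close>, the form is d of a form \<gamma>
  with smooth coefficients. A form given only pointwise obtains both smoothness and closedness from
  this single property, and \<gamma> itself may be local and depend on choices.\<close>

definition exact_in ::
    "('m::{t2_space,second_countable_topology}, 'e::euclidean_space) atlas \<Rightarrow> ('m, 'e) chart \<Rightarrow> ('m, 'e) tensor2 \<Rightarrow> 'm \<Rightarrow> bool" where
  "exact_in A c \<omega> p \<longleftrightarrow> (\<exists>\<gamma>. \<forall>\<^sub>F y in nhds (snd c p). (\<forall>w. smooth_near (\<lambda>y. \<gamma> y w) y) \<and>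
     (\<forall>a b. comp2 A c \<omega> a b y = ext1 \<E> \<gamma> y a b))"

lemma smooth_near_ext1:
  assumes "\<And>w. smooth_near (\<lambda>y. \<gamma> y w) y0"
  shows "smooth_near (\<lambda>y. ext1 \<E> \<gamma> y a b) y0"
  unfolding ext1_euclidean by (intro smooth_near_diff smooth_near_frechet assms)

lemma exact_inE:
  assumes "exact_in A c \<omega> p"
  obtains \<gamma> where "\<And>w. smooth_near (\<lambda>y. \<gamma> y w) (snd c p)"
    and "\<forall>\<^sub>F y in nhds (snd c p). \<forall>w. smooth_near (\<lambda>y. \<gamma> y w) y"
    and "\<forall>\<^sub>F y in nhds (snd c p). \<forall>a b. comp2 A c \<omega> a b y = ext1 \<E> \<gamma> y a b"
proof -
  obtain \<gamma> where "\<forall>\<^sub>F y in nhds (snd c p). (\<forall>w. smooth_near (\<lambda>y. \<gamma> y w) y) \<and>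
     (\<forall>a b. comp2 A c \<omega> a b y = ext1 \<E> \<gamma> y a b)"
    using assms unfolding exact_in_def by blast
  then show thesis
    by (intro that[of \<gamma>]) (auto elim: eventually_mono dest: eventually_nhds_x_imp_x)
qed

lemma exact_in_smooth:
  assumes "exact_in A c \<omega> p"
  shows "smooth_near (\<lambda>y. comp2 A c \<omega> a b y) (snd c p)"
proof -
  obtain \<gamma> where \<gamma>: "\<And>w. smooth_near (\<lambda>y. \<gamma> y w) (snd c p)"
    "\<forall>\<^sub>F y in nhds (snd c p). \<forall>a b. comp2 A c \<omega> a b y = ext1 \<E> \<gamma> y a b"
    using assms by (rule exact_inE) blast
  show ?thesis
    by (rule smooth_near_cong[OF smooth_near_ext1[OF \<gamma>(1)]]) (use \<gamma>(2) in \<open>auto elim: eventually_mono\<close>)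
qed

text \<open>This is d d = 0: in the cyclic sum the second derivatives of the coefficients of
  \<gamma> cancel in pairs.\<close>

lemma exact_in_ext2:
  assumes "exact_in A (chart_at A p) \<omega> p"
  shows "ext2 A \<omega> p u v w = 0"
proof -
  let ?c = "chart_at A p"
  obtain \<gamma> where \<gamma>: "\<And>w. smooth_near (\<lambda>y. \<gamma> y w) (snd ?c p)"
    and ev: "\<forall>\<^sub>F y in nhds (snd ?c p). \<forall>a b. comp2 A ?c \<omega> a b y = ext1 \<E> \<gamma> y a b"
    using assms by (rule exact_inE) blast
  define D where "D w u y = \<D> (\<lambda>y. \<gamma> y w) y u" for w u y
  define DD where "DD w u v = \<D> (D w u) (snd ?c p) v" for w u v
  have sD: "smooth_near (D w u) (snd ?c p)" for w u
    unfolding D_def[abs_def] by (rule smooth_near_frechet[OF \<gamma>])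
  have "\<D> (\<lambda>y. comp2 A ?c \<omega> a b y) (snd ?c p) x
      = DD b a x - DD a b x" for a b x
  proof -
    have "\<D> (\<lambda>y. comp2 A ?c \<omega> a b y) (snd ?c p)
       = \<D> (\<lambda>y. D b a y - D a b y) (snd ?c p)"
      by (rule frechet_derivative_cong[OF exact_in_smooth[OF assms]])
        (use ev in \<open>auto elim: eventually_mono simp: ext1_euclidean D_def\<close>)
    moreover have "\<dots> x = DD b a x - DD a b x"
      unfolding DD_def
      by (intro fun_cong[OF frechet_derivative_eqI] has_derivative_diff smooth_near_has_derivative sD)
    ultimately show ?thesis by simp
  qed
  moreover have "DD a b x = DD a x b" for a b x
    unfolding DD_def D_def[abs_def] by (rule frechet_derivative_commute[OF \<gamma>])
  ultimately show ?thesis unfolding ext2_def Let_def by simp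
qed

text \<open>By naturality the pull-back of d\<alpha> is d of the pull-back of \<alpha>. With
  \<open>f\<close> a local section of P this is applied to the curvature on W.\<close>

lemma exact_in_pull:
  assumes A: "smooth_manifold A" and B: "smooth_manifold B" and f: "smooth_at A B f p"
    and \<alpha>: "smooth_form1 B \<alpha>" and c: "c \<in> A" "p \<in> fst c"
    and \<omega>: "\<forall>\<^sub>F q in nhds p. \<forall>u v. \<omega> q u v = ext1 B \<alpha> (f q) (tangent_map A B f q u) (tangent_map A B f q v)"
  shows "exact_in A c \<omega> p"
proof -
  note E = manifold_euclidean
  have in_chart: "\<forall>\<^sub>F y in nhds (snd c p). y \<in> snd c ` fst c"
    by (rule eventually_chart_image[OF A c])
  have "\<forall>\<^sub>F y in nhds (snd c p). \<forall>a b. comp2 A c \<omega> a b y =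
      ext1 \<E> (pull1 \<E> B (\<lambda>y. f (cinv c y)) \<alpha>) y a b"
    using in_chart eventually_cinv[OF A c smooth_at_eventually[OF f]] eventually_cinv[OF A c \<omega>]
  proof eventually_elim
    case (elim y)
    have sc: "smooth_at \<E> A (cinv c) y"
      by (rule smooth_at_cinv_image[OF A c(1) elim(1)])
    have "tangent_map A B f (cinv c y) (frame A c (cinv c y) a) = tangent_map \<E> B (\<lambda>y. f (cinv c y)) y a" for a
      using tangent_map_compose[OF E A B sc elim(2)] frame_eq_tangent_map[OF A c(1) cinv_in[OF A c(1) elim(1)]]
        chart_cinv[OF A c(1) elim(1)] by simp
    then show ?case
      using ext1_pull1_euclidean[OF B smooth_at_compose[OF E A B sc elim(2)] \<alpha>] elim(3) by simp
  qed
  moreover have "\<forall>\<^sub>F y in nhds (snd c p). \<forall>w. smooth_near (\<lambda>y. pull1 \<E> B (\<lambda>y. f (cinv c y)) \<alpha> y w) y"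
    using smooth_at_eventually[OF smooth_near_pull1_cinv(3)[OF A B f \<alpha> c]]
    by eventually_elim (simp add: smooth_near_pull1[OF B _ \<alpha>])
  ultimately show ?thesis unfolding exact_in_def by (auto intro: eventually_conj)
qed

lemma exact_in_ext1:
  assumes A: "smooth_manifold A" and \<alpha>: "smooth_form1 A \<alpha>" and c: "c \<in> A" "p \<in> fst c"
  shows "exact_in A c (ext1 A \<alpha>) p"
  by (rule exact_in_pull[OF A A smooth_at_ident[OF A] \<alpha> c]) (simp add: tangent_map_ident[OF A])

text \<open>Allows an identity between forms to be solved for one of them, whose closedness is then
  inherited from the others.\<close>

lemma exact_in_lincomb:
  assumes A: "smooth_manifold A" and c: "c \<in> A" "p \<in> fst c"
    and 1: "exact_in A c \<omega>1 p" and 2: "exact_in A c \<omega>2 p"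
    and \<omega>: "\<forall>\<^sub>F q in nhds p. \<forall>u v. \<omega> q u v = k * \<omega>1 q u v - \<omega>2 q u v"
  shows "exact_in A c \<omega> p"
proof -
  obtain \<gamma> where \<gamma>: "\<forall>\<^sub>F y in nhds (snd c p). \<forall>w. smooth_near (\<lambda>y. \<gamma> y w) y"
      "\<forall>\<^sub>F y in nhds (snd c p). \<forall>a b. comp2 A c \<omega>1 a b y = ext1 \<E> \<gamma> y a b"
    using 1 by (rule exact_inE) blast
  obtain \<delta> where \<delta>: "\<forall>\<^sub>F y in nhds (snd c p). \<forall>w. smooth_near (\<lambda>y. \<delta> y w) y"
      "\<forall>\<^sub>F y in nhds (snd c p). \<forall>a b. comp2 A c \<omega>2 a b y = ext1 \<E> \<delta> y a b"
    using 2 by (rule exact_inE) blast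
  have lin: "ext1 \<E> (\<lambda>y w. k * \<gamma> y w - \<delta> y w) y a b = k * ext1 \<E> \<gamma> y a b - ext1 \<E> \<delta> y a b"
    if "\<forall>w. smooth_near (\<lambda>y. \<gamma> y w) y" "\<forall>w. smooth_near (\<lambda>y. \<delta> y w) y" for y a b
  proof -
    have D: "\<D> (\<lambda>y. k * \<gamma> y w - \<delta> y w) y u =
        k * \<D> (\<lambda>y. \<gamma> y w) y u - \<D> (\<lambda>y. \<delta> y w) y u" for w u
      by (intro fun_cong[OF frechet_derivative_eqI] has_derivative_diff has_derivative_mult_right
          smooth_near_has_derivative that[rule_format])
    show ?thesis unfolding ext1_euclidean D by (simp add: algebra_simps)
  qed
  have "\<forall>\<^sub>F y in nhds (snd c p). (\<forall>w. smooth_near (\<lambda>y. k * \<gamma> y w - \<delta> y w) y) \<and>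
     (\<forall>a b. comp2 A c \<omega> a b y = ext1 \<E> (\<lambda>y w. k * \<gamma> y w - \<delta> y w) y a b)"
    using \<gamma> \<delta> eventually_cinv[OF A c \<omega>]
  proof eventually_elim
    case (elim y)
    then show ?case
      using lin[of y] by (auto intro!: smooth_near_diff smooth_near_mult smooth_near_const)
  qed
  then show ?thesis unfolding exact_in_def by (intro exI[of _ "\<lambda>y w. k * \<gamma> y w - \<delta> y w"])
qed

section \<open>Circle actions\<close>

lemma tangent_map_to_euclidean:
  "tangent_map A \<E> f p = \<D> (\<lambda>y. f (cinv (chart_at A p) y)) (snd (chart_at A p) p)"
  by (simp add: tangent_map_def chart_at_euclidean)

lemma tangent_map_Pair:
  assumes A: "smooth_manifold A" and f: "smooth_at A \<E> f p" and g: "smooth_at A \<E> g p"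
  shows "tangent_map A \<E> (\<lambda>q. (f q, g q)) p u = (tangent_map A \<E> f p u, tangent_map A \<E> g p u)"
    and "smooth_at A \<E> (\<lambda>q. (f q, g q)) p"
proof -
  note c = chart_at_in[OF A, of p] and E = manifold_euclidean
  have near: "smooth_near (\<lambda>y. f (cinv (chart_at A p) y)) (snd (chart_at A p) p)"
    "smooth_near (\<lambda>y. g (cinv (chart_at A p) y)) (snd (chart_at A p) p)"
    using smooth_at_chart[OF A c E _ _ f, of "(UNIV, \<lambda>x. x)"] smooth_at_chart[OF A c E _ _ g, of "(UNIV, \<lambda>x. x)"]
    by (simp_all add: euclidean_atlas_def)
  show "tangent_map A \<E> (\<lambda>q. (f q, g q)) p u = (tangent_map A \<E> f p u, tangent_map A \<E> g p u)"
    unfolding tangent_map_to_euclidean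
    by (intro fun_cong[OF frechet_derivative_eqI] has_derivative_Pair smooth_near_has_derivative near)
  show "smooth_at A \<E> (\<lambda>q. (f q, g q)) p"
  proof (rule smooth_atI[where f="\<lambda>q. (f q, g q)", OF A c E, of "(UNIV, \<lambda>x. x)"])
    show "isCont (\<lambda>q. (f q, g q)) p" using smooth_at_isCont f g by (metis continuous_Pair)
  qed (use smooth_near_Pair[OF near] in \<open>simp_all add: euclidean_atlas_def\<close>)
qed

lemma smooth_at_euclidean_compose:
  assumes "smooth_manifold A" "smooth_at A \<E> f p" "smooth_near g (f p)"
  shows "smooth_at A \<E> (\<lambda>x. g (f x)) p"
  by (rule smooth_at_compose[OF assms(1) manifold_euclidean manifold_euclidean assms(2)])
    (simp add: smooth_at_euclidean_iff assms(3))

locale circle_flow =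
  fixes A :: "('m::{t2_space,second_countable_topology}, 'e::euclidean_space) atlas"
    and T :: real and \<phi> :: "real \<Rightarrow> 'm \<Rightarrow> 'm" and X :: "('m, 'e) vector_field"
  assumes A: "smooth_manifold A" and action: "circle_action A T \<phi> X"
begin

lemma zero: "\<phi> 0 p = p" and plus: "\<phi> (s + t) p = \<phi> s (\<phi> t p)" and period: "\<phi> T p = p"
  using action unfolding circle_action_def by blast+

lemma minus: "\<phi> (- t) (\<phi> t p) = p" "\<phi> t (\<phi> (- t) p) = p"
  using plus[of "- t" t p] plus[of t "- t" p] zero by simp_all

lemma period_int: "\<phi> (of_int k * T) p = p"
proof -
  have nat: "\<phi> (of_nat n * T) p = p" for n p
    by (induction n) (simp_all add: zero plus period distrib_right)
  show ?thesis
  proof (cases k)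
    case (nonneg n)
    then show ?thesis using nat by simp
  next
    case (neg n)
    have "of_int k * T + of_nat (Suc n) * T = 0" unfolding neg by (simp add: algebra_simps)
    then have "\<phi> (of_int k * T) (\<phi> (of_nat (Suc n) * T) p) = p"
      unfolding plus[symmetric] by (simp add: zero)
    then show ?thesis by (simp only: nat)
  qed
qed

lemma smooth_at_flow:
  assumes D: "smooth_manifold D" and "smooth_at D \<E> f x" and "smooth_at D A k x"
  shows "smooth_at D A (\<lambda>q. \<phi> (f q) (k q)) x"
proof -
  note E = manifold_euclidean
  have "smooth_map_on (prod_atlas \<E> A) UNIV A (\<lambda>(t, p). \<phi> t p)"
    using action unfolding circle_action_def by blast
  then have "smooth_at (prod_atlas \<E> A) A (\<lambda>(t, p). \<phi> t p) (f x, k x)"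
    using smooth_map_on_iff[OF smooth_manifold_prod[OF E A] A open_UNIV] by blast
  from smooth_at_compose[OF D smooth_manifold_prod[OF E A] A smooth_at_Pair[OF E A D assms(2,3)] this]
  show ?thesis by simp
qed

lemma smooth_at_flow_time: "smooth_at \<E> A (\<lambda>t. \<phi> t p) t"
  by (intro smooth_at_flow smooth_at_const smooth_at_ident manifold_euclidean A)

lemma smooth_at_flow_space: "smooth_at A A (\<phi> t) p"
  using smooth_at_flow[OF A smooth_at_const[OF A manifold_euclidean, of t] smooth_at_ident[OF A]] by simp

text \<open>The action prescribes velocities at time 0 only; the group law carries this to time
  \<open>t\<close> by restarting the orbit at \<open>\<phi> t p\<close>.\<close>

lemma tangent_map_flow_time: "tangent_map \<E> A (\<lambda>t. \<phi> t p) t a = a *\<^sub>R X (\<phi> t p)"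
proof -
  let ?q = "\<phi> t p"
  have "((\<lambda>s. snd (chart_at A ?q) (\<phi> s ?q)) has_vector_derivative X ?q) (at 0)"
    using action unfolding circle_action_def by blast
  then have d: "((\<lambda>s. snd (chart_at A ?q) (\<phi> (s + t) p)) has_derivative (\<lambda>a. a *\<^sub>R X ?q)) (at (t - t))"
    unfolding has_vector_derivative_def plus by simp
  have "((\<lambda>s. s - t) has_derivative (\<lambda>a. a)) (at t)" by (auto intro!: derivative_eq_intros)
  from has_derivative_compose[OF this d]
  have "((\<lambda>s. snd (chart_at A ?q) (\<phi> s p)) has_derivative (\<lambda>a. a *\<^sub>R X ?q)) (at t)" by simp
  then show ?thesis unfolding tangent_map_from_euclidean by (simp add: frechet_derivative_eqI)
qed

text \<open>Differentiate \<phi> s (\<phi> t p) = \<phi> t (\<phi> s p) in \<open>t\<close> at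
  0.\<close>

lemma tangent_map_flow_generator: "tangent_map A A (\<phi> s) p (X p) = X (\<phi> s p)"
proof -
  note E = manifold_euclidean
  have "tangent_map \<E> A (\<lambda>t. \<phi> s (\<phi> t p)) 0 1 = tangent_map A A (\<phi> s) p (X p)"
    using tangent_map_compose[OF E A A smooth_at_flow_time smooth_at_flow_space, of s p 0 1]
    by (simp add: tangent_map_flow_time zero)
  moreover have "tangent_map \<E> A (\<lambda>t. \<phi> s (\<phi> t p)) 0 1 = X (\<phi> s p)"
  proof -
    have "(\<lambda>t. \<phi> s (\<phi> t p)) = (\<lambda>t. \<phi> t (\<phi> s p))" by (simp add: plus[symmetric] add.commute)
    then show ?thesis by (simp add: tangent_map_flow_time zero)
  qed
  ultimately show ?thesis by simp
qed

lemma tangent_map_flow_zero: "tangent_map A A (\<phi> 0) p u = u"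
proof -
  have "\<phi> 0 = (\<lambda>p. p)" by (rule ext) (rule zero)
  then show ?thesis using tangent_map_ident[OF A] by simp
qed

text \<open>Sum of the two partial derivatives. The map \<open>H\<close> uses time and chart
  coordinates as two Euclidean variables, so that only the splitting of a vector of a product of
  Euclidean spaces is needed.\<close>

lemma tangent_map_flow:
  assumes D: "smooth_manifold D" and f: "smooth_at D \<E> f x" and k: "smooth_at D A k x"
  shows "tangent_map D A (\<lambda>q. \<phi> (f q) (k q)) x u =
    tangent_map D \<E> f x u *\<^sub>R X (\<phi> (f x) (k x)) + tangent_map A A (\<phi> (f x)) (k x) (tangent_map D A k x u)"
proof -
  note E = manifold_euclidean
  let ?c = "chart_at D x"
  note c = chart_at_in[OF D, of x]
  define H where "H z = \<phi> (fst z) (k (cinv ?c (snd z)))" for z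
  let ?y = "snd ?c x"
  have kc: "smooth_at \<E> A (\<lambda>y. k (cinv ?c y)) ?y"
    by (rule smooth_at_compose[OF E D A smooth_at_cinv[OF D c]]) (simp add: cinv_chart[OF D c] k)
  have H: "smooth_at \<E> A H (f x, ?y)"
    unfolding H_def
  proof (rule smooth_at_flow[OF E])
    show "smooth_at \<E> \<E> fst (f x, ?y)" by (simp add: smooth_at_euclidean_iff smooth_near_fst)
    have "smooth_at \<E> \<E> snd (f x, ?y)" by (simp add: smooth_at_euclidean_iff smooth_near_snd)
    from smooth_at_compose[OF E E A this] kc
    show "smooth_at \<E> A (\<lambda>z. k (cinv ?c (snd z))) (f x, ?y)" by simp
  qed
  note P = tangent_map_Pair[OF D f smooth_at_chart_map[OF D c]]
  have "tangent_map D A (\<lambda>q. H (f q, snd ?c q)) x u = tangent_map \<E> A H (f x, ?y) (tangent_map D \<E> (\<lambda>q. (f q, snd ?c q)) x u)"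
    by (rule tangent_map_compose[OF D E A P(2) H])
  moreover have "tangent_map D A (\<lambda>q. \<phi> (f q) (k q)) x = tangent_map D A (\<lambda>q. H (f q, snd ?c q)) x"
    by (rule tangent_map_cong[OF D A smooth_at_flow[OF D f k]])
      (use open_chart[OF D c(1)] c(2) cinv_chart[OF D c(1)] in \<open>auto simp: eventually_nhds H_def\<close>)
  moreover have "tangent_map D \<E> (snd ?c) x u = u"
    unfolding coframe_eq_tangent_map[OF D c, symmetric]
    using coframe_frame[OF D c, of u] frame_chart_at[OF D] by metis
  ultimately have 1: "tangent_map D A (\<lambda>q. \<phi> (f q) (k q)) x u = tangent_map \<E> A H (f x, ?y) (tangent_map D \<E> f x u, u)"
    using P(1) by simp
  have lin: "linear (tangent_map \<E> A H (f x, ?y))" by (rule linear_tangent_map[OF E A H])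
  have s1: "tangent_map \<E> A H (f x, ?y) (a, 0) = a *\<^sub>R X (\<phi> (f x) (k x))" for a
  proof -
    have "((\<lambda>t. (t, ?y)) has_derivative (\<lambda>a. (a, 0))) (at (f x))" by (auto intro!: derivative_eq_intros)
    then have "tangent_map \<E> \<E> (\<lambda>t. (t, ?y)) (f x) a = (a, 0)"
      by (simp add: tangent_map_euclidean frechet_derivative_eqI)
    moreover have "smooth_at \<E> \<E> (\<lambda>t. (t, ?y)) (f x)"
      by (simp add: smooth_at_euclidean_iff smooth_near_Pair smooth_near_ident smooth_near_const)
    ultimately have "tangent_map \<E> A (\<lambda>t. H (t, ?y)) (f x) a = tangent_map \<E> A H (f x, ?y) (a, 0)"
      using tangent_map_compose[where f="\<lambda>t. (t, ?y)", OF E E A _ H] by simp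
    then show ?thesis by (simp add: H_def cinv_chart[OF D c] tangent_map_flow_time)
  qed
  have s2: "tangent_map \<E> A H (f x, ?y) (0, b) = tangent_map A A (\<phi> (f x)) (k x) (tangent_map D A k x b)" for b
  proof -
    have "((\<lambda>y. (f x, y)) has_derivative (\<lambda>b. (0, b))) (at ?y)" by (auto intro!: derivative_eq_intros)
    then have "tangent_map \<E> \<E> (\<lambda>y. (f x, y)) ?y b = (0, b)"
      by (simp add: tangent_map_euclidean frechet_derivative_eqI)
    moreover have "smooth_at \<E> \<E> (\<lambda>y. (f x, y)) ?y"
      by (simp add: smooth_at_euclidean_iff smooth_near_Pair smooth_near_ident smooth_near_const)
    ultimately have "tangent_map \<E> A (\<lambda>y. H (f x, y)) ?y b = tangent_map \<E> A H (f x, ?y) (0, b)"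
      using tangent_map_compose[where f="\<lambda>y. (f x, y)", OF E E A _ H] by simp
    moreover have "tangent_map \<E> A (\<lambda>y. H (f x, y)) ?y b =
        tangent_map A A (\<phi> (f x)) (k x) (tangent_map \<E> A (\<lambda>y. k (cinv ?c y)) ?y b)"
      using tangent_map_compose[OF E A A kc smooth_at_flow_space, of "f x" b]
      by (simp add: H_def cinv_chart[OF D c])
    moreover have "tangent_map \<E> A (\<lambda>y. k (cinv ?c y)) ?y b = tangent_map D A k x b"
    proof -
      have "smooth_at D A k (cinv ?c ?y)" using k cinv_chart[OF D c] by simp
      from tangent_map_compose[OF E D A smooth_at_cinv[OF D c] this]
      show ?thesis using cinv_chart[OF D c] frame_chart_at[OF D]
        by (simp add: frame_eq_tangent_map[OF D c, symmetric])
    qed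
    ultimately show ?thesis by simp
  qed
  show ?thesis
    using 1 s1[of "tangent_map D \<E> f x u"] s2[of u] linear_add[OF lin, of "(tangent_map D \<E> f x u, 0)" "(0, u)"]
    by simp
qed

end

text \<open>Each level set is open and closed in the real line. It is open because in a chart around
  \<open>c s\<close> the coordinate curve has zero derivative and is constant on a ball.\<close>

lemma constant_curve:
  assumes A: "smooth_manifold A" and c: "\<And>t::real. smooth_at \<E> A c t" and 0: "\<And>t. tangent_map \<E> A c t 1 = 0"
  shows "c s = c t"
proof -
  have cont: "continuous_on UNIV c" using smooth_at_isCont[OF c] by (simp add: continuous_at_imp_continuous_on)
  let ?S = "{s. c s = c t}"
  have "open ?S"
  proof (rule openI)
    fix s assume "s \<in> ?S"
    let ?d = "chart_at A (c s)"
    note d = chart_at_in[OF A, of "c s"]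
    have "\<forall>\<^sub>F r in nhds s. c r \<in> fst ?d"
      by (rule isCont_eventually[OF smooth_at_isCont[OF c] open_chart[OF A d(1)] d(2)])
    then obtain e where e: "e > 0" "\<And>r. dist r s < e \<Longrightarrow> c r \<in> fst ?d"
      unfolding eventually_nhds_metric by blast
    have der: "((\<lambda>r. snd ?d (c r)) has_derivative (\<lambda>_. 0)) (at r)" if "dist r s < e" for r
    proof -
      note E = manifold_euclidean
      have near: "smooth_near (\<lambda>r. snd ?d (c r)) r"
        by (rule tangent_map_euclidean_frame(2)[OF A d(1) e(2)[OF that] c])
      have "tangent_map \<E> \<E> (\<lambda>r. snd ?d (c r)) r 1 = 0"
        using tangent_map_compose[OF E A E c smooth_at_chart_map[OF A d(1) e(2)[OF that]], of 1] 0
          linear_0[OF linear_tangent_map[OF A E smooth_at_chart_map[OF A d(1) e(2)[OF that]]]] by simp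
      then have "\<D> (\<lambda>r. snd ?d (c r)) r a = 0" for a
        using linear_cmul[OF linear_frechet_derivative[OF smooth_near_differentiable[OF near]], of a 1]
        by (simp add: tangent_map_euclidean)
      then show ?thesis using smooth_near_has_derivative[OF near] by presburger
    qed
    have "c r = c s" if "r \<in> ball s e" for r
    proof -
      have "snd ?d (c r) = snd ?d (c s)"
        by (rule has_derivative_zero_unique[of "ball s e" "\<lambda>r. snd ?d (c r)" r s])
          (use that e der in \<open>auto simp: dist_commute intro: has_derivative_at_withinI\<close>)
      moreover have "dist r s < e" using that by (simp add: dist_commute)
      ultimately show ?thesis using cinv_chart[OF A d(1) e(2)[of r]] cinv_chart[OF A d] by simp
    qed
    then have "ball s e \<subseteq> ?S" using \<open>s \<in> ?S\<close> by (metis (mono_tags) mem_Collect_eq subsetI)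
    then show "\<exists>e>0. ball s e \<subseteq> ?S" using e(1) by blast
  qed
  moreover have "closed ?S" using continuous_closed_preimage_constant[OF cont closed_UNIV, of "c t"] by simp
  moreover have "t \<in> ?S" by simp
  ultimately have "?S = UNIV" using clopen[of ?S] by blast
  then show ?thesis by blast
qed

context circle_flow begin

lemma invariant_map:
  assumes D: "smooth_manifold D" and f: "\<And>p. smooth_at A D f p" and 0: "\<And>p. tangent_map A D f p (X p) = 0"
  shows "f (\<phi> t p) = f p"
proof -
  note E = manifold_euclidean
  have "f (\<phi> t p) = f (\<phi> 0 p)"
  proof (rule constant_curve[OF D, of "\<lambda>t. f (\<phi> t p)"])
    show "smooth_at \<E> D (\<lambda>t. f (\<phi> t p)) t" for t by (rule smooth_at_compose[OF E A D smooth_at_flow_time f])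
    show "tangent_map \<E> D (\<lambda>t. f (\<phi> t p)) t 1 = 0" for t
      using tangent_map_compose[OF E A D smooth_at_flow_time f] 0 by (simp add: tangent_map_flow_time)
  qed
  then show ?thesis by (simp add: zero)
qed

text \<open>The curve \<open>t \<mapsto> \<phi> (- t) (f (\<phi> t p))\<close> has zero velocity.\<close>
lemma flow_commute:
  assumes f: "\<And>p. smooth_at A A f p" and X: "\<And>p. tangent_map A A f p (X p) = X (f p)"
  shows "f (\<phi> t p) = \<phi> t (f p)"
proof -
  note E = manifold_euclidean
  have neg: "smooth_at \<E> \<E> (\<lambda>t. - t) t" "tangent_map \<E> \<E> (\<lambda>t. - t) t a = - a" for t a :: real
    by (auto simp: smooth_at_euclidean_iff tangent_map_euclidean
        intro!: smooth_near_minus smooth_near_ident fun_cong[OF frechet_derivative_eqI] derivative_eq_intros)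
  have fc: "smooth_at \<E> A (\<lambda>t. f (\<phi> t p)) t" for t by (rule smooth_at_compose[OF E A A smooth_at_flow_time f])
  have "\<phi> (- t) (f (\<phi> t p)) = \<phi> (- 0) (f (\<phi> 0 p))"
  proof (rule constant_curve[OF A, of "\<lambda>t. \<phi> (- t) (f (\<phi> t p))"])
    show "smooth_at \<E> A (\<lambda>t. \<phi> (- t) (f (\<phi> t p))) t" for t
      by (rule smooth_at_flow[OF E neg(1) fc])
    show "tangent_map \<E> A (\<lambda>t. \<phi> (- t) (f (\<phi> t p))) t 1 = 0" for t
    proof -
      have "tangent_map \<E> A (\<lambda>t. f (\<phi> t p)) t 1 = X (f (\<phi> t p))"
        using tangent_map_compose[OF E A A smooth_at_flow_time f] X by (simp add: tangent_map_flow_time)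
      then show ?thesis
        using tangent_map_flow[OF E neg(1) fc, of t 1] by (simp add: neg(2) tangent_map_flow_generator)
    qed
  qed
  then show ?thesis using minus(2)[of t "f (\<phi> t p)"] by (simp add: zero)
qed

text \<open>The hypothesis is Cartan's formula for \<open>L\<^sub>X \<alpha> = 0\<close>.\<close>
lemma invariant_form1I:
  assumes \<alpha>: "smooth_form1 A \<alpha>" and m: "\<And>p. smooth_at A \<E> (\<lambda>q. \<alpha> q (X q)) p"
    and cartan: "\<And>p v. ext1 A \<alpha> p (X p) v + ext0 A (\<lambda>q. \<alpha> q (X q)) p v = 0"
  shows "invariant_form1 A \<phi> \<alpha>"
  unfolding invariant_form1_def
proof (intro allI)
  fix t p u
  note E = manifold_euclidean
  let ?c = "chart_at A p"
  note c = chart_at_in[OF A, of p]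
  define y where "y = snd ?c p"
  \<comment> \<open>The flow as a map of time and chart coordinates. The coefficients of the
    pull-back \<eta> in space directions are those of the pulled-back form at time
    \<open>fst z\<close>, so invariance means that they do not depend on time.\<close>
  define \<Psi> where "\<Psi> z = \<phi> (fst z) (cinv ?c (snd z))" for z
  define \<eta> where "\<eta> = pull1 \<E> A \<Psi> \<alpha>"
  have sm: "smooth_at \<E> \<E> fst z" "smooth_at \<E> \<E> snd z" for z :: "real \<times> 'e"
    by (simp_all add: smooth_at_euclidean_iff smooth_near_fst smooth_near_snd)
  have yin: "y \<in> snd ?c ` fst ?c" using c by (simp add: y_def)
  have cs: "smooth_at \<E> A (\<lambda>z. cinv ?c (snd z)) z" if "snd z \<in> snd ?c ` fst ?c" for z :: "real \<times> 'e"
    by (rule smooth_at_compose[OF E E A sm(2) smooth_at_cinv_image[OF A c(1) that]])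
  have \<Psi>: "smooth_at \<E> A \<Psi> z" if "snd z \<in> snd ?c ` fst ?c" for z
    unfolding \<Psi>_def by (rule smooth_at_flow[OF E sm(1) cs[OF that]])
  have tfst: "tangent_map \<E> \<E> fst z w = fst w" and tsnd: "tangent_map \<E> \<E> snd z w = snd w"
    for z w :: "real \<times> 'e"
    by (auto simp: tangent_map_euclidean intro!: fun_cong[OF frechet_derivative_eqI] derivative_eq_intros)
  have tm: "tangent_map \<E> A \<Psi> z w = fst w *\<^sub>R X (\<Psi> z) +
      tangent_map A A (\<phi> (fst z)) (cinv ?c (snd z)) (tangent_map \<E> A (\<lambda>z. cinv ?c (snd z)) z w)"
    if "snd z \<in> snd ?c ` fst ?c" for z w
    using tangent_map_flow[OF E sm(1) cs[OF that]] by (simp add: \<Psi>_def[abs_def] tfst)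
  have tcs: "tangent_map \<E> A (\<lambda>z. cinv ?c (snd z)) z w = tangent_map \<E> A (cinv ?c) (snd z) (snd w)"
    if "snd z \<in> snd ?c ` fst ?c" for z :: "real \<times> 'e" and w
    using tangent_map_compose[OF E E A sm(2) smooth_at_cinv_image[OF A c(1) that]] by (simp add: tsnd)
  have lin0: "tangent_map A A (\<phi> s) q (tangent_map \<E> A (cinv ?c) (snd z) 0) = 0"
    if "snd z \<in> snd ?c ` fst ?c" for s q and z :: "real \<times> 'e"
    by (simp add: linear_0[OF linear_tangent_map[OF E A smooth_at_cinv_image[OF A c(1) that]]]
        linear_0[OF linear_tangent_map[OF A A smooth_at_flow_space]])
  have e1: "\<eta> z (1, 0) = \<alpha> (\<Psi> z) (X (\<Psi> z))" if "snd z \<in> snd ?c ` fst ?c" for z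
    unfolding \<eta>_def pull1_def tm[OF that] tcs[OF that] using lin0[OF that] by simp
  have e2: "\<eta> (s, y) (0, u) = \<alpha> (\<phi> s p) (tangent_map A A (\<phi> s) p u)" for s
  proof -
    have "tangent_map \<E> A (cinv ?c) y u = u"
      using frame_eq_tangent_map[OF A c] frame_chart_at[OF A, of p u] by (simp add: y_def)
    then show ?thesis
      unfolding \<eta>_def pull1_def using tm[of "(s, y)" "(0, u)"] tcs[of "(s, y)" "(0, u)"] yin
      by (simp add: \<Psi>_def y_def cinv_chart[OF A c])
  qed
  have s\<eta>: "smooth_near (\<lambda>z. \<eta> z w) (s, y)" for w s
    unfolding \<eta>_def by (rule smooth_near_pull1[OF A \<Psi> \<alpha>]) (simp add: yin)
  \<comment> \<open>Write d\<eta>(\<partial>t, u) as the time derivative of \<eta>(u) minus the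
    derivative of \<eta>(\<partial>t) along u. By naturality d\<eta>(\<partial>t, u) is d\<alpha>(X,
    .), and \<eta>(\<partial>t) is \<alpha>(X); the hypothesis \<open>cartan\<close> leaves zero for
    the time derivative.\<close>
  have D0: "\<D> (\<lambda>z. \<eta> z (0, u)) (s, y) (1, 0) = 0" for s
  proof -
    let ?w = "tangent_map \<E> A \<Psi> (s, y) (0, u)"
    have \<Psi>s: "smooth_at \<E> A \<Psi> (s, y)" by (rule \<Psi>) (simp add: yin)
    have "\<D> (\<lambda>z. \<eta> z (1, 0)) (s, y) =
        \<D> (\<lambda>z. \<alpha> (\<Psi> z) (X (\<Psi> z))) (s, y)"
    proof (rule frechet_derivative_cong[OF s\<eta>])
      have "open (UNIV \<times> (snd ?c ` fst ?c) :: (real \<times> 'e) set)"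
        by (intro open_Times open_UNIV open_chart_image[OF A c(1)])
      then show "\<forall>\<^sub>F z in nhds (s, y). \<eta> z (1, 0) = \<alpha> (\<Psi> z) (X (\<Psi> z))"
        unfolding eventually_nhds using yin e1 by (intro exI[of _ "UNIV \<times> (snd ?c ` fst ?c)"]) auto
    qed
    also have "\<dots> = tangent_map \<E> \<E> (\<lambda>z. \<alpha> (\<Psi> z) (X (\<Psi> z))) (s, y)" by (simp add: tangent_map_euclidean)
    finally have "\<D> (\<lambda>z. \<eta> z (1, 0)) (s, y) (0, u) =
        tangent_map \<E> \<E> (\<lambda>z. \<alpha> (\<Psi> z) (X (\<Psi> z))) (s, y) (0, u)" by simp
    also have "\<dots> = ext0 A (\<lambda>q. \<alpha> q (X q)) (\<Psi> (s, y)) ?w"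
      using tangent_map_compose[OF E A E \<Psi>s m] by (simp add: ext0_eq_tangent_map)
    finally have 1: "\<D> (\<lambda>z. \<eta> z (1, 0)) (s, y) (0, u) = ext0 A (\<lambda>q. \<alpha> q (X q)) (\<Psi> (s, y)) ?w" .
    have "tangent_map \<E> A \<Psi> (s, y) (1, 0) = X (\<Psi> (s, y))"
      using tm[of "(s, y)" "(1, 0)"] tcs[of "(s, y)" "(1, 0)"] lin0[of "(s, y)"] yin by simp
    then have "ext1 \<E> \<eta> (s, y) (1, 0) (0, u) = ext1 A \<alpha> (\<Psi> (s, y)) (X (\<Psi> (s, y))) ?w"
      unfolding \<eta>_def using ext1_pull1_euclidean[OF A \<Psi>s \<alpha>] by simp
    then show ?thesis using cartan[of "\<Psi> (s, y)" ?w] 1 by (simp add: ext1_euclidean)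
  qed
  have "((\<lambda>s. \<eta> (s, y) (0, u)) has_real_derivative 0) (at s)" for s
  proof -
    have "((\<lambda>s. (s, y)) has_derivative (\<lambda>a. (a, 0))) (at s)" by (auto intro!: derivative_eq_intros)
    from has_derivative_compose[OF this smooth_near_has_derivative[OF s\<eta>]]
    have "((\<lambda>s. \<eta> (s, y) (0, u)) has_derivative (\<lambda>a. \<D> (\<lambda>z. \<eta> z (0, u)) (s, y) (a, 0))) (at s)" .
    moreover have "\<D> (\<lambda>z. \<eta> z (0, u)) (s, y) (a, 0) = a * 0" for a
    proof -
      have "(a, 0) = a *\<^sub>R (1, 0 :: 'e)" by simp
      then show ?thesis
        using linear_cmul[OF linear_frechet_derivative[OF smooth_near_differentiable[OF s\<eta>[of "(0, u)" s]]], of a "(1, 0)"] D0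
        by simp
    qed
    moreover have "(*) (0::real) = (\<lambda>a. 0)" by (rule ext) simp
    ultimately show ?thesis unfolding has_field_derivative_def by simp
  qed
  then have "\<eta> (t, y) (0, u) = \<eta> (0, y) (0, u)" by (intro DERIV_isconst_all allI)
  then show "\<alpha> (\<phi> t p) (tangent_map A A (\<phi> t) p u) = \<alpha> p u"
    by (simp add: e2 zero tangent_map_flow_zero)
qed

lemma ext1_invariant:
  assumes \<alpha>: "smooth_form1 A \<alpha>" and inv: "invariant_form1 A \<phi> \<alpha>"
  shows "ext1 A \<alpha> (\<phi> t p) (tangent_map A A (\<phi> t) p u) (tangent_map A A (\<phi> t) p v) = ext1 A \<alpha> p u v"
proof -
  have "pull1 A A (\<phi> t) \<alpha> = \<alpha>"
    using inv unfolding invariant_form1_def pull1_def by blast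
  then show ?thesis using ext1_pull1[OF A A smooth_at_flow_space \<alpha>] by metis
qed

end

section \<open>Principal circle bundles\<close>

text \<open>Provides a smooth logarithm on the circle near 1; the rational derivative 1 / (1 + x^2)
  makes all higher orders available at once.\<close>

lemma smooth_near_arctan: "smooth_near arctan x"
proof -
  have "Ck_on k arctan UNIV" for k
  proof (cases k)
    case (Suc n)
    have "Ck_on (Suc n) arctan UNIV"
    proof (rule Ck_on_SucI[OF open_UNIV])
      show "(arctan has_derivative (\<lambda>v. v * inverse (1 + x * x))) (at x)" for x
        using DERIV_arctan[of x] unfolding has_field_derivative_def
        by (simp add: power2_eq_square mult.commute[of _ "inverse _"])
      have "Ck_on n (\<lambda>x::real. 1 + x * x) UNIV"
        by (intro Ck_on_add Ck_on_const Ck_on_bounded_bilinear[OF bounded_bilinear_mult] Ck_on_ident open_UNIV)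
      then have "Ck_on n (\<lambda>x::real. inverse (1 + x * x)) UNIV"
        by (rule Ck_on_inverse[OF open_UNIV]) (smt (verit) zero_le_square)
      then show "Ck_on n (\<lambda>x::real. v * inverse (1 + x * x)) UNIV" for v
        by (intro Ck_on_bounded_bilinear[OF bounded_bilinear_mult] Ck_on_const open_UNIV)
    qed
    then show ?thesis using Suc by simp
  qed (simp add: continuous_on_arctan[OF continuous_on_id, unfolded id_def])
  then show ?thesis unfolding smooth_near_def smooth_on_def by (intro exI[of _ UNIV]) simp
qed

text \<open>In the right half plane arctan of the slope is the argument, with no branch to
  choose.\<close>

lemma cis_arctan:
  assumes "norm z = 1" "Re z > 0"
  shows "cis (arctan (Im z / Re z)) = z"
proof -
  have sq: "(Re z)\<^sup>2 + (Im z)\<^sup>2 = 1" using assms(1) by (simp add: cmod_def)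
  have "1 + (Im z / Re z)\<^sup>2 = (1 / Re z)\<^sup>2"
    using sq assms(2) by (simp add: power_divide field_simps)
  then have "sqrt (1 + (Im z / Re z)\<^sup>2) = 1 / Re z"
    using assms(2) by (metis divide_nonneg_pos real_sqrt_unique zero_le_one less_imp_le)
  then show ?thesis
    using assms(2) by (simp add: complex_eq_iff cos_arctan sin_arctan)
qed

lemma cis_eqD:
  assumes "cis x = cis y" shows "\<exists>n::int. x = y + 2 * pi * n"
proof -
  have "sin x = sin y \<and> cos x = cos y" using assms by (metis cis.sel)
  then show ?thesis by (simp only: sin_cos_eq_iff)
qed

locale principal_bundle =
  fixes B :: "('p::{t2_space,second_countable_topology}, 'q::euclidean_space) atlas"
    and A :: "('m::{t2_space,second_countable_topology}, 'e::euclidean_space) atlas"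
    and \<pi> :: "'p \<Rightarrow> 'm" and S :: real and \<psi> :: "real \<Rightarrow> 'p \<Rightarrow> 'p" and Z :: "('p, 'q) vector_field"
  assumes pcb: "principal_circle_bundle B A \<pi> S \<psi> Z"
begin

lemma base: "smooth_manifold A" and total: "smooth_manifold B" and action: "circle_action B S \<psi> Z"
  and fibre: "\<pi> p = \<pi> q \<longleftrightarrow> (\<exists>t. q = \<psi> t p)"
  using pcb unfolding principal_circle_bundle_def by blast+

end

sublocale principal_bundle \<subseteq> flow: circle_flow B S \<psi> Z
  using total action by unfold_locales

context principal_bundle begin

lemma smooth_projection: "smooth_at B A \<pi> p"
  using pcb smooth_map_on_iff[OF total base open_UNIV] unfolding principal_circle_bundle_def by blast

lemma projection_flow: "\<pi> (\<psi> t p) = \<pi> p"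
  using fibre by metis

lemma local_section:
  obtains U s and \<tau> :: "'p \<Rightarrow> complex" where "open U" "x \<in> U" "\<And>y. y \<in> U \<Longrightarrow> smooth_at A B s y"
    "\<And>y. y \<in> U \<Longrightarrow> \<pi> (s y) = y" "\<And>p. \<pi> p \<in> U \<Longrightarrow> smooth_at B \<E> \<tau> p" "\<And>p. \<pi> p \<in> U \<Longrightarrow> norm (\<tau> p) = 1"
    "\<And>p t. \<pi> p \<in> U \<Longrightarrow> \<tau> (\<psi> t p) = cis (2 * pi * t / S) * \<tau> p" "\<And>y. y \<in> U \<Longrightarrow> \<tau> (s y) = 1"
proof -
  have "\<exists>U s (\<tau> :: 'p \<Rightarrow> complex). open U \<and> x \<in> U \<and>
        smooth_map_on A U B s \<and> (\<forall>y\<in>U. \<pi> (s y) = y) \<and>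
        smooth_map_on B (\<pi> -` U) euclidean_atlas \<tau> \<and>
        (\<forall>p\<in>\<pi> -` U. norm (\<tau> p) = 1 \<and> (\<forall>t. \<tau> (\<psi> t p) = cis (2 * pi * t / S) * \<tau> p)) \<and>
        (\<forall>y\<in>U. \<tau> (s y) = 1)"
    using pcb unfolding principal_circle_bundle_def by blast
  then obtain U s and \<tau> :: "'p \<Rightarrow> complex" where U: "open U" "x \<in> U"
    and s: "smooth_map_on A U B s" "\<forall>y\<in>U. \<pi> (s y) = y"
    and \<tau>: "smooth_map_on B (\<pi> -` U) euclidean_atlas \<tau>"
      "\<forall>p\<in>\<pi> -` U. norm (\<tau> p) = 1 \<and> (\<forall>t. \<tau> (\<psi> t p) = cis (2 * pi * t / S) * \<tau> p)" "\<forall>y\<in>U. \<tau> (s y) = 1"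
    by blast
  have "continuous_on UNIV \<pi>" using smooth_at_isCont[OF smooth_projection] by (simp add: continuous_at_imp_continuous_on)
  then have op: "open (\<pi> -` U)" using U(1) by (simp add: continuous_on_open_vimage[OF open_UNIV])
  show thesis
    by (rule that[of U s \<tau>])
      (use U s \<tau> smooth_map_on_iff[OF base total U(1)] smooth_map_on_iff[OF total manifold_euclidean op, of \<tau>]
        in auto)
qed

lemma surj_projection: "\<exists>p. \<pi> p = x"
  by (rule local_section[of x]) blast

lemma tangent_projection_flow:
  "tangent_map B A \<pi> (\<psi> t p) (tangent_map B B (\<psi> t) p u) = tangent_map B A \<pi> p u"
  using tangent_map_compose[OF total total base flow.smooth_at_flow_space smooth_projection, of t p u]
  by (simp add: projection_flow)

lemma tangent_projection_generator: "tangent_map B A \<pi> p (Z p) = 0"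
  using tangent_map_compose[OF manifold_euclidean total base flow.smooth_at_flow_time smooth_projection, of p 0 1]
  by (simp add: projection_flow tangent_map_const flow.tangent_map_flow_time flow.zero)

lemma linear_tangent_projection: "linear (tangent_map B A \<pi> p)"
  by (rule linear_tangent_map[OF total base smooth_projection])

lemma tangent_projection_section:
  assumes "open U" "\<And>y. y \<in> U \<Longrightarrow> smooth_at A B s y" "\<And>y. y \<in> U \<Longrightarrow> \<pi> (s y) = y" "x \<in> U"
  shows "tangent_map B A \<pi> (s x) (tangent_map A B s x w) = w"
proof -
  have "tangent_map A A (\<lambda>y. \<pi> (s y)) x = tangent_map A A (\<lambda>y. y) x"
    by (rule tangent_map_cong[OF base base smooth_at_compose[OF base total base assms(2)[OF assms(4)] smooth_projection]])
      (use assms in \<open>auto simp: eventually_nhds\<close>)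
  then show ?thesis
    using tangent_map_compose[OF base total base assms(2)[OF assms(4)] smooth_projection] tangent_map_ident[OF base]
    by metis
qed

text \<open>A section yields preimages only at the points \<open>s x\<close>; the action carries
  them along the fibre to \<open>p\<close> without changing their projection.\<close>

lemma surj_tangent_projection: "\<exists>u. tangent_map B A \<pi> p u = w"
proof (rule local_section[of "\<pi> p"])
  fix U s and \<tau> :: "'p \<Rightarrow> complex"
  assume U: "open U" "\<pi> p \<in> U" "\<And>y. y \<in> U \<Longrightarrow> smooth_at A B s y" "\<And>y. y \<in> U \<Longrightarrow> \<pi> (s y) = y"
  have "\<pi> (s (\<pi> p)) = \<pi> p" using U by blast
  then obtain t where t: "p = \<psi> t (s (\<pi> p))" using fibre by blast
  have "tangent_map B A \<pi> (s (\<pi> p)) (tangent_map A B s (\<pi> p) w) = w"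
    by (rule tangent_projection_section[OF U(1,3,4,2)])
  then show ?thesis using tangent_projection_flow[of t "s (\<pi> p)"] t by metis
qed

text \<open>
  Near \<open>p\<close> one has \<open>q = \<psi> (f q) (s (\<pi> q))\<close>, where \<open>s\<close> is a local section and \<open>f\<close> a smooth
  logarithm of the circle coordinate.
\<close>
lemma kernel_tangent_projection:
  assumes "tangent_map B A \<pi> p u = 0"
  shows "\<exists>c. u = c *\<^sub>R Z p"
proof (rule local_section[of "\<pi> p"])
  fix U s and \<tau> :: "'p \<Rightarrow> complex"
  assume U: "open U" "\<pi> p \<in> U" and s: "\<And>y. y \<in> U \<Longrightarrow> smooth_at A B s y" "\<And>y. y \<in> U \<Longrightarrow> \<pi> (s y) = y"
    and \<tau>: "\<And>p. \<pi> p \<in> U \<Longrightarrow> smooth_at B \<E> \<tau> p" "\<And>p. \<pi> p \<in> U \<Longrightarrow> norm (\<tau> p) = 1"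
    "\<And>p t. \<pi> p \<in> U \<Longrightarrow> \<tau> (\<psi> t p) = cis (2 * pi * t / S) * \<tau> p" "\<And>y. y \<in> U \<Longrightarrow> \<tau> (s y) = 1"
  have S: "S > 0" using action unfolding circle_action_def by blast
  note E = manifold_euclidean
  have coord: "\<exists>t. q = \<psi> t (s (\<pi> q)) \<and> \<tau> q = cis (2 * pi * t / S)" if "\<pi> q \<in> U" for q
  proof -
    have "\<pi> (s (\<pi> q)) = \<pi> q" using s(2)[OF that] .
    then obtain t where t: "q = \<psi> t (s (\<pi> q))" using fibre by blast
    have "\<tau> (\<psi> t (s (\<pi> q))) = cis (2 * pi * t / S)" using \<tau>(3)[of "s (\<pi> q)" t] \<tau>(4)[OF that] s(2)[OF that] that by simp
    then show ?thesis using t by metis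
  qed
  obtain t0 where t0: "p = \<psi> t0 (s (\<pi> p))" "\<tau> p = cis (2 * pi * t0 / S)" using coord[OF U(2)] by blast
  \<comment> \<open>Rotates the circle coordinate so that its value at \<open>p\<close> is 1, where
    arctan gives the logarithm.\<close>
  define z where "z q = \<tau> q * cnj (\<tau> p)" for q
  \<comment> \<open>The factor converts an angle into time for an action of period \<open>S\<close>;
    \<open>t0\<close> is a time at which the orbit of the section reaches \<open>p\<close>.\<close>
  define f where "f q = t0 + S / (2 * pi) * arctan (Im (z q) / Re (z q))" for q
  have zp: "z p = 1" using \<tau>(2)[OF U(2)] complex_norm_square[of "\<tau> p"] by (simp add: z_def)
  have "smooth_near (\<lambda>w. t0 + S / (2 * pi) * arctan (Im (w * cnj (\<tau> p)) * inverse (Re (w * cnj (\<tau> p))))) (\<tau> p)"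
    by (intro smooth_near_add smooth_near_const smooth_near_mult smooth_near_compose[OF smooth_near_arctan]
        smooth_near_inverse smooth_near_bounded_linear[OF bounded_linear_Im]
        smooth_near_bounded_linear[OF bounded_linear_Re] smooth_near_ident)
      (use zp in \<open>simp add: z_def\<close>)
  from smooth_at_euclidean_compose[OF total \<tau>(1)[OF U(2)] this]
  have fs: "smooth_at B \<E> f p" unfolding f_def[abs_def] z_def divide_inverse .
  have ks: "smooth_at B B (\<lambda>q. s (\<pi> q)) p"
    by (rule smooth_at_compose[OF total base total smooth_projection s(1)[OF U(2)]])
  have "isCont \<tau> p" by (rule smooth_at_isCont[OF \<tau>(1)[OF U(2)]])
  then have "isCont (\<lambda>q. Re (\<tau> q * cnj (\<tau> p))) p"
    by (rule isCont_o2[where g="\<lambda>w. Re (w * cnj (\<tau> p))"]) (auto intro!: isCont_Re isCont_mult)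
  then have "isCont (\<lambda>q. Re (z q)) p" unfolding z_def .
  then have "\<forall>\<^sub>F q in nhds p. Re (z q) \<in> {0<..}" by (rule isCont_eventually) (auto simp: zp)
  moreover have "\<forall>\<^sub>F q in nhds p. \<pi> q \<in> U"
    by (rule isCont_eventually[OF smooth_at_isCont[OF smooth_projection] U])
  ultimately have ev: "\<forall>\<^sub>F q in nhds p. \<psi> (f q) (s (\<pi> q)) = q"
  proof eventually_elim
    case (elim q)
    obtain t where t: "q = \<psi> t (s (\<pi> q))" "\<tau> q = cis (2 * pi * t / S)" using coord[OF elim(2)] by blast
    have "norm (z q) = 1" using \<tau>(2)[OF elim(2)] \<tau>(2)[OF U(2)] by (simp add: z_def norm_mult)
    then have "cis (arctan (Im (z q) / Re (z q))) = z q" using elim(1) by (intro cis_arctan) auto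
    moreover have "z q = cis (2 * pi * t / S - 2 * pi * t0 / S)"
      unfolding z_def t(2) t0(2) cis_cnj by (simp add: cis_mult)
    moreover have "arctan (Im (z q) / Re (z q)) = 2 * pi * (f q) / S - 2 * pi * t0 / S"
    proof -
      have "2 * pi * (t0 + S / (2 * pi) * x) / S - 2 * pi * t0 / S = x" for x
      proof -
        have "2 * pi * (S / (2 * pi) * x) / S = x" using S by simp
        then show ?thesis by (simp only: distrib_left add_divide_distrib)
      qed
      from this[of "arctan (Im (z q) / Re (z q))"] show ?thesis by (simp only: f_def)
    qed
    ultimately have "cis (2 * pi * f q / S - 2 * pi * t0 / S) = cis (2 * pi * t / S - 2 * pi * t0 / S)" by simp
    \<comment> \<open>The circle coordinate determines the time only up to multiples of
      \<open>S\<close>, and these act trivially.\<close>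
    then have "\<exists>n::int. 2 * pi * f q / S - 2 * pi * t0 / S = (2 * pi * t / S - 2 * pi * t0 / S) + 2 * pi * n"
      by (rule cis_eqD)
    then obtain n :: int where "2 * pi * f q / S = 2 * pi * t / S + 2 * pi * n" by auto
    then have "2 * pi * (f q / S) = 2 * pi * (t / S + n)" by (simp add: distrib_left)
    then have "f q / S = t / S + n" by (rule mult_left_cancel[THEN iffD1, rotated]) simp
    then have "f q = (t / S + n) * S" using S by (simp add: divide_eq_eq)
    then have "f q = t + of_int n * S" using S by (simp add: distrib_right)
    then have "\<psi> (f q) (s (\<pi> q)) = \<psi> t (\<psi> (of_int n * S) (s (\<pi> q)))" by (simp add: flow.plus)
    then show ?case using t(1) by (simp add: flow.period_int)
  qed
  have "u = tangent_map B B (\<lambda>q. \<psi> (f q) (s (\<pi> q))) p u"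
    using tangent_map_cong[OF total total flow.smooth_at_flow[OF total fs ks] ev] tangent_map_ident[OF total] by metis
  also have "\<dots> = tangent_map B \<E> f p u *\<^sub>R Z (\<psi> (f p) (s (\<pi> p))) +
      tangent_map B B (\<psi> (f p)) (s (\<pi> p)) (tangent_map B B (\<lambda>q. s (\<pi> q)) p u)"
    by (rule flow.tangent_map_flow[OF total fs ks])
  \<comment> \<open>Along a vector killed by the projection the base point does not move to first
    order, so only the time coordinate contributes, in the direction of \<open>Z\<close>.\<close>
  also have "tangent_map B B (\<lambda>q. s (\<pi> q)) p u = 0"
    using tangent_map_compose[OF total base total smooth_projection s(1)[OF U(2)]] assms
      linear_0[OF linear_tangent_map[OF base total s(1)[OF U(2)]]] by simp
  also have "\<psi> (f p) (s (\<pi> p)) = p" using ev by (rule eventually_nhds_x_imp_x)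
  finally show ?thesis
    using linear_0[OF linear_tangent_map[OF total total flow.smooth_at_flow_space]] by auto
qed

end

text \<open>Near \<open>x\<close> the descended map is \<open>f\<close> after a smooth local
  section.\<close>

lemma (in principal_bundle) smooth_at_descend:
  assumes D: "smooth_manifold D" and f: "\<And>p. smooth_at B D f p" and F: "\<And>p. F (\<pi> p) = f p"
  shows "smooth_at A D F x"
proof (rule local_section[of x])
  fix U s and \<tau> :: "'p \<Rightarrow> complex"
  assume U: "open U" "x \<in> U" "\<And>y. y \<in> U \<Longrightarrow> smooth_at A B s y" "\<And>y. y \<in> U \<Longrightarrow> \<pi> (s y) = y"
  have "\<forall>\<^sub>F y in nhds x. f (s y) = F y"
    unfolding eventually_nhds using U F by (intro exI[of _ U]) metis
  with smooth_at_compose[OF base total D U(3)[OF U(2)] f] show ?thesis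
    by (rule smooth_at_cong[OF base D])
qed

text \<open>The form is required only to be nonzero on the generator, not to be a normalised
  connection, so that the same \<theta> can be used for both projections of P: its value is 1 on
  \<open>Z\<close> and \<open>a\<close> on X'.\<close>

locale bundle_form = principal_bundle B A \<pi> S \<psi> Z
  for B :: "('p::{t2_space,second_countable_topology}, 'q::euclidean_space) atlas"
    and A :: "('m::{t2_space,second_countable_topology}, 'e::euclidean_space) atlas"
    and \<pi> :: "'p \<Rightarrow> 'm" and S :: real and \<psi> :: "real \<Rightarrow> 'p \<Rightarrow> 'p" and Z :: "('p, 'q) vector_field" +
  fixes \<theta> :: "('p, 'q) form1"
  assumes linear_form: "linear (\<theta> p)" and form_generator: "\<theta> p (Z p) \<noteq> 0"
begin

abbreviation "hl \<equiv> hlift B A \<pi> \<theta>"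

lemma hlift_unique_aux:
  assumes "\<theta> p u = 0" "\<theta> p v = 0" "tangent_map B A \<pi> p u = tangent_map B A \<pi> p v"
  shows "u = v"
proof -
  have "tangent_map B A \<pi> p (u - v) = 0" using assms(3) linear_diff[OF linear_tangent_projection] by simp
  then obtain c where c: "u - v = c *\<^sub>R Z p" using kernel_tangent_projection by blast
  have "\<theta> p (u - v) = 0" using assms linear_diff[OF linear_form] by simp
  then have "c * \<theta> p (Z p) = 0" unfolding c using linear_cmul[OF linear_form] by simp
  then show ?thesis using c form_generator by simp
qed

text \<open>Justifies the definite description in \<open>hlift\<close>: any vector over
  \<open>w\<close> becomes horizontal after subtracting a multiple of \<open>Z p\<close>, and two
  horizontal ones differ by a vertical vector killed by \<theta>.\<close>

lemma hlift: "\<theta> p (hl p w) = 0" "tangent_map B A \<pi> p (hl p w) = w"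
proof -
  obtain u where u: "tangent_map B A \<pi> p u = w" using surj_tangent_projection by blast
  let ?v = "u - (\<theta> p u / \<theta> p (Z p)) *\<^sub>R Z p"
  have v: "\<theta> p ?v = 0 \<and> tangent_map B A \<pi> p ?v = w"
    using u form_generator[of p] linear_diff[OF linear_form] linear_cmul[OF linear_form]
      linear_diff[OF linear_tangent_projection] linear_cmul[OF linear_tangent_projection] tangent_projection_generator
    by simp
  have "\<exists>!u. \<theta> p u = 0 \<and> tangent_map B A \<pi> p u = w"
  proof (rule ex1I[of _ ?v], rule v)
    fix u' assume "\<theta> p u' = 0 \<and> tangent_map B A \<pi> p u' = w"
    then show "u' = ?v" using v hlift_unique_aux[of p u' ?v] by simp
  qed
  from theI'[OF this] show "\<theta> p (hl p w) = 0" "tangent_map B A \<pi> p (hl p w) = w"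
    unfolding hlift_def by blast+
qed

lemma hlift_eqI: "\<theta> p u = 0 \<Longrightarrow> tangent_map B A \<pi> p u = w \<Longrightarrow> hl p w = u"
  using hlift_unique_aux hlift by blast

lemma hlift_projection: "\<theta> p u = 0 \<Longrightarrow> hl p (tangent_map B A \<pi> p u) = u"
  using hlift_eqI by blast

lemma linear_hlift: "linear (hl p)"
  by (rule linearI; rule hlift_eqI)
    (simp_all add: linear_add[OF linear_form] linear_cmul[OF linear_form] hlift
      linear_add[OF linear_tangent_projection] linear_cmul[OF linear_tangent_projection])

lemma decompose: "u = hl p (tangent_map B A \<pi> p u) + (\<theta> p u / \<theta> p (Z p)) *\<^sub>R Z p"
proof -
  have "hl p (tangent_map B A \<pi> p u) = u - (\<theta> p u / \<theta> p (Z p)) *\<^sub>R Z p"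
    by (rule hlift_eqI)
      (use form_generator[of p] in \<open>simp_all add: linear_diff[OF linear_form] linear_cmul[OF linear_form]
        linear_diff[OF linear_tangent_projection] linear_cmul[OF linear_tangent_projection] tangent_projection_generator\<close>)
  then show ?thesis by simp
qed

text \<open>Uniqueness of horizontal lifts. It is used for the flow \<psi> over M and for the flow
  \<rho> over W, each of which covers the identity and preserves \<theta>.\<close>

lemma hlift_push:
  assumes f: "smooth_at B B f p" and \<pi>: "\<And>q. \<pi> (f q) = \<pi> q" and \<theta>: "\<And>u. \<theta> (f p) (tangent_map B B f p u) = \<theta> p u"
  shows "tangent_map B B f p (hl p w) = hl (f p) w"
proof (rule hlift_eqI[symmetric])
  show "\<theta> (f p) (tangent_map B B f p (hl p w)) = 0" by (simp add: \<theta> hlift)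
  show "tangent_map B A \<pi> (f p) (tangent_map B B f p (hl p w)) = w"
    using tangent_map_compose[OF total total base f smooth_projection, of "hl p w"] by (simp add: \<pi> hlift)
qed

end

section \<open>Smooth tensor fields\<close>

text \<open>The raw values of \<open>L\<close> and \<open>X\<close> may jump with
  \<open>chart_at\<close>. In the expansion over a basis, \<open>coframe\<close> and
  \<open>frame\<close> absorb the jumps, and each factor is smooth by assumption.\<close>

lemma smooth_near_apply:
  fixes L :: "'m::{t2_space,second_countable_topology} \<Rightarrow> 'e::euclidean_space \<Rightarrow> 'v::euclidean_space"
  assumes A: "smooth_manifold A" and X: "smooth_vector_field A X" and c: "c \<in> A" "p \<in> fst c"
    and lin: "\<And>q. q \<in> fst c \<Longrightarrow> linear (L q)"
    and near: "\<And>b. smooth_near (\<lambda>y. comp1 A c L b y) (snd c p)"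
  shows "smooth_near (\<lambda>y. L (cinv c y) (X (cinv c y))) (snd c p)"
proof (rule smooth_near_cong)
  show "smooth_near (\<lambda>y. \<Sum>b\<in>Basis. (coframe A c (cinv c y) (X (cinv c y)) \<bullet> b) *\<^sub>R
      comp1 A c L b y) (snd c p)"
    using X c near unfolding smooth_vector_field_iff[OF A]
    by (intro smooth_near_sum smooth_near_scaleR smooth_near_inner) auto
  have "(\<Sum>b\<in>Basis. (coframe A c (cinv c y) (X (cinv c y)) \<bullet> b) *\<^sub>R comp1 A c L b y) =
      L (cinv c y) (X (cinv c y))" if "y \<in> snd c ` fst c" for y
  proof -
    note q = cinv_in[OF A c(1) that]
    from linear_componentwise_expansion[OF linear_compose[OF linear_frame[OF A c(1) q] lin[OF q]],
        of "coframe A c (cinv c y) (X (cinv c y))"]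
    show ?thesis by (simp add: frame_coframe[OF A c(1) q])
  qed
  then show "\<forall>\<^sub>F y in nhds (snd c p). (\<Sum>b\<in>Basis. (coframe A c (cinv c y) (X (cinv c y)) \<bullet> b) *\<^sub>R
      comp1 A c L b y) = L (cinv c y) (X (cinv c y))"
    by (rule eventually_mono[OF eventually_chart_image[OF A c]])
qed

lemma smooth_at_funI:
  assumes A: "smooth_manifold A" and c: "c \<in> A" "p \<in> fst c" and k: "smooth_near (\<lambda>y. k (cinv c y)) (snd c p)"
  shows "smooth_at A \<E> k p"
proof (rule smooth_atI[OF A c manifold_euclidean, of "(UNIV, \<lambda>x. x)"])
  have "isCont (\<lambda>q. k (cinv c (snd c q))) p"
    by (rule isCont_o2[where g="\<lambda>y. k (cinv c y)"]) (intro isCont_chart[OF A c] smooth_near_isCont[OF k])+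
  moreover have "\<forall>\<^sub>F q in nhds p. k (cinv c (snd c q)) = k q"
    unfolding eventually_nhds using open_chart[OF A c(1)] c(2) cinv_chart[OF A c(1)] by (intro exI[of _ "fst c"]) simp
  ultimately show "isCont k p" by (rule isCont_cong[THEN iffD1, rotated])
qed (use k in \<open>simp_all add: euclidean_atlas_def\<close>)

lemma smooth_at_form1_vector:
  assumes A: "smooth_manifold A" and \<alpha>: "smooth_form1 A \<alpha>" and X: "smooth_vector_field A X"
  shows "smooth_at A \<E> (\<lambda>q. \<alpha> q (X q)) p"
proof (rule smooth_at_funI[OF A chart_at_in[OF A]], rule smooth_near_apply[OF A X chart_at_in[OF A]])
  show "linear (\<alpha> q)" for q using \<alpha> by (simp add: smooth_form1_def)
  show "smooth_near (\<lambda>y. comp1 A (chart_at A p) \<alpha> b y) (snd (chart_at A p) p)" for b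
    using \<alpha> chart_at_in[OF A, of p] unfolding smooth_form1_iff[OF A] by blast
qed

lemma bilinear_linear:
  assumes "bilinear f" shows "linear (f x)" "linear (\<lambda>x. f x y)"
  using assms unfolding bilinear_def by blast+

lemma bilinear_plus: "bilinear f \<Longrightarrow> bilinear g \<Longrightarrow> bilinear (\<lambda>u v. f u v + g u v)"
  unfolding bilinear_def by (auto intro: linear_compose_add)

lemma bilinear_scale:
  fixes c :: real and f :: "'a::real_vector \<Rightarrow> 'b::real_vector \<Rightarrow> real"
  assumes "bilinear f" shows "bilinear (\<lambda>u v. c * f u v)"
  using assms unfolding bilinear_def
  by (auto intro!: linear_compose_scale_right[of "_ :: _ \<Rightarrow> real", unfolded real_scaleR_def])

lemma bilinear_product:
  fixes a b :: "'a::real_vector \<Rightarrow> real"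
  assumes "linear a" "linear b" shows "bilinear (\<lambda>u v. a u * b v)"
  unfolding bilinear_def
  by (auto intro!: linearI simp: linear_add[OF assms(1)] linear_add[OF assms(2)] linear_cmul[OF assms(1)]
      linear_cmul[OF assms(2)] distrib_left distrib_right)

lemma smooth_form1_flat:
  assumes A: "smooth_manifold A" and g: "smooth_tensor2 A g" and X: "smooth_vector_field A X"
  shows "smooth_form1 A (flat g X)"
  unfolding smooth_form1_iff[OF A]
proof (intro conjI allI ballI)
  have bil: "bilinear (g q)" for q using g by (simp add: smooth_tensor2_def)
  show "linear (flat g X q)" for q using bilinear_linear(1)[OF bil] by (simp add: flat_def[abs_def])
  fix c p v assume c: "c \<in> A" "p \<in> fst c"
  show "smooth_near (\<lambda>y. comp1 A c (flat g X) v y) (snd c p)"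
    unfolding flat_def
  proof (rule smooth_near_cong)
    show "smooth_near (\<lambda>y. (\<lambda>q x. g q x (frame A c q v)) (cinv c y) (X (cinv c y))) (snd c p)"
      by (rule smooth_near_apply[OF A X c])
        (use g c bilinear_linear(2)[OF bil] smooth_tensor2_iff[OF A] in \<open>blast+\<close>)
  qed simp
qed

lemma smooth_vector_field_endo:
  assumes A: "smooth_manifold A" and J: "smooth_endo A J" and X: "smooth_vector_field A X"
  shows "smooth_vector_field A (\<lambda>q. J q (X q))"
  unfolding smooth_vector_field_iff[OF A]
proof (intro ballI)
  fix c p assume c: "c \<in> A" "p \<in> fst c"
  show "smooth_near (\<lambda>y. coframe A c (cinv c y) (J (cinv c y) (X (cinv c y)))) (snd c p)"
  proof (rule smooth_near_cong)
    have "linear (\<lambda>v. coframe A c q (J q v))" if "q \<in> fst c" for q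
      using linear_compose[of "J q" "coframe A c q"] J that c(1)
      by (simp add: o_def smooth_endo_def coframe_eq_tangent_map[OF A] smooth_at_chart_map[OF A]
          linear_tangent_map[OF A manifold_euclidean])
    then show "smooth_near (\<lambda>y. (\<lambda>q v. coframe A c q (J q v)) (cinv c y) (X (cinv c y))) (snd c p)"
      by (rule smooth_near_apply[OF A X c]) (use J c smooth_endo_iff[OF A] in \<open>blast+\<close>)
  qed simp
qed

lemma alpha_eq_flat: "alpha g J X = flat g (\<lambda>q. J q (X q))"
  by (intro ext) (simp add: alpha_def omega_def flat_def)

lemma smooth_tensor2_elementary_deformation:
  assumes A: "smooth_manifold A" and g: "smooth_tensor2 A g" and X: "smooth_vector_field A X"
    and I: "smooth_endo A I" and J: "smooth_endo A J" and K: "smooth_endo A K"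
    and h: "\<And>p. smooth_at A \<E> h p"
  shows "smooth_tensor2 A (elementary_deformation g I J K X h)"
proof -
  have flats: "smooth_form1 A (flat g X)" "smooth_form1 A (alpha g I X)"
    "smooth_form1 A (alpha g J X)" "smooth_form1 A (alpha g K X)"
    unfolding alpha_eq_flat
    by (rule smooth_form1_flat[OF A g X], rule smooth_form1_flat[OF A g smooth_vector_field_endo[OF A I X]],
      rule smooth_form1_flat[OF A g smooth_vector_field_endo[OF A J X]],
      rule smooth_form1_flat[OF A g smooth_vector_field_endo[OF A K X]])
  have lin: "linear (flat g X p)" "linear (alpha g I X p)" "linear (alpha g J X p)" "linear (alpha g K X p)" for p
    using flats by (simp_all add: smooth_form1_def)
  have near: "smooth_near (\<lambda>y. comp1 A c \<alpha> v y) (snd c p)"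
    if "smooth_form1 A \<alpha>" "c \<in> A" "p \<in> fst c" for \<alpha> c p v
    using that unfolding smooth_form1_iff[OF A] by blast
  show ?thesis unfolding smooth_tensor2_iff[OF A]
  proof (intro conjI allI ballI)
    have "bilinear (g p)" for p using g by (simp add: smooth_tensor2_def)
    then show "bilinear (elementary_deformation g I J K X h p)" for p
      unfolding elementary_deformation_def g_HX_def
      by (intro bilinear_plus bilinear_scale bilinear_product lin)
    fix c p u v assume c: "c \<in> A" "p \<in> fst c"
    have gn: "smooth_near (\<lambda>y. comp2 A c g u v y) (snd c p)"
      using g c unfolding smooth_tensor2_iff[OF A] by blast
    note hn = smooth_fun_chart[OF A c h]
    note fn = near[OF flats(1) c] near[OF flats(2) c] near[OF flats(3) c] near[OF flats(4) c]
    show "smooth_near (\<lambda>y. comp2 A c (elementary_deformation g I J K X h) u v y) (snd c p)"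
      unfolding elementary_deformation_def g_HX_def
      by (rule smooth_near_add[OF gn smooth_near_mult[OF hn]], intro smooth_near_add; rule smooth_near_mult[OF fn(1) fn(1)]
          smooth_near_mult[OF fn(2) fn(2)] smooth_near_mult[OF fn(3) fn(3)] smooth_near_mult[OF fn(4) fn(4)])
  qed
qed

section \<open>Pointwise hyperhermitian algebra\<close>

text \<open>The vectors \<open>e1\<close>, \<open>e2\<close>, \<open>e3\<close> are dual to the
  three covectors up to nonzero factors; evaluating on them shows that the coefficients of \<beta>
  are unique, hence that the definite description in \<open>star3\<close> has the expected
  value.\<close>

lemma star3_eq:
  assumes "a e1 \<noteq> 0" "b e1 = 0" "c e1 = 0" "a e2 = 0" "b e2 \<noteq> 0" "c e2 = 0" "a e3 = 0" "b e3 = 0" "c e3 \<noteq> 0"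
    and \<beta>: "\<beta> = (\<lambda>w. x * a w + y * b w + z * c w)"
  shows "star3 a b c \<beta> = (\<lambda>u v. x * wedge b c u v + y * wedge c a u v + z * wedge a b u v)"
  unfolding star3_def
proof (rule the_equality)
  show "\<exists>x' y' z'. \<beta> = (\<lambda>w. x' * a w + y' * b w + z' * c w) \<and>
     (\<lambda>u v. x * wedge b c u v + y * wedge c a u v + z * wedge a b u v) =
     (\<lambda>u v. x' * wedge b c u v + y' * wedge c a u v + z' * wedge a b u v)"
    using \<beta> by blast
next
  fix \<eta> assume "\<exists>x' y' z'. \<beta> = (\<lambda>w. x' * a w + y' * b w + z' * c w) \<and>
     \<eta> = (\<lambda>u v. x' * wedge b c u v + y' * wedge c a u v + z' * wedge a b u v)"
  then obtain x' y' z' where *: "\<beta> = (\<lambda>w. x' * a w + y' * b w + z' * c w)"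
    and \<eta>: "\<eta> = (\<lambda>u v. x' * wedge b c u v + y' * wedge c a u v + z' * wedge a b u v)" by blast
  have "x = x'" "y = y'" "z = z'"
    using assms(1-9) fun_cong[OF *[unfolded \<beta>], of e1] fun_cong[OF *[unfolded \<beta>], of e2]
      fun_cong[OF *[unfolded \<beta>], of e3] by simp_all
  then show "\<eta> = (\<lambda>u v. x * wedge b c u v + y * wedge c a u v + z * wedge a b u v)" by (simp add: \<eta>)
qed

lemma
  assumes "almost_hyperhermitian A g I J K"
  shows almost_hyperhermitian_bilinear: "bilinear (g p)"
    and almost_hyperhermitian_sym: "g p u v = g p v u"
    and almost_hyperhermitian_linear: "linear (I p)" "linear (J p)" "linear (K p)"
    and almost_hyperhermitian_orthogonal:
      "g p u (I p u) = 0" "g p u (J p u) = 0" "g p u (K p u) = 0" "g p (I p u) u = 0" "g p (J p u) u = 0" "g p (K p u) u = 0"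
      "g p (I p u) (J p u) = 0" "g p (J p u) (I p u) = 0" "g p (I p u) (K p u) = 0" "g p (K p u) (I p u) = 0"
      "g p (J p u) (K p u) = 0" "g p (K p u) (J p u) = 0"
    and almost_hyperhermitian_isometry:
      "g p (I p u) (I p v) = g p u v" "g p (J p u) (J p v) = g p u v" "g p (K p u) (K p v) = g p u v"
proof -
  have sm: "smooth_tensor2 A g" and sym: "g p u v = g p v u"
    and lin: "linear (I p)" "linear (J p)" "linear (K p)"
    and quat: "I p (I p v) = - v" "J p (J p v) = - v" "K p (K p v) = - v"
            "I p (J p v) = K p v" "J p (I p v) = - K p v"
    and iso: "g p (I p u) (I p v) = g p u v" "g p (J p u) (J p v) = g p u v" "g p (K p u) (K p v) = g p u v" for p u v
    using assms unfolding almost_hyperhermitian_def smooth_endo_def by blast+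
  show bil: "bilinear (g p)" using sm by (simp add: smooth_tensor2_def)
  show "g p u v = g p v u" by (rule sym)
  show "linear (I p)" "linear (J p)" "linear (K p)" by (rule lin)+
  show "g p (I p u) (I p v) = g p u v" "g p (J p u) (J p v) = g p u v" "g p (K p u) (K p v) = g p u v" by (rule iso)+
  note neg = linear_neg[OF bilinear_linear(1)[OF bil]] linear_neg[OF bilinear_linear(2)[OF bil]]
    linear_neg[OF lin(1)] linear_neg[OF lin(2)] linear_neg[OF lin(3)]
  \<comment> \<open>An isometry with square -1 is skew: g(u, L u) = g(L u, L (L u)) = -g(L u, u),
    which symmetry makes its own negative.\<close>
  have self: "g p u (L u) = 0" if "\<And>u v. g p (L u) (L v) = g p u v" "L (L u) = - u" for L u
    using that(1)[of u "L u"] that(2) sym[of p "L u" u] by (simp add: neg)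
  have I: "g p u (I p u) = 0" and J: "g p u (J p u) = 0" and K: "g p u (K p u) = 0" for u
    using self iso quat by blast+
  show "g p u (I p u) = 0" "g p u (J p u) = 0" "g p u (K p u) = 0" by (rule I J K)+
  show "g p (I p u) u = 0" "g p (J p u) u = 0" "g p (K p u) u = 0"
    using I[of u] J[of u] K[of u] sym[of p "I p u" u] sym[of p "J p u" u] sym[of p "K p u" u] by simp_all
  \<comment> \<open>The definition records only the products of \<open>I\<close> and
    \<open>J\<close>; this one comes from K = IJ, JI = -K and J^2 = -1.\<close>
  have JK: "J p (K p u) = I p u" for u
  proof -
    have "J p (K p u) = J p (I p (J p u))" by (simp only: quat(4))
    also have "\<dots> = - K p (J p u)" by (rule quat(5))
    also have "K p (J p u) = I p (J p (J p u))" by (simp only: quat(4))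
    also have "\<dots> = - I p u" by (simp only: quat(2) neg(3))
    finally show ?thesis by simp
  qed
  have IK: "I p (K p u) = - J p u" for u using quat(1)[of p "J p u"] by (simp only: quat(4))
  have z1: "g p (I p u) (J p u) = 0"
    using iso(1)[of p "I p u" "J p u"] K[of u] unfolding quat(1) quat(4) neg(2) by simp
  have z2: "g p (I p u) (K p u) = 0"
    using iso(1)[of p "I p u" "K p u"] J[of u] unfolding quat(1) IK neg(1) neg(2) by simp
  have z3: "g p (J p u) (K p u) = 0"
    using iso(2)[of p "J p u" "K p u"] I[of u] unfolding quat(2) JK neg(2) by simp
  show "g p (I p u) (J p u) = 0" "g p (I p u) (K p u) = 0" "g p (J p u) (K p u) = 0" by (rule z1 z2 z3)+
  show "g p (J p u) (I p u) = 0" "g p (K p u) (I p u) = 0" "g p (K p u) (J p u) = 0"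
    using z1 z2 z3 sym[of p "J p u" "I p u"] sym[of p "K p u" "I p u"] sym[of p "K p u" "J p u"] by simp_all
qed

section \<open>The inverse twist\<close>

text \<open>The deformed and twisted metrics may be indefinite, so positivity is recorded for
  \<open>g\<close> alone and reaches W only through \<Phi>.\<close>

locale elementary_twist =
  fixes A :: "('m::{t2_space,second_countable_topology}, 'e::euclidean_space) atlas"
    and B :: "('p::{t2_space,second_countable_topology}, 'q::euclidean_space) atlas"
    and C :: "('w::{t2_space,second_countable_topology}, 'f::euclidean_space) atlas"
    and g :: "('m, 'e) tensor2" and I J K :: "('m, 'e) endo_field"
    and T :: real and \<phi> :: "real \<Rightarrow> 'm \<Rightarrow> 'm" and X :: "('m, 'e) vector_field"
    and h a :: "'m \<Rightarrow> real" and lam :: real and F :: "('m, 'e) tensor2"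
    and \<pi>M :: "'p \<Rightarrow> 'm" and \<pi>W :: "'p \<Rightarrow> 'w"
    and S R :: real and \<psi> \<rho> :: "real \<Rightarrow> 'p \<Rightarrow> 'p"
    and Z :: "('p, 'q) vector_field" and \<theta> :: "('p, 'q) form1"
    and gW :: "('w, 'f) tensor2" and IW JW KW :: "('w, 'f) endo_field"
    and XW :: "('w, 'f) vector_field"
  assumes hyperhermitian: "almost_hyperhermitian A g I J K"
    and positive: "v \<noteq> 0 \<Longrightarrow> g x v v > 0"
    and data: "elementary_twist_data A g I J K X h lam a F"
    and twist: "is_twist A B C \<pi>M \<pi>W T \<phi> X a F S \<psi> Z \<theta> R \<rho>"
    and twisted: "twisted_structure A B C \<pi>M \<pi>W \<theta> \<phi>
           (elementary_deformation g I J K X h) I J K gW IW JW KW"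
    and XW_smooth: "smooth_vector_field C XW"
    and XW_related: "vector_related A B C \<pi>M \<pi>W \<theta> XW (\<lambda>x. (- (1 / a x)) *\<^sub>R X x)"
begin

abbreviation "X' \<equiv> lifted_field B A \<pi>M \<theta> Z X a"

lemma F_smooth: "smooth_form2 A F" and a_smooth_fun: "smooth_fun A a" and a_nz: "a x \<noteq> 0" and da: "ext0 A a x v = - F x (X x) v"
  and pcbM: "principal_circle_bundle B A \<pi>M S \<psi> Z" and \<theta>_connection: "principal_connection B \<psi> Z \<theta>"
  and curvature: "ext1 B \<theta> p u v' = F (\<pi>M p) (tangent_map B A \<pi>M p u) (tangent_map B A \<pi>M p v')"
  and pcbW: "principal_circle_bundle B C \<pi>W R \<rho> X'"
  and action_M: "circle_action A T \<phi> X"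
  using twist unfolding is_twist_def twist_data_def by blast+

lemma \<theta>_smooth: "smooth_form1 B \<theta>" and \<theta>_invariant: "invariant_form1 B \<psi> \<theta>" and \<theta>_Z: "\<theta> p (Z p) = 1"
  using \<theta>_connection unfolding principal_connection_def by blast+

lemma \<theta>_linear: "linear (\<theta> p)"
  using \<theta>_smooth by (simp add: smooth_form1_def)

end

sublocale elementary_twist \<subseteq> M: bundle_form B A \<pi>M S \<psi> Z \<theta>
  by (intro bundle_form.intro principal_bundle.intro bundle_form_axioms.intro pcbM \<theta>_linear) (simp add: \<theta>_Z)

context elementary_twist begin

lemma X'_eq: "X' p = M.hl p (X (\<pi>M p)) + a (\<pi>M p) *\<^sub>R Z p"
  by (simp add: lifted_field_def)

lemma \<theta>_X': "\<theta> p (X' p) = a (\<pi>M p)"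
  by (simp add: X'_eq linear_add[OF \<theta>_linear] linear_cmul[OF \<theta>_linear] M.hlift \<theta>_Z)

end

text \<open>As \<theta>(X') = a never vanishes, ker \<theta> is a complement of the vertical line of
  the second projection too.\<close>

sublocale elementary_twist \<subseteq> W: bundle_form B C \<pi>W R \<rho> X' \<theta>
  by (intro bundle_form.intro principal_bundle.intro bundle_form_axioms.intro pcbW \<theta>_linear) (simp add: \<theta>_X' a_nz)

section \<open>Invariance of functions, forms and lifts under the two flows on P\<close>

context elementary_twist begin

lemma h_smooth: "smooth_at A \<E> h x" and lam_nz: "lam \<noteq> 0"
  using data smooth_fun_iff[OF M.base] unfolding elementary_twist_data_def by blast+

lemma data_at:
  assumes "X x \<noteq> 0"
  shows "a x = lam * (1 + h x * norm_sq g X x)"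
    and "\<exists>x' y z. ext0 A h x = (\<lambda>w. x' * alpha g I X x w + y * alpha g J X x w + z * alpha g K X x w)"
    and "F x u v = lam * (ext1 A (\<lambda>q w. h q * flat g X q w) x u v + star_d A g I J K X h x u v)"
  using data assms unfolding elementary_twist_data_def by blast+

lemma a_smooth: "smooth_at A \<E> a x"
  using a_smooth_fun smooth_fun_iff[OF M.base] by blast

lemma X_smooth: "smooth_vector_field A X"
  using action_M unfolding circle_action_def by blast

lemma F_bilinear: "bilinear (F x)" and F_antisym: "F x u v = - F x v u"
  using F_smooth unfolding smooth_form2_def smooth_tensor2_def by blast+

lemma F_self: "F x u u = 0"
  using F_antisym[of x u u] by simp

lemma tangent_X': "tangent_map B A \<pi>M p (X' p) = X (\<pi>M p)"
  by (simp add: X'_eq linear_add[OF M.linear_tangent_projection] linear_cmul[OF M.linear_tangent_projection]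
      M.hlift M.tangent_projection_generator)

lemma smooth_at_pull_M: "smooth_at A \<E> f (\<pi>M p) \<Longrightarrow> smooth_at B \<E> (\<lambda>q. f (\<pi>M q)) p"
  by (rule smooth_at_compose[OF M.total M.base manifold_euclidean M.smooth_projection])

lemma ext0_pull_M:
  "smooth_at A \<E> f (\<pi>M p) \<Longrightarrow> ext0 B (\<lambda>q. f (\<pi>M q)) p u = ext0 A f (\<pi>M p) (tangent_map B A \<pi>M p u)"
  unfolding ext0_eq_tangent_map
  by (rule tangent_map_compose[OF M.total M.base manifold_euclidean M.smooth_projection])

text \<open>X' projects to X, so a function on M that X annihilates is constant along \<rho> once
  pulled back to P. For \<open>a\<close> this is F(X, X) = 0.\<close>

lemma flow_invariant:
  assumes "\<And>x. smooth_at A \<E> f x" "\<And>x. ext0 A f x (X x) = 0"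
  shows "f (\<pi>M (\<rho> t p)) = f (\<pi>M p)"
  using W.flow.invariant_map[OF manifold_euclidean, of "\<lambda>q. f (\<pi>M q)" t p]
    smooth_at_pull_M[OF assms(1)] ext0_pull_M[OF assms(1)] assms(2) tangent_X'
  by (simp add: ext0_eq_tangent_map)

lemma a_invariant: "a (\<pi>M (\<rho> t p)) = a (\<pi>M p)"
  by (rule flow_invariant[OF a_smooth]) (simp add: da F_self)

lemma alpha_X: "alpha g I X x (X x) = 0" "alpha g J X x (X x) = 0" "alpha g K X x (X x) = 0"
  using almost_hyperhermitian_orthogonal[OF hyperhermitian] by (simp_all add: alpha_def omega_def)

text \<open>Where X is nonzero, \<open>dh\<close> lies in the span of the forms g(AX, .), and these
  vanish on X because \<open>I\<close>, \<open>J\<close>, \<open>K\<close> are skew. At a zero of X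
  linearity suffices.\<close>

lemma dh_X: "ext0 A h x (X x) = 0"
proof (cases "X x = 0")
  case True
  then show ?thesis
    using linear_0[OF linear_tangent_map[OF M.base manifold_euclidean h_smooth]]
    by (simp add: ext0_eq_tangent_map)
next
  case False
  from data_at(2)[OF this] show ?thesis by (auto simp: alpha_X)
qed

lemma h_invariant: "h (\<pi>M (\<rho> t p)) = h (\<pi>M p)"
  by (rule flow_invariant[OF h_smooth dh_X])

lemma \<theta>_rho_invariant: "invariant_form1 B \<rho> \<theta>"
proof (rule W.flow.invariant_form1I[OF \<theta>_smooth])
  show "smooth_at B \<E> (\<lambda>q. \<theta> q (X' q)) p" for p
    unfolding \<theta>_X' by (rule smooth_at_pull_M[OF a_smooth])
  show "ext1 B \<theta> p (X' p) v + ext0 B (\<lambda>q. \<theta> q (X' q)) p v = 0" for p v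
    unfolding \<theta>_X' ext0_pull_M[OF a_smooth] by (simp add: curvature tangent_X' da)
qed

lemma \<theta>_psi: "\<theta> (\<psi> t p) (tangent_map B B (\<psi> t) p u) = \<theta> p u"
  and \<theta>_rho: "\<theta> (\<rho> t p) (tangent_map B B (\<rho> t) p u) = \<theta> p u"
  using \<theta>_invariant \<theta>_rho_invariant unfolding invariant_form1_def by blast+

lemma psi_hl: "tangent_map B B (\<psi> t) p (M.hl p w) = M.hl (\<psi> t p) w"
  by (rule M.hlift_push[OF M.flow.smooth_at_flow_space M.projection_flow \<theta>_psi])

lemma rho_hl: "tangent_map B B (\<rho> t) p (W.hl p w) = W.hl (\<rho> t p) w"
  by (rule W.hlift_push[OF W.flow.smooth_at_flow_space W.projection_flow \<theta>_rho])

text \<open>Both summands of X' are preserved: the horizontal lift because \<psi> preserves \<theta>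
  and covers the identity of M, and \<open>Z\<close> as the generator, with a coefficient constant
  on fibres. Hence the two flows commute.\<close>

lemma psi_X': "tangent_map B B (\<psi> t) p (X' p) = X' (\<psi> t p)"
  using linear_tangent_map[OF M.total M.total M.flow.smooth_at_flow_space, of t p]
  by (simp add: X'_eq linear_add linear_cmul psi_hl M.projection_flow M.flow.tangent_map_flow_generator)

lemma psi_rho: "\<psi> s (\<rho> t p) = \<rho> t (\<psi> s p)"
  by (rule W.flow.flow_commute[OF M.flow.smooth_at_flow_space psi_X'])

section \<open>The tangent isomorphism \<Phi> and H-related tensors\<close>

definition \<Phi> :: "'p \<Rightarrow> 'e \<Rightarrow> 'f" where
  "\<Phi> p u = tangent_map B C \<pi>W p (M.hl p u)"

lemma W_hl_\<Phi>: "W.hl p (\<Phi> p u) = M.hl p u"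
  unfolding \<Phi>_def by (rule W.hlift_projection) (rule M.hlift)

lemma \<Phi>_linear: "linear (\<Phi> p)"
  using linear_compose[OF M.linear_hlift W.linear_tangent_projection] by (simp add: \<Phi>_def[abs_def] o_def)

lemma \<Phi>_inverse: "\<Phi> p (tangent_map B A \<pi>M p (W.hl p u)) = u"
  unfolding \<Phi>_def by (simp add: M.hlift_projection W.hlift)

text \<open>Lets an arbitrary tangent vector of W be written as the image of one of M, which turns
  every pointwise identity on W into an identity on M.\<close>

lemma \<Phi>_surj: "\<exists>u'. u = \<Phi> p u'"
  using \<Phi>_inverse by metis

lemma \<Phi>_horizontal: "\<theta> p u = 0 \<Longrightarrow> tangent_map B C \<pi>W p u = \<Phi> p (tangent_map B A \<pi>M p u)"
  unfolding \<Phi>_def by (simp add: M.hlift_projection)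

text \<open>The horizontal lifts from M fill ker \<theta>, so testing on horizontal vectors of P
  amounts to testing on tangent vectors of M.\<close>

lemma tensor2_related_iff:
  "tensor2_related A B C \<pi>M \<pi>W \<theta> GW G \<longleftrightarrow> (\<forall>p u v. GW (\<pi>W p) (\<Phi> p u) (\<Phi> p v) = G (\<pi>M p) u v)"
proof
  assume *: "tensor2_related A B C \<pi>M \<pi>W \<theta> GW G"
  show "\<forall>p u v. GW (\<pi>W p) (\<Phi> p u) (\<Phi> p v) = G (\<pi>M p) u v"
  proof (intro allI)
    fix p u v
    have "GW (\<pi>W p) (\<Phi> p u) (\<Phi> p v) =
      G (\<pi>M p) (tangent_map B A \<pi>M p (M.hl p u)) (tangent_map B A \<pi>M p (M.hl p v))"
      unfolding \<Phi>_def using * M.hlift(1) unfolding tensor2_related_def by blast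
    then show "GW (\<pi>W p) (\<Phi> p u) (\<Phi> p v) = G (\<pi>M p) u v" by (simp add: M.hlift)
  qed
qed (simp add: tensor2_related_def \<Phi>_horizontal)

lemma gW_\<Phi>: "gW (\<pi>W p) (\<Phi> p u) (\<Phi> p v) = elementary_deformation g I J K X h (\<pi>M p) u v"
  using twisted tensor2_related_iff unfolding twisted_structure_def by blast

lemma endo_related_\<Phi>:
  assumes "endo_related A B C \<pi>M \<pi>W \<theta> LW L"
  shows "LW (\<pi>W p) (\<Phi> p u) = \<Phi> p (L (\<pi>M p) u)"
proof -
  have "W.hl p (LW (\<pi>W p) (\<Phi> p u)) = M.hl p (L (\<pi>M p) (tangent_map B A \<pi>M p (M.hl p u)))"
    unfolding \<Phi>_def using assms M.hlift(1) unfolding endo_related_def by blast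
  then have "W.hl p (LW (\<pi>W p) (\<Phi> p u)) = M.hl p (L (\<pi>M p) u)" by (simp add: M.hlift)
  then show ?thesis using W.hlift(2) \<Phi>_def by metis
qed

lemma IW_\<Phi>: "IW (\<pi>W p) (\<Phi> p u) = \<Phi> p (I (\<pi>M p) u)"
  and JW_\<Phi>: "JW (\<pi>W p) (\<Phi> p u) = \<Phi> p (J (\<pi>M p) u)"
  and KW_\<Phi>: "KW (\<pi>W p) (\<Phi> p u) = \<Phi> p (K (\<pi>M p) u)"
  using twisted unfolding twisted_structure_def by (simp_all add: endo_related_\<Phi>)

lemma W_hl_XW: "W.hl p (XW (\<pi>W p)) = - (1 / a (\<pi>M p)) *\<^sub>R M.hl p (X (\<pi>M p))"
  using XW_related unfolding vector_related_def
  by (simp add: linear_cmul[OF M.linear_hlift] linear_neg[OF M.linear_hlift])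

lemma XW_\<Phi>: "XW (\<pi>W p) = \<Phi> p (- (1 / a (\<pi>M p)) *\<^sub>R X (\<pi>M p))"
proof -
  have "XW (\<pi>W p) = tangent_map B C \<pi>W p (W.hl p (XW (\<pi>W p)))" by (simp add: W.hlift)
  then show ?thesis by (simp only: W_hl_XW \<Phi>_def linear_cmul[OF M.linear_hlift])
qed

text \<open>X' is vertical over W, so the projections of its two summands cancel: a times the image
  of \<open>Z\<close> is minus the image of the lift of X. This is the origin of the factor -1 / a
  in \<open>XW\<close>.\<close>

lemma tangent_Z: "tangent_map B C \<pi>W p (Z p) = XW (\<pi>W p)"
proof -
  note lin = W.linear_tangent_projection
  have "tangent_map B C \<pi>W p (X' p) = 0" by (rule W.tangent_projection_generator)
  then have "\<Phi> p (X (\<pi>M p)) + a (\<pi>M p) *\<^sub>R tangent_map B C \<pi>W p (Z p) = 0"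
    by (simp add: X'_eq linear_add[OF lin] linear_cmul[OF lin] \<Phi>_def)
  then have "a (\<pi>M p) *\<^sub>R tangent_map B C \<pi>W p (Z p) = - \<Phi> p (X (\<pi>M p))" by (simp add: eq_neg_iff_add_eq_0 add.commute)
  then have "(1 / a (\<pi>M p)) *\<^sub>R a (\<pi>M p) *\<^sub>R tangent_map B C \<pi>W p (Z p) = - ((1 / a (\<pi>M p)) *\<^sub>R \<Phi> p (X (\<pi>M p)))" by simp
  then show ?thesis using a_nz by (simp add: XW_\<Phi> linear_cmul[OF \<Phi>_linear] linear_neg[OF \<Phi>_linear])
qed

section \<open>The objects on W, defined through a point of the fibre\<close>

definition "lift w = (SOME p. \<pi>W p = w)"

lemma lift: "\<pi>W (lift w) = w"
  unfolding lift_def using W.surj_projection by (rule someI_ex)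

text \<open>The fibres of \<open>\<pi>W\<close> are the orbits of \<rho>, so a \<rho>-invariant
  quantity does not see the point chosen by \<open>lift\<close>.\<close>

lemma lift_invariant:
  assumes "\<And>t p. f (\<rho> t p) = f p" shows "f (lift (\<pi>W p)) = f p"
proof -
  obtain t where "lift (\<pi>W p) = \<rho> t p" using W.fibre lift by metis
  then show ?thesis using assms by metis
qed

definition "hW w = - (lam\<^sup>2 * h (\<pi>M (lift w)))"
definition "aW w = 1 / a (\<pi>M (lift w))"
definition "\<phi>W t w = \<pi>W (\<psi> t (lift w))"
definition "\<theta>W p u = 1 / a (\<pi>M p) * \<theta> p u"
text \<open>Expressed by d\<theta> on P instead of F on M: independence of the chosen point then
  follows from the \<rho>-invariance of \<theta> and hence of d\<theta>.\<close>

definition "FW w u v = 1 / a (\<pi>M (lift w)) * ext1 B \<theta> (lift w) (W.hl (lift w) u) (W.hl (lift w) v)"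

lemma hW: "hW (\<pi>W p) = - (lam\<^sup>2 * h (\<pi>M p))"
  unfolding hW_def by (rule lift_invariant) (simp add: h_invariant)

lemma aW: "aW (\<pi>W p) = 1 / a (\<pi>M p)"
  unfolding aW_def by (rule lift_invariant) (simp add: a_invariant)

lemma \<phi>W: "\<phi>W t (\<pi>W p) = \<pi>W (\<psi> t p)"
  unfolding \<phi>W_def by (rule lift_invariant) (simp add: psi_rho W.projection_flow)

lemma FW_hl: "FW (\<pi>W p) u v = 1 / a (\<pi>M p) * ext1 B \<theta> p (W.hl p u) (W.hl p v)"
  unfolding FW_def
  by (rule lift_invariant)
    (simp add: a_invariant W.projection_flow rho_hl[symmetric] W.flow.ext1_invariant[OF \<theta>_smooth \<theta>_rho_invariant])

lemma FW_\<Phi>: "FW (\<pi>W p) (\<Phi> p u) (\<Phi> p v) = 1 / a (\<pi>M p) * F (\<pi>M p) u v"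
  by (simp add: FW_hl W_hl_\<Phi> curvature M.hlift)

lemma inverse_a_smooth: "smooth_at B \<E> (\<lambda>p. 1 / a (\<pi>M p)) p"
proof -
  have "smooth_near (\<lambda>x. inverse x) (a (\<pi>M p))" by (rule smooth_near_inverse[OF smooth_near_ident a_nz])
  then show ?thesis
    using smooth_at_euclidean_compose[OF M.total smooth_at_pull_M[OF a_smooth]] by (simp add: inverse_eq_divide)
qed

lemma d_inverse_a: "ext0 B (\<lambda>p. 1 / a (\<pi>M p)) p u = F (\<pi>M p) (X (\<pi>M p)) (tangent_map B A \<pi>M p u) / (a (\<pi>M p))\<^sup>2"
proof -
  note E = manifold_euclidean
  have sm: "smooth_near (\<lambda>x. 1 / x) (a (\<pi>M p))"
    using smooth_near_inverse[OF smooth_near_ident a_nz] by (simp add: inverse_eq_divide)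
  have "((\<lambda>x. 1 / x) has_derivative (\<lambda>v. - v / (a (\<pi>M p))\<^sup>2)) (at (a (\<pi>M p)))"
    using a_nz by (auto intro!: derivative_eq_intros simp: power2_eq_square field_simps)
  then have d: "tangent_map \<E> \<E> (\<lambda>x. 1 / x) (a (\<pi>M p)) v = - v / (a (\<pi>M p))\<^sup>2" for v
    by (simp add: tangent_map_euclidean frechet_derivative_eqI)
  have "ext0 B (\<lambda>p. 1 / a (\<pi>M p)) p u = tangent_map \<E> \<E> (\<lambda>x. 1 / x) (a (\<pi>M p)) (ext0 B (\<lambda>p. a (\<pi>M p)) p u)"
    unfolding ext0_eq_tangent_map
    by (rule tangent_map_compose[OF M.total E E smooth_at_pull_M[OF a_smooth]]) (simp add: smooth_at_euclidean_iff sm)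
  then show ?thesis by (simp add: d ext0_pull_M[OF a_smooth] da)
qed

lemma \<theta>W_smooth: "smooth_form1 B \<theta>W"
  unfolding \<theta>W_def[abs_def] by (rule smooth_form1_scale[OF M.total inverse_a_smooth \<theta>_smooth])

text \<open>By the Leibniz rule d(\<theta> / a) = d(1 / a) \<and> \<theta> + d\<theta> / a. Since da
  = -F(X, .), the first term cancels exactly the contributions of the X' components of
  \<open>u\<close> and \<open>v\<close> to the second, so that only their horizontal parts
  remain.\<close>

lemma curvature_W: "ext1 B \<theta>W p u v = FW (\<pi>W p) (tangent_map B C \<pi>W p u) (tangent_map B C \<pi>W p v)"
proof -
  let ?x = "\<pi>M p"
  define uh where "uh = W.hl p (tangent_map B C \<pi>W p u)"
  define vh where "vh = W.hl p (tangent_map B C \<pi>W p v)"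
  \<comment> \<open>The component of \<open>u\<close> along X' in the splitting of the tangent space
    over W, since \<theta>(X') = a.\<close>
  define c where "c = \<theta> p u / a ?x"
  define d where "d = \<theta> p v / a ?x"
  define Y where "Y w = F ?x (X ?x) (tangent_map B A \<pi>M p w)" for w
  note lin = M.linear_tangent_projection[of p]
  note bil = bilinear_linear(1)[OF F_bilinear] bilinear_linear(2)[OF F_bilinear]
  have u: "tangent_map B A \<pi>M p u = tangent_map B A \<pi>M p uh + c *\<^sub>R X ?x"
    using arg_cong[OF W.decompose[of u p], of "tangent_map B A \<pi>M p"]
    by (simp add: uh_def c_def \<theta>_X' linear_add[OF lin] linear_cmul[OF lin] tangent_X')
  have v: "tangent_map B A \<pi>M p v = tangent_map B A \<pi>M p vh + d *\<^sub>R X ?x"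
    using arg_cong[OF W.decompose[of v p], of "tangent_map B A \<pi>M p"]
    by (simp add: vh_def d_def \<theta>_X' linear_add[OF lin] linear_cmul[OF lin] tangent_X')
  have e1: "ext1 B \<theta> p u v = ext1 B \<theta> p uh vh - d * Y u + c * Y v"
    unfolding curvature Y_def u v linear_add[OF bil(1)] linear_add[OF bil(2)] linear_cmul[OF bil(1)] linear_cmul[OF bil(2)]
    using F_antisym[of ?x "tangent_map B A \<pi>M p uh" "X ?x"] by (simp add: F_self)
  have e2: "ext1 B \<theta>W p u v = wedge (ext0 B (\<lambda>p. 1 / a (\<pi>M p)) p) (\<theta> p) u v + 1 / a ?x * ext1 B \<theta> p u v"
    unfolding \<theta>W_def[abs_def] by (rule ext1_scale[OF M.total inverse_a_smooth \<theta>_smooth])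
  have e3: "wedge (ext0 B (\<lambda>p. 1 / a (\<pi>M p)) p) (\<theta> p) u v = 1 / a ?x * (d * Y u - c * Y v)"
    using a_nz[of ?x] by (simp add: wedge_def d_inverse_a Y_def c_def d_def power2_eq_square field_simps)
  show ?thesis
    unfolding FW_hl uh_def[symmetric] vh_def[symmetric] e2 e3 e1 by (simp add: algebra_simps)
qed

lemma FW_bilinear: "bilinear (FW w)"
proof -
  let ?p = "lift w"
  note lin = linear_compose[OF W.linear_hlift M.linear_tangent_projection, of ?p ?p, unfolded o_def]
  have "bilinear (\<lambda>u v. F (\<pi>M ?p) (tangent_map B A \<pi>M ?p (W.hl ?p u)) (tangent_map B A \<pi>M ?p (W.hl ?p v)))"
    using linear_compose[OF lin bilinear_linear(1)[OF F_bilinear]] linear_compose[OF lin bilinear_linear(2)[OF F_bilinear]]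
    unfolding bilinear_def o_def by blast
  from bilinear_scale[OF this] show ?thesis unfolding FW_def[abs_def] curvature .
qed

lemma exact_FW:
  assumes c: "c \<in> C" "w \<in> fst c"
  shows "exact_in C c FW w"
proof (rule W.local_section[of w])
  fix U s and \<tau> :: "'p \<Rightarrow> complex"
  assume U: "open U" "w \<in> U" and s: "\<And>y. y \<in> U \<Longrightarrow> smooth_at C B s y" "\<And>y. y \<in> U \<Longrightarrow> \<pi>W (s y) = y"
  show ?thesis
  proof (rule exact_in_pull[OF W.base W.total s(1)[OF U(2)] \<theta>W_smooth c])
    show "\<forall>\<^sub>F q in nhds w. \<forall>u v. FW q u v = ext1 B \<theta>W (s q) (tangent_map C B s q u) (tangent_map C B s q v)"
      unfolding eventually_nhds curvature_W
      using U s(2) W.tangent_projection_section[OF U(1) s] by (intro exI[of _ U]) simp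
  qed
qed

lemma FW_smooth: "smooth_form2 C FW"
  unfolding smooth_form2_def smooth_tensor2_iff[OF W.base]
proof (intro conjI allI ballI)
  show "bilinear (FW w)" for w by (rule FW_bilinear)
  show "FW w u v = - FW w v u" for w u v
    using F_antisym[of "\<pi>M (lift w)" "tangent_map B A \<pi>M (lift w) (W.hl (lift w) u)"] by (simp add: FW_def curvature)
  show "smooth_near (\<lambda>y. comp2 C c FW u v y) (snd c w)"
    if "c \<in> C" "w \<in> fst c" for c w u v
    by (rule exact_in_smooth[OF exact_FW[OF that]])
qed

lemma FW_closed: "ext2 C FW w u v x = 0"
  by (rule exact_in_ext2[OF exact_FW[OF chart_at_in[OF W.base]]])

lemma action_W: "circle_action C S \<phi>W XW"
  unfolding circle_action_def
proof (intro conjI allI)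
  note E = manifold_euclidean
  note prod = smooth_manifold_prod[OF E W.base]
  show "S > 0" using M.action unfolding circle_action_def by blast
  show "\<phi>W 0 w = w" for w by (simp add: \<phi>W_def M.flow.zero lift)
  show "\<phi>W (s + t) w = \<phi>W s (\<phi>W t w)" for s t w
    using \<phi>W[of _ "lift w"] \<phi>W[of s "\<psi> t (lift w)"] by (simp add: lift M.flow.plus)
  show "\<phi>W S w = w" for w by (simp add: \<phi>W_def M.flow.period lift)
  show "smooth_vector_field C XW" by (rule XW_smooth)
  show "smooth_map_on (prod_atlas \<E> C) UNIV C (\<lambda>(t, w). \<phi>W t w)"
    unfolding smooth_map_on_iff[OF prod W.base open_UNIV]
  proof (intro ballI)
    fix z :: "real \<times> 'w"
    show "smooth_at (prod_atlas \<E> C) C (\<lambda>(t, w). \<phi>W t w) z"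
    proof (rule W.local_section[of "snd z"])
      fix U s and \<tau> :: "'p \<Rightarrow> complex"
      assume U: "open U" "snd z \<in> U" and s: "\<And>y. y \<in> U \<Longrightarrow> smooth_at C B s y" "\<And>y. y \<in> U \<Longrightarrow> \<pi>W (s y) = y"
      \<comment> \<open>The choice made by \<open>lift\<close> carries no smoothness, but
        \<open>\<phi>W\<close> does not depend on the point of the fibre, so a smooth local section
        may replace it near \<open>z\<close>.\<close>
      have "smooth_at (prod_atlas \<E> C) B (\<lambda>z. \<psi> (fst z) (s (snd z))) z"
        by (intro M.flow.smooth_at_flow[OF prod] smooth_at_fst[OF E W.base]
            smooth_at_compose[OF prod W.base W.total smooth_at_snd[OF E W.base] s(1)[OF U(2)]])
      from smooth_at_compose[OF prod W.total W.base this W.smooth_projection]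
      have "smooth_at (prod_atlas \<E> C) C (\<lambda>z. \<pi>W (\<psi> (fst z) (s (snd z)))) z" .
      moreover have "\<forall>\<^sub>F z in nhds z. \<pi>W (\<psi> (fst z) (s (snd z))) = (\<lambda>(t, w). \<phi>W t w) z"
        unfolding eventually_nhds
      proof (intro exI[of _ "UNIV \<times> U"] conjI ballI)
        show "open (UNIV \<times> U)" using U(1) by (simp add: open_Times)
        show "z \<in> UNIV \<times> U" using U(2) by (simp add: mem_Times_iff)
        fix z assume "z \<in> (UNIV :: real set) \<times> U"
        then have "\<pi>W (s (snd z)) = snd z" using s(2) by auto
        then show "\<pi>W (\<psi> (fst z) (s (snd z))) = (\<lambda>(t, w). \<phi>W t w) z"
          using \<phi>W[of "fst z" "s (snd z)"] by (simp add: case_prod_unfold)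
      qed
      ultimately show ?thesis by (rule smooth_at_cong[OF prod W.base])
    qed
  qed
  show "((\<lambda>t. snd (chart_at C w) (\<phi>W t w)) has_vector_derivative XW w) (at 0)" for w
  proof -
    let ?p = "lift w"
    have eq: "(\<lambda>t. \<phi>W t w) = (\<lambda>t. \<pi>W (\<psi> t ?p))" by (simp add: \<phi>W_def)
    have sm: "smooth_at \<E> C (\<lambda>t. \<pi>W (\<psi> t ?p)) 0"
      by (rule smooth_at_compose[OF E W.total W.base M.flow.smooth_at_flow_time W.smooth_projection])
    have tm: "tangent_map \<E> C (\<lambda>t. \<pi>W (\<psi> t ?p)) 0 r = r *\<^sub>R XW w" for r
      using tangent_map_compose[OF E W.total W.base M.flow.smooth_at_flow_time W.smooth_projection, of ?p 0 r]
      by (simp add: M.flow.tangent_map_flow_time M.flow.zero linear_cmul[OF W.linear_tangent_projection] tangent_Z lift)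
    have p0: "\<pi>W (\<psi> 0 ?p) = w" by (simp add: M.flow.zero lift)
    have "smooth_near (\<lambda>t. snd (chart_at C w) (\<pi>W (\<psi> t ?p))) 0"
      by (rule tangent_map_euclidean_frame(2)[OF W.base chart_at_in(1)[OF W.base] _ sm])
        (simp add: p0 chart_at_in(2)[OF W.base])
    from smooth_near_has_derivative[OF this]
    have "((\<lambda>t. snd (chart_at C w) (\<pi>W (\<psi> t ?p))) has_derivative tangent_map \<E> C (\<lambda>t. \<pi>W (\<psi> t ?p)) 0) (at 0)"
      unfolding tangent_map_from_euclidean p0 .
    moreover have "tangent_map \<E> C (\<lambda>t. \<pi>W (\<psi> t ?p)) 0 = (\<lambda>r. r *\<^sub>R XW w)" by (rule ext) (rule tm)
    ultimately show ?thesis unfolding has_vector_derivative_def by (simp add: \<phi>W_def)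
  qed
qed

lemma smooth_at_\<phi>W: "smooth_at C C (\<phi>W t) w"
  by (rule circle_flow.smooth_at_flow_space) (unfold_locales, rule W.base, rule action_W)

text \<open>Differentiate \<phi>W t (\<pi>W p) = \<pi>W (\<psi> t p) along a horizontal vector.
  Since \<psi> covers the identity of M, it takes the lift of \<open>u\<close> at \<open>p\<close>
  to the lift of the same \<open>u\<close> at \<open>\<psi> t p\<close>.\<close>

lemma tangent_\<phi>W: "tangent_map C C (\<phi>W t) (\<pi>W p) (\<Phi> p u) = \<Phi> (\<psi> t p) u"
proof -
  have "tangent_map B C (\<lambda>p. \<phi>W t (\<pi>W p)) p (M.hl p u) = tangent_map C C (\<phi>W t) (\<pi>W p) (\<Phi> p u)"
    unfolding \<Phi>_def by (rule tangent_map_compose[OF W.total W.base W.base W.smooth_projection smooth_at_\<phi>W])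
  moreover have "tangent_map B C (\<lambda>p. \<pi>W (\<psi> t p)) p (M.hl p u) = tangent_map B C \<pi>W (\<psi> t p) (tangent_map B B (\<psi> t) p (M.hl p u))"
    by (rule tangent_map_compose[OF W.total W.total W.base M.flow.smooth_at_flow_space W.smooth_projection])
  ultimately show ?thesis by (simp add: \<phi>W psi_hl \<Phi>_def)
qed

text \<open>Along an orbit of \<psi> neither the point of M nor, by \<open>tangent_\<phi>W\<close>,
  the vectors on the M side move. So being related to some tensor on M already implies
  invariance.\<close>

lemma invariant_tensor2_W:
  assumes rel: "\<And>p u v. GW (\<pi>W p) (\<Phi> p u) (\<Phi> p v) = G (\<pi>M p) u v"
  shows "invariant_tensor2 C \<phi>W GW"
  unfolding invariant_tensor2_def
proof (intro allI)
  fix t w u v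
  let ?p = "lift w"
  obtain u' v' where "u = \<Phi> ?p u'" "v = \<Phi> ?p v'" using \<Phi>_surj by blast
  then show "GW (\<phi>W t w) (tangent_map C C (\<phi>W t) w u) (tangent_map C C (\<phi>W t) w v) = GW w u v"
    using tangent_\<phi>W[of t ?p] rel[of ?p] rel[of "\<psi> t ?p"] \<phi>W[of t ?p] by (simp add: lift M.projection_flow)
qed

lemma invariant_endo_W:
  assumes rel: "\<And>p u. LW (\<pi>W p) (\<Phi> p u) = \<Phi> p (L (\<pi>M p) u)"
  shows "invariant_endo C \<phi>W LW"
  unfolding invariant_endo_def
proof (intro allI)
  fix t w u
  let ?p = "lift w"
  obtain u' where "u = \<Phi> ?p u'" using \<Phi>_surj by blast
  then show "LW (\<phi>W t w) (tangent_map C C (\<phi>W t) w u) = tangent_map C C (\<phi>W t) w (LW w u)"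
    using tangent_\<phi>W[of t ?p] rel[of ?p] rel[of "\<psi> t ?p"] \<phi>W[of t ?p] by (simp add: lift M.projection_flow)
qed

section \<open>The twist from W back to M\<close>

lemma smooth_at_aW: "smooth_at C \<E> aW w"
  by (rule W.smooth_at_descend[OF manifold_euclidean inverse_a_smooth aW])

lemma smooth_at_hW: "smooth_at C \<E> hW w"
proof (rule W.smooth_at_descend[where f="\<lambda>p. - (lam\<^sup>2 * h (\<pi>M p))", OF manifold_euclidean _ hW])
  fix p
  have "smooth_near (\<lambda>r. - (lam\<^sup>2 * r)) (h (\<pi>M p))"
    by (intro smooth_near_minus smooth_near_mult smooth_near_const smooth_near_ident)
  from smooth_at_euclidean_compose[OF M.total smooth_at_pull_M[OF h_smooth] this]
  show "smooth_at B \<E> (\<lambda>p. - (lam\<^sup>2 * h (\<pi>M p))) p" .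
qed

lemma ext0_\<Phi>:
  assumes "smooth_at C \<E> fW (\<pi>W p)" "\<And>p. fW (\<pi>W p) = f p"
  shows "ext0 C fW (\<pi>W p) (\<Phi> p u) = ext0 B f p (M.hl p u)"
  unfolding ext0_eq_tangent_map \<Phi>_def
  using tangent_map_compose[OF W.total W.base manifold_euclidean W.smooth_projection assms(1), of "M.hl p u"] assms(2)
  by simp

lemma twist_data_W: "twist_data C S \<phi>W XW aW FW"
  unfolding twist_data_def
proof (intro conjI allI)
  show "invariant_tensor2 C \<phi>W FW" by (rule invariant_tensor2_W[where G="\<lambda>x u v. 1 / a x * F x u v", OF FW_\<Phi>])
  show "smooth_fun C aW" using smooth_fun_iff[OF W.base] smooth_at_aW by blast
  show "aW w \<noteq> 0" for w using a_nz by (simp add: aW_def)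
  show "ext0 C aW w v = - FW w (XW w) v" for w v
  proof -
    let ?p = "lift w"
    obtain v' where v: "v = \<Phi> ?p v'" using \<Phi>_surj by blast
    have "ext0 C aW (\<pi>W ?p) (\<Phi> ?p v') = F (\<pi>M ?p) (X (\<pi>M ?p)) v' / (a (\<pi>M ?p))\<^sup>2"
      by (simp add: ext0_\<Phi>[OF smooth_at_aW aW] d_inverse_a M.hlift)
    moreover have "FW (\<pi>W ?p) (XW (\<pi>W ?p)) (\<Phi> ?p v') = - F (\<pi>M ?p) (X (\<pi>M ?p)) v' / (a (\<pi>M ?p))\<^sup>2"
      unfolding XW_\<Phi> FW_\<Phi> linear_cmul[OF bilinear_linear(2)[OF F_bilinear]]
      by (simp add: power2_eq_square)
    ultimately show ?thesis by (simp add: v lift)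
  qed
qed (rule action_W FW_smooth FW_closed)+

lemma \<theta>W_zero_iff: "\<theta>W p u = 0 \<longleftrightarrow> \<theta> p u = 0"
  using a_nz by (simp add: \<theta>W_def)

text \<open>A horizontal lift depends on the form only through its kernel.\<close>

lemma hlift_\<theta>W: "hlift B C \<pi>W \<theta>W p w = W.hl p w" "hlift B A \<pi>M \<theta>W p v = M.hl p v"
  by (simp_all add: hlift_def \<theta>W_zero_iff)

text \<open>The horizontal lift of \<open>XW\<close> is -1 / a times that of X, and X' / a adds the
  same lift back together with \<open>Z\<close>. So the field whose quotient defines the second
  twist is the principal field of P over M, and that twist is M.\<close>

lemma lifted_field_W: "lifted_field B C \<pi>W \<theta>W X' XW aW = Z"
proof (rule ext)
  fix p
  have "lifted_field B C \<pi>W \<theta>W X' XW aW p = W.hl p (XW (\<pi>W p)) + (1 / a (\<pi>M p)) *\<^sub>R X' p"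
    by (simp add: lifted_field_def[of B C] hlift_\<theta>W aW)
  then show "lifted_field B C \<pi>W \<theta>W X' XW aW p = Z p"
    using a_nz by (simp add: W_hl_XW X'_eq scaleR_add_right)
qed

lemma is_twist_W: "is_twist C B A \<pi>W \<pi>M S \<phi>W XW aW FW R \<rho> X' \<theta>W S \<psi>"
  unfolding is_twist_def lifted_field_W principal_connection_def
proof (intro conjI allI)
  show "invariant_form1 B \<rho> \<theta>W"
    unfolding invariant_form1_def by (simp add: \<theta>W_def a_invariant \<theta>_rho)
  show "\<theta>W p (X' p) = 1" for p using a_nz by (simp add: \<theta>W_def \<theta>_X')
qed (rule twist_data_W pcbW \<theta>W_smooth curvature_W pcbM)+

end

section \<open>Deformed metrics and the elementary twist data on W\<close>

context elementary_twist begin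

abbreviation "gT \<equiv> elementary_deformation g I J K X h"
abbreviation "gTW \<equiv> elementary_deformation gW IW JW KW XW hW"

lemma hyperhermitian_T: "almost_hyperhermitian A gT I J K"
  and hyperhermitian_W: "almost_hyperhermitian C gW IW JW KW"
  using twisted unfolding twisted_structure_def by blast+

text \<open>Used with L the identity, \<open>I\<close>, \<open>J\<close> or \<open>K\<close>. The
  factor 1 + h |X|^2 by which the deformation stretches L X is cancelled by the 1 / a in
  \<open>XW\<close>, and only the constant 1 / \<lambda> survives.\<close>

lemma gW_X:
  assumes lin: "linear L"
    and L: "\<And>v. gT (\<pi>M p) (L (X (\<pi>M p))) v = (1 + h (\<pi>M p) * norm_sq g X (\<pi>M p)) * g (\<pi>M p) (L (X (\<pi>M p))) v"
  shows "gW (\<pi>W p) (\<Phi> p (L (- (1 / a (\<pi>M p)) *\<^sub>R X (\<pi>M p)))) (\<Phi> p v) = - (g (\<pi>M p) (L (X (\<pi>M p))) v / lam)"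
proof -
  let ?x = "\<pi>M p"
  have "gW (\<pi>W p) (\<Phi> p (L (- (1 / a ?x) *\<^sub>R X ?x))) (\<Phi> p v) = - (gT ?x (L (X ?x)) v / a ?x)"
    unfolding gW_\<Phi> linear_cmul[OF lin]
      linear_cmul[OF bilinear_linear(2)[OF almost_hyperhermitian_bilinear[OF hyperhermitian_T]]] by simp
  also have "gT ?x (L (X ?x)) v / a ?x = g ?x (L (X ?x)) v / lam"
  \<comment> \<open>The formula for \<open>a\<close> is available only where X is nonzero; at a zero
    of X both sides vanish.\<close>
  proof (cases "X ?x = 0")
    case True
    then have "g ?x (L (X ?x)) v = 0"
      using linear_0[OF lin] linear_0[OF bilinear_linear(2)[OF almost_hyperhermitian_bilinear[OF hyperhermitian]]]
      by simp
    then show ?thesis unfolding L by simp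
  next
    case False
    from data_at(1)[OF this] show ?thesis using a_nz[of ?x] lam_nz by (simp add: L divide_simps)
  qed
  finally show ?thesis .
qed

text \<open>On each of X, IX, JX, KX exactly one of the four forms in \<open>g_HX\<close> can be
  nonzero, with value |X|^2. Contracting \<open>g_HX\<close> with that vector thus gives |X|^2 times
  its form, which is the hypothesis of \<open>gW_X\<close>.\<close>

lemma flat_W: "flat gW XW (\<pi>W p) (\<Phi> p v) = - (flat g X (\<pi>M p) v / lam)"
  and alpha_W: "alpha gW IW XW (\<pi>W p) (\<Phi> p v) = - (alpha g I X (\<pi>M p) v / lam)"
    "alpha gW JW XW (\<pi>W p) (\<Phi> p v) = - (alpha g J X (\<pi>M p) v / lam)"
    "alpha gW KW XW (\<pi>W p) (\<Phi> p v) = - (alpha g K X (\<pi>M p) v / lam)"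
proof -
  note simps = elementary_deformation_def g_HX_def norm_sq_def flat_def alpha_def omega_def algebra_simps
    almost_hyperhermitian_orthogonal[OF hyperhermitian] almost_hyperhermitian_isometry[OF hyperhermitian]
  note defs = flat_def alpha_def omega_def XW_\<Phi> IW_\<Phi> JW_\<Phi> KW_\<Phi>
  note lin = almost_hyperhermitian_linear[OF hyperhermitian]
  show "flat gW XW (\<pi>W p) (\<Phi> p v) = - (flat g X (\<pi>M p) v / lam)"
    unfolding defs by (rule gW_X[where L="\<lambda>u. u"]) (simp_all add: simps linear_iff)
  show "alpha gW IW XW (\<pi>W p) (\<Phi> p v) = - (alpha g I X (\<pi>M p) v / lam)"
    unfolding defs by (rule gW_X[OF lin(1)]) (simp add: simps)
  show "alpha gW JW XW (\<pi>W p) (\<Phi> p v) = - (alpha g J X (\<pi>M p) v / lam)"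
    unfolding defs by (rule gW_X[OF lin(2)]) (simp add: simps)
  show "alpha gW KW XW (\<pi>W p) (\<Phi> p v) = - (alpha g K X (\<pi>M p) v / lam)"
    unfolding defs by (rule gW_X[OF lin(3)]) (simp add: simps)
qed

lemma gTW_\<Phi>: "gTW (\<pi>W p) (\<Phi> p u) (\<Phi> p v) = g (\<pi>M p) u v"
proof -
  have "g_HX gW IW JW KW XW (\<pi>W p) (\<Phi> p u) (\<Phi> p v) = g_HX g I J K X (\<pi>M p) u v / lam\<^sup>2"
    unfolding g_HX_def flat_W alpha_W by (simp add: power2_eq_square add_divide_distrib)
  then have e: "lam\<^sup>2 * h (\<pi>M p) * g_HX gW IW JW KW XW (\<pi>W p) (\<Phi> p u) (\<Phi> p v) =
      h (\<pi>M p) * g_HX g I J K X (\<pi>M p) u v"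
    using lam_nz by simp
  show ?thesis
    unfolding elementary_deformation_def[of gW] hW gW_\<Phi> elementary_deformation_def[of g] mult_minus_left e by simp
qed

lemma norm_sq_W: "norm_sq gW XW (\<pi>W p) = norm_sq g X (\<pi>M p) / (lam * a (\<pi>M p))"
proof -
  have "norm_sq gW XW (\<pi>W p) = flat gW XW (\<pi>W p) (XW (\<pi>W p))" by (simp add: norm_sq_def flat_def)
  also have "\<dots> = - (flat g X (\<pi>M p) (- (1 / a (\<pi>M p)) *\<^sub>R X (\<pi>M p)) / lam)" by (simp only: XW_\<Phi> flat_W)
  also have "flat g X (\<pi>M p) (- (1 / a (\<pi>M p)) *\<^sub>R X (\<pi>M p)) = - (1 / a (\<pi>M p)) * norm_sq g X (\<pi>M p)"
    using linear_cmul[OF bilinear_linear(1)[OF almost_hyperhermitian_bilinear[OF hyperhermitian]]]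
    by (simp only: flat_def norm_sq_def real_scaleR_def)
  finally show ?thesis by (simp add: mult.commute)
qed

lemma XW_nz: "XW (\<pi>W p) \<noteq> 0 \<Longrightarrow> X (\<pi>M p) \<noteq> 0"
  using linear_0[OF \<Phi>_linear] by (auto simp: XW_\<Phi>)

lemma dhW: "ext0 C hW (\<pi>W p) (\<Phi> p u) = - (lam\<^sup>2 * ext0 A h (\<pi>M p) u)"
proof -
  note E = manifold_euclidean
  let ?f = "\<lambda>r. - (lam\<^sup>2 * r)"
  have near: "smooth_near ?f r" for r
    by (intro smooth_near_minus smooth_near_mult smooth_near_const smooth_near_ident)
  have "tangent_map \<E> \<E> ?f r v = - (lam\<^sup>2 * v)" for r v
    unfolding tangent_map_euclidean by (intro fun_cong[OF frechet_derivative_eqI]) (auto intro!: derivative_eq_intros)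
  then have "ext0 A (\<lambda>x. ?f (h x)) x v = - (lam\<^sup>2 * ext0 A h x v)" for x v
    unfolding ext0_eq_tangent_map
    using tangent_map_compose[where g="?f", OF M.base E E h_smooth] near by (simp add: smooth_at_euclidean_iff)
  then show ?thesis
    using ext0_\<Phi>[OF smooth_at_hW hW, of p u] ext0_pull_M[OF smooth_at_euclidean_compose[OF M.base h_smooth near]]
    by (simp add: M.hlift)
qed

lemma flat_smooth: "smooth_form1 A (flat g X)"
  and flat_W_smooth: "smooth_form1 C (flat gW XW)"
  using hyperhermitian hyperhermitian_W unfolding almost_hyperhermitian_def
  by (auto intro: smooth_form1_flat M.base W.base X_smooth XW_smooth)

text \<open>
  On \<open>P\<close> the pull-backs of \<open>hW \<alpha>\<^sub>0\<close> from \<open>W\<close> and of \<open>\<lambda> h \<alpha>\<^sub>0\<close> from \<open>M\<close> agree on \<open>ker \<theta>\<close>, hence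
  differ by a multiple of \<open>\<theta>\<close>, whose differential contributes a multiple of \<open>F\<close>.
\<close>
lemma ext1_W:
  "ext1 C (\<lambda>w v. hW w * flat gW XW w v) (\<pi>W p) (\<Phi> p u) (\<Phi> p v) =
   lam * ext1 A (\<lambda>x v. h x * flat g X x v) (\<pi>M p) u v
   - lam * h (\<pi>M p) * norm_sq g X (\<pi>M p) / a (\<pi>M p) * F (\<pi>M p) u v"
proof -
  define \<gamma> where "\<gamma> x v = lam * (h x * flat g X x v)" for x v
  define \<gamma>W where "\<gamma>W w v = hW w * flat gW XW w v" for w v
  \<comment> \<open>Minus the value on \<open>Z\<close> of the pull-back of
    \<open>\<gamma>W\<close>: the image of \<open>Z\<close> in W is \<open>XW\<close>, that is
    \<Phi>(-X / a), while \<theta>(Z) = 1 and the pull-back of \<gamma> from M kills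
    \<open>Z\<close>.\<close>
  define k where "k p = lam * (h (\<pi>M p) * norm_sq g X (\<pi>M p)) * (1 / a (\<pi>M p))" for p
  have hf: "smooth_form1 A (\<lambda>x v. h x * flat g X x v)" by (rule smooth_form1_scale[OF M.base h_smooth flat_smooth])
  have \<gamma>: "smooth_form1 A \<gamma>" unfolding \<gamma>_def[abs_def]
    by (rule smooth_form1_scale[OF M.base smooth_at_const[OF M.base manifold_euclidean] hf])
  have \<gamma>W: "smooth_form1 C \<gamma>W" unfolding \<gamma>W_def[abs_def]
    by (rule smooth_form1_scale[OF W.base smooth_at_hW flat_W_smooth])
  have lin: "linear (\<gamma>W w)" for w using \<gamma>W by (simp add: smooth_form1_def)
  have lin\<gamma>: "linear (\<gamma> x)" for x using \<gamma> by (simp add: smooth_form1_def)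
  have rel: "\<gamma>W (\<pi>W p) (\<Phi> p v) = \<gamma> (\<pi>M p) v" for p v
    using lam_nz by (simp add: \<gamma>W_def \<gamma>_def hW flat_W power2_eq_square)
  have \<gamma>X: "\<gamma> x (X x) = lam * (h x * norm_sq g X x)" for x by (simp add: \<gamma>_def flat_def norm_sq_def)
  have pull: "pull1 B C \<pi>W \<gamma>W = (\<lambda>p w. pull1 B A \<pi>M \<gamma> p w - k p * \<theta> p w)"
  proof (intro ext)
    fix p w
    have w: "w = M.hl p (tangent_map B A \<pi>M p w) + \<theta> p w *\<^sub>R Z p" using M.decompose[of w p] by (simp add: \<theta>_Z)
    have "tangent_map B C \<pi>W p w = \<Phi> p (tangent_map B A \<pi>M p w) + \<theta> p w *\<^sub>R XW (\<pi>W p)"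
      by (subst w) (simp only: linear_add[OF W.linear_tangent_projection] linear_cmul[OF W.linear_tangent_projection]
          \<Phi>_def tangent_Z)
    then have "pull1 B C \<pi>W \<gamma>W p w = \<gamma> (\<pi>M p) (tangent_map B A \<pi>M p w) + \<theta> p w * \<gamma> (\<pi>M p) (- (1 / a (\<pi>M p)) *\<^sub>R X (\<pi>M p))"
      by (simp only: pull1_def XW_\<Phi> linear_add[OF lin] linear_cmul[OF lin] rel real_scaleR_def)
    then show "pull1 B C \<pi>W \<gamma>W p w = pull1 B A \<pi>M \<gamma> p w - k p * \<theta> p w"
      unfolding linear_cmul[OF lin\<gamma>] \<gamma>X by (simp add: pull1_def k_def)
  qed
  have ks: "smooth_at B \<E> k p" for p
  proof -
    have "smooth_at A \<E> (\<lambda>x. \<gamma> x (X x)) x" for x by (rule smooth_at_form1_vector[OF M.base \<gamma> X_smooth])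
    from smooth_at_pull_M[OF this]
    have "smooth_at B \<E> (\<lambda>p. lam * (h (\<pi>M p) * norm_sq g X (\<pi>M p))) p" unfolding \<gamma>X .
    from tangent_map_Pair(2)[OF M.total this inverse_a_smooth]
    have "smooth_at B \<E> (\<lambda>p. (lam * (h (\<pi>M p) * norm_sq g X (\<pi>M p)), 1 / a (\<pi>M p))) p" .
    from smooth_at_euclidean_compose[OF M.total this, of "\<lambda>z. fst z * snd z"]
    show ?thesis unfolding k_def[abs_def] by (simp add: smooth_near_mult smooth_near_fst smooth_near_snd)
  qed
  let ?u = "M.hl p u" and ?v = "M.hl p v"
  have "ext1 C \<gamma>W (\<pi>W p) (\<Phi> p u) (\<Phi> p v) = ext1 B (pull1 B C \<pi>W \<gamma>W) p ?u ?v"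
    unfolding \<Phi>_def by (rule ext1_pull1[OF W.total W.base W.smooth_projection \<gamma>W, symmetric])
  also have "\<dots> = ext1 B (pull1 B A \<pi>M \<gamma>) p ?u ?v - ext1 B (\<lambda>p w. k p * \<theta> p w) p ?u ?v"
    unfolding pull by (rule ext1_diff[OF M.total smooth_form1_pull1[OF M.total M.base M.smooth_projection \<gamma>]
          smooth_form1_scale[OF M.total ks \<theta>_smooth]])
  also have "ext1 B (pull1 B A \<pi>M \<gamma>) p ?u ?v = ext1 A \<gamma> (\<pi>M p) u v"
    using ext1_pull1[OF M.total M.base M.smooth_projection \<gamma>] by (simp add: M.hlift)
  \<comment> \<open>The Leibniz term dk \<and> \<theta> vanishes on horizontal vectors.\<close>
  also have "ext1 B (\<lambda>p w. k p * \<theta> p w) p ?u ?v = k p * F (\<pi>M p) u v"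
    using ext1_scale[OF M.total ks \<theta>_smooth] by (simp add: wedge_def M.hlift curvature)
  also have "ext1 A \<gamma> (\<pi>M p) u v = lam * ext1 A (\<lambda>x v. h x * flat g X x v) (\<pi>M p) u v"
    using ext1_scale[OF M.base smooth_at_const[OF M.base manifold_euclidean, of lam] hf]
    by (simp add: \<gamma>_def[abs_def] wedge_def ext0_eq_tangent_map tangent_map_const)
  finally show ?thesis unfolding \<gamma>W_def[abs_def] by (simp add: k_def)
qed

text \<open>Bookkeeping of powers of \<lambda>: dhW corresponds to -\<lambda>^2 dh and each \<alpha>
  equals -\<lambda> times its counterpart on W, so the coefficients of dhW are \<lambda>^3 times
  those of dh. A wedge of two forms on W returns \<lambda>^-2, and a single \<lambda> is
  left.\<close>

lemma star_data:
  assumes X: "X (\<pi>M p) \<noteq> 0"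
  shows "\<exists>x y z. ext0 C hW (\<pi>W p) = (\<lambda>w. x * alpha gW IW XW (\<pi>W p) w + y * alpha gW JW XW (\<pi>W p) w + z * alpha gW KW XW (\<pi>W p) w)"
    and "star_d C gW IW JW KW XW hW (\<pi>W p) (\<Phi> p u) (\<Phi> p v) = lam * star_d A g I J K X h (\<pi>M p) u v"
proof -
  let ?x = "\<pi>M p" and ?w = "\<pi>W p"
  let ?a = "alpha g I X ?x" and ?b = "alpha g J X ?x" and ?c = "alpha g K X ?x"
  let ?aW = "alpha gW IW XW ?w" and ?bW = "alpha gW JW XW ?w" and ?cW = "alpha gW KW XW ?w"
  let ?e1 = "I ?x (X ?x)" and ?e2 = "J ?x (X ?x)" and ?e3 = "K ?x (X ?x)"
  have pos: "g ?x (X ?x) (X ?x) \<noteq> 0" using positive[OF X] by (metis less_irrefl)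
  \<comment> \<open>IX, JX, KX serve as the test vectors required by \<open>star3_eq\<close>, and
    their images under \<Phi> do so on W.\<close>
  have e: "?a ?e1 \<noteq> 0" "?b ?e1 = 0" "?c ?e1 = 0" "?a ?e2 = 0" "?b ?e2 \<noteq> 0" "?c ?e2 = 0" "?a ?e3 = 0" "?b ?e3 = 0" "?c ?e3 \<noteq> 0"
    using almost_hyperhermitian_orthogonal[OF hyperhermitian] almost_hyperhermitian_isometry[OF hyperhermitian] pos
    by (simp_all add: alpha_def omega_def)
  obtain x y z where dh: "ext0 A h ?x = (\<lambda>w. x * ?a w + y * ?b w + z * ?c w)" using data_at(2)[OF X] by blast
  have dW: "ext0 C hW ?w = (\<lambda>w. (lam ^ 3 * x) * ?aW w + (lam ^ 3 * y) * ?bW w + (lam ^ 3 * z) * ?cW w)"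
  proof (rule ext)
    fix w
    obtain w' where w: "w = \<Phi> p w'" using \<Phi>_surj by blast
    show "ext0 C hW ?w w = (lam ^ 3 * x) * ?aW w + (lam ^ 3 * y) * ?bW w + (lam ^ 3 * z) * ?cW w"
      unfolding w dhW dh alpha_W using lam_nz by (simp add: power2_eq_square power3_eq_cube algebra_simps)
  qed
  then show "\<exists>x y z. ext0 C hW ?w = (\<lambda>w. x * ?aW w + y * ?bW w + z * ?cW w)" by blast
  have star: "star_d A g I J K X h ?x = (\<lambda>u v. x * wedge ?b ?c u v + y * wedge ?c ?a u v + z * wedge ?a ?b u v)"
    unfolding star_d_def by (rule star3_eq[OF e dh])
  have starW: "star_d C gW IW JW KW XW hW ?w =
     (\<lambda>u v. (lam ^ 3 * x) * wedge ?bW ?cW u v + (lam ^ 3 * y) * wedge ?cW ?aW u v + (lam ^ 3 * z) * wedge ?aW ?bW u v)"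
    unfolding star_d_def
    by (rule star3_eq[OF _ _ _ _ _ _ _ _ _ dW, of "\<Phi> p ?e1" "\<Phi> p ?e2" "\<Phi> p ?e3"]) (simp_all add: alpha_W e lam_nz)
  have wW: "lam ^ 3 * r * wedge \<alpha>W \<beta>W (\<Phi> p u) (\<Phi> p v) = lam * (r * wedge \<alpha> \<beta> u v)"
    if "\<And>v. \<alpha>W (\<Phi> p v) = - (\<alpha> v / lam)" "\<And>v. \<beta>W (\<Phi> p v) = - (\<beta> v / lam)" for \<alpha>W \<beta>W \<alpha> \<beta> r
    using lam_nz by (simp add: wedge_def that power3_eq_cube algebra_simps)
  show "star_d C gW IW JW KW XW hW ?w (\<Phi> p u) (\<Phi> p v) = lam * star_d A g I J K X h ?x u v"
    unfolding star starW
    using wW[of ?bW ?b ?cW ?c x, OF alpha_W(2,3)] wW[of ?cW ?c ?aW ?a y, OF alpha_W(3,1)] wW[of ?aW ?a ?bW ?b z, OF alpha_W(1,2)]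
    by (simp only: distrib_left)
qed

lemma FW_eq:
  assumes "XW w \<noteq> 0"
  shows "FW w u v = 1 / lam * (ext1 C (\<lambda>w v. hW w * flat gW XW w v) w u v + star_d C gW IW JW KW XW hW w u v)"
proof -
  let ?p = "lift w" let ?x = "\<pi>M ?p"
  obtain u' v' where u: "u = \<Phi> ?p u'" and v: "v = \<Phi> ?p v'" using \<Phi>_surj by blast
  have X: "X ?x \<noteq> 0" using XW_nz assms by (simp add: lift)
  define D where "D = ext1 A (\<lambda>x v. h x * flat g X x v) ?x u' v'"
  define s where "s = star_d A g I J K X h ?x u' v'"
  define n where "n = h ?x * norm_sq g X ?x"
  have F: "F ?x u' v' = lam * (D + s)" unfolding D_def s_def by (rule data_at(3)[OF X])
  have a: "a ?x = lam * (1 + n)" unfolding n_def by (rule data_at(1)[OF X])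
  then have n1: "1 + n \<noteq> 0" using a_nz[of ?x] by auto
  have "FW (\<pi>W ?p) u v = 1 / a ?x * F ?x u' v'" unfolding u v by (rule FW_\<Phi>)
  also have "\<dots> = (D + s) / (1 + n)" unfolding F a using lam_nz by simp
  \<comment> \<open>With F = \<lambda>(D + s) and a = \<lambda>(1 + n) the subtracted term is n / (1
    + n) times \<lambda>(D + s), and 1 / (1 + n) = 1 - n / (1 + n).\<close>
  also have "\<dots> = 1 / lam * (lam * D - lam * n / a ?x * F ?x u' v' + lam * s)"
  proof -
    define m where "m = 1 + n"
    have "m \<noteq> 0" "n = m - 1" using n1 by (simp_all add: m_def)
    then show ?thesis unfolding F a \<open>n = m - 1\<close> using lam_nz by (simp add: field_simps)
  qed
  also have "\<dots> = 1 / lam * (ext1 C (\<lambda>w v. hW w * flat gW XW w v) (\<pi>W ?p) u v + star_d C gW IW JW KW XW hW (\<pi>W ?p) u v)"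
    unfolding u v ext1_W star_data(2)[OF X] by (simp add: D_def s_def n_def)
  finally show ?thesis by (simp add: lift)
qed

lemma star_W_closed:
  assumes "XW w \<noteq> 0"
  shows "ext2 C (star_d C gW IW JW KW XW hW) w u v x = 0"
proof (rule exact_in_ext2)
  note c = chart_at_in[OF W.base, of w]
  have fl: "smooth_form1 C (\<lambda>w v. hW w * flat gW XW w v)"
    by (rule smooth_form1_scale[OF W.base smooth_at_hW flat_W_smooth])
  \<comment> \<open>The values of \<open>XW\<close> need not vary continuously with the point, so
    nonvanishing nearby is read off from the continuous function \<open>norm_sq gW XW\<close>. As
    \<open>gW\<close> may be indefinite, that function is shown to be nonzero at \<open>w\<close> by
    comparison with |X|^2 on M.\<close>
  have "g (\<pi>M (lift w)) (X (\<pi>M (lift w))) (X (\<pi>M (lift w))) > 0"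
    by (rule positive[OF XW_nz]) (simp add: lift assms)
  then have nz: "norm_sq gW XW w \<noteq> 0"
    using norm_sq_W[of "lift w"] a_nz lam_nz by (simp add: lift norm_sq_def)
  have "smooth_at C \<E> (\<lambda>q. flat gW XW q (XW q)) w"
    by (rule smooth_at_form1_vector[OF W.base flat_W_smooth XW_smooth])
  then have "isCont (\<lambda>q. norm_sq gW XW q) w"
    using smooth_at_isCont by (simp add: norm_sq_def flat_def)
  from isCont_eventually[OF this, of "- {0}"] nz
  have ev: "\<forall>\<^sub>F q in nhds w. norm_sq gW XW q \<noteq> 0" by (simp add: open_Compl)
  have "\<forall>\<^sub>F q in nhds w. \<forall>u v. star_d C gW IW JW KW XW hW q u v =
      lam * FW q u v - ext1 C (\<lambda>w v. hW w * flat gW XW w v) q u v"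
    using ev
  proof eventually_elim
    case (elim q)
    have "gW q (XW q) 0 = 0"
      by (rule linear_0[OF bilinear_linear(1)[OF almost_hyperhermitian_bilinear[OF hyperhermitian_W]]])
    then have "XW q \<noteq> 0" using elim by (auto simp: norm_sq_def)
    then show ?case using FW_eq lam_nz by simp
  qed
  then show "exact_in C (chart_at C w) (star_d C gW IW JW KW XW hW) w"
    by (rule exact_in_lincomb[OF W.base c exact_FW[OF c] exact_in_ext1[OF W.base fl c]])
qed

lemma elementary_twist_data_W: "elementary_twist_data C gW IW JW KW XW hW (1 / lam) aW FW"
  unfolding elementary_twist_data_def
proof (intro conjI allI impI)
  show "smooth_fun C hW" using smooth_fun_iff[OF W.base] smooth_at_hW by blast
  show "1 / lam \<noteq> 0" using lam_nz by simp
  fix w assume w: "XW w \<noteq> 0"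
  let ?p = "lift w" let ?x = "\<pi>M ?p"
  have X: "X ?x \<noteq> 0" using XW_nz w by (simp add: lift)
  define n where "n = h ?x * norm_sq g X ?x"
  have a: "a ?x = lam * (1 + n)" unfolding n_def by (rule data_at(1)[OF X])
  then have n1: "1 + n \<noteq> 0" using a_nz[of ?x] by auto
  \<comment> \<open>The subtracted quotient is -\<open>hW\<close> times
    \<open>norm_sq gW XW\<close>, and it equals n / (1 + n).\<close>
  have "1 / a ?x = 1 / lam * (1 + - (lam\<^sup>2 * n / (lam * a ?x)))"
  proof -
    define m where "m = 1 + n"
    have "m \<noteq> 0" "n = m - 1" using n1 by (simp_all add: m_def)
    then show ?thesis unfolding a using lam_nz by (simp add: field_simps power2_eq_square)
  qed
  then show "aW w = 1 / lam * (1 + hW w * norm_sq gW XW w)"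
    using aW[of ?p] hW[of ?p] norm_sq_W[of ?p] by (simp add: lift n_def)
  show "aW w \<noteq> 0" using a_nz by (simp add: aW_def)
  show "\<exists>x y z. ext0 C hW w = (\<lambda>v. x * alpha gW IW XW w v + y * alpha gW JW XW w v + z * alpha gW KW XW w v)"
    using star_data(1)[OF X] by (simp add: lift)
  show "FW w u v = 1 / lam * (ext1 C (\<lambda>w v. hW w * flat gW XW w v) w u v + star_d C gW IW JW KW XW hW w u v)" for u v
    by (rule FW_eq[OF w])
  show "ext2 C (star_d C gW IW JW KW XW hW) w u v x = 0" for u v x by (rule star_W_closed[OF w])
qed

lemma hyperhermitian_TW: "almost_hyperhermitian C gTW IW JW KW"
  unfolding almost_hyperhermitian_def
proof (intro conjI allI impI)
  have sm: "smooth_tensor2 C gW" "smooth_endo C IW" "smooth_endo C JW" "smooth_endo C KW"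
    and quat: "IW w (IW w v) = - v" "JW w (JW w v) = - v" "KW w (KW w v) = - v"
            "IW w (JW w v) = KW w v" "JW w (IW w v) = - KW w v" for w v
    using hyperhermitian_W unfolding almost_hyperhermitian_def by blast+
  show "smooth_tensor2 C gTW"
    by (rule smooth_tensor2_elementary_deformation[OF W.base sm(1) XW_smooth sm(2-4) smooth_at_hW])
  show "smooth_endo C IW" "smooth_endo C JW" "smooth_endo C KW" by (rule sm)+
  show "IW w (IW w v) = - v" "JW w (JW w v) = - v" "KW w (KW w v) = - v"
            "IW w (JW w v) = KW w v" "JW w (IW w v) = - KW w v" for w v by (rule quat)+
  fix w u
  let ?p = "lift w"
  have \<Phi>: "gTW w (\<Phi> ?p u') (\<Phi> ?p v') = g (\<pi>M ?p) u' v'" for u' v' using gTW_\<Phi>[of ?p] by (simp add: lift)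
  have L: "IW w (\<Phi> ?p u') = \<Phi> ?p (I (\<pi>M ?p) u')" "JW w (\<Phi> ?p u') = \<Phi> ?p (J (\<pi>M ?p) u')"
    "KW w (\<Phi> ?p u') = \<Phi> ?p (K (\<pi>M ?p) u')" for u'
    using IW_\<Phi>[of ?p] JW_\<Phi>[of ?p] KW_\<Phi>[of ?p] by (simp_all add: lift)
  obtain u' where u: "u = \<Phi> ?p u'" using \<Phi>_surj by blast
  { fix v
    obtain v' where v: "v = \<Phi> ?p v'" using \<Phi>_surj by blast
    show "gTW w u v = gTW w v u" unfolding u v \<Phi> by (rule almost_hyperhermitian_sym[OF hyperhermitian])
    show "gTW w (IW w u) (IW w v) = gTW w u v" "gTW w (JW w u) (JW w v) = gTW w u v" "gTW w (KW w u) (KW w v) = gTW w u v"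
      unfolding u v L \<Phi> by (rule almost_hyperhermitian_isometry[OF hyperhermitian])+ }
  \<comment> \<open>Nondegeneracy comes from positivity of \<open>g\<close>, by testing on
    \<open>u\<close> itself through \<Phi>.\<close>
  assume "\<forall>v. gTW w u v = 0"
  then have "g (\<pi>M ?p) u' u' = 0" using \<Phi> u by metis
  then have "u' = 0" using positive by (metis less_irrefl)
  then show "u = 0" using u linear_0[OF \<Phi>_linear] by simp
qed

lemma twisted_structure_W: "twisted_structure C B A \<pi>W \<pi>M \<theta>W \<phi>W gTW IW JW KW g I J K"
  unfolding twisted_structure_def
proof (intro conjI)
  show "almost_hyperhermitian C gTW IW JW KW" "almost_hyperhermitian A g I J K"
    by (rule hyperhermitian_TW hyperhermitian)+
  show "invariant_structure C \<phi>W gTW IW JW KW"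
    unfolding invariant_structure_def
    by (intro conjI invariant_tensor2_W[of gTW g] invariant_endo_W[of IW I] invariant_endo_W[of JW J]
        invariant_endo_W[of KW K] gTW_\<Phi> IW_\<Phi> JW_\<Phi> KW_\<Phi>)
  show "tensor2_related C B A \<pi>W \<pi>M \<theta>W g gTW"
    unfolding tensor2_related_def by (simp add: \<theta>W_zero_iff \<Phi>_horizontal gTW_\<Phi>)
  show "endo_related C B A \<pi>W \<pi>M \<theta>W I IW" "endo_related C B A \<pi>W \<pi>M \<theta>W J JW" "endo_related C B A \<pi>W \<pi>M \<theta>W K KW"
    unfolding endo_related_def hlift_\<theta>W by (simp_all add: \<theta>W_zero_iff \<Phi>_horizontal IW_\<Phi> JW_\<Phi> KW_\<Phi> W_hl_\<Phi>)
qed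

lemma invariant_structure_W: "invariant_structure C \<phi>W gW IW JW KW"
  unfolding invariant_structure_def
  by (intro conjI invariant_tensor2_W[of gW gT] invariant_endo_W[of IW I] invariant_endo_W[of JW J]
      invariant_endo_W[of KW K] gW_\<Phi> IW_\<Phi> JW_\<Phi> KW_\<Phi>)

lemma vector_related_W: "vector_related C B A \<pi>W \<pi>M \<theta>W X (\<lambda>w. (- (1 / aW w)) *\<^sub>R XW w)"
  unfolding vector_related_def hlift_\<theta>W
proof
  fix p
  have "W.hl p ((- (1 / aW (\<pi>W p))) *\<^sub>R XW (\<pi>W p)) = (- (1 / aW (\<pi>W p))) *\<^sub>R W.hl p (XW (\<pi>W p))"
    by (rule linear_cmul[OF W.linear_hlift])
  then show "M.hl p (X (\<pi>M p)) = W.hl p ((- (1 / aW (\<pi>W p))) *\<^sub>R XW (\<pi>W p))"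
    using a_nz by (simp add: W_hl_XW aW)
qed

end

theorem proposition5p2:
  fixes A :: "('m::{t2_space,second_countable_topology}, 'e::euclidean_space) atlas"
    and B :: "('p::{t2_space,second_countable_topology}, 'q::euclidean_space) atlas"
    and C :: "('w::{t2_space,second_countable_topology}, 'f::euclidean_space) atlas"
    and g :: "('m, 'e) tensor2" and I J K :: "('m, 'e) endo_field"
    and T :: real and \<phi> :: "real \<Rightarrow> 'm \<Rightarrow> 'm" and X :: "('m, 'e) vector_field"
    and h a :: "'m \<Rightarrow> real" and lam :: real and F :: "('m, 'e) tensor2"
    and \<pi>M :: "'p \<Rightarrow> 'm" and \<pi>W :: "'p \<Rightarrow> 'w"
    and S R :: real and \<psi> \<rho> :: "real \<Rightarrow> 'p \<Rightarrow> 'p"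
    and Z :: "('p, 'q) vector_field" and \<theta> :: "('p, 'q) form1"
    and gW :: "('w, 'f) tensor2" and IW JW KW :: "('w, 'f) endo_field"
    and XW :: "('w, 'f) vector_field"
  assumes "hyperkaehler A g I J K"
    and "connected (UNIV :: 'm set)"
    and "DIM('e) > 4"
    and "circle_action A T \<phi> X" and "effective_action T \<phi>"
    and "invariant_structure A \<phi> g I J K"
    and "elementary_twist_data A g I J K X h lam a F"
    and "is_twist A B C \<pi>M \<pi>W T \<phi> X a F S \<psi> Z \<theta> R \<rho>"
    and "twisted_structure A B C \<pi>M \<pi>W \<theta> \<phi>
           (elementary_deformation g I J K X h) I J K gW IW JW KW"
    and "smooth_vector_field C XW"
    and "vector_related A B C \<pi>M \<pi>W \<theta> XW (\<lambda>x. (- (1 / a x)) *\<^sub>R X x)"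
  shows "\<exists>hW lamW aW FW.
    fun_related \<pi>M \<pi>W hW (\<lambda>x. - (lam\<^sup>2 * h x)) \<and>
    fun_related \<pi>M \<pi>W (\<lambda>_. lamW) (\<lambda>_. 1 / lam) \<and>
    fun_related \<pi>M \<pi>W aW (\<lambda>x. 1 / a x) \<and>
    tensor2_related A B C \<pi>M \<pi>W \<theta> FW (\<lambda>x u v. (1 / a x) * F x u v) \<and>
    elementary_twist_data C gW IW JW KW XW hW lamW aW FW \<and>
    (\<exists>TW \<phi>W \<theta>W.
       (\<forall>p u. \<theta>W p u = 0 \<longleftrightarrow> \<theta> p u = 0) \<and>
       invariant_structure C \<phi>W gW IW JW KW \<and>
       is_twist C B A \<pi>W \<pi>M TW \<phi>W XW aW FW R \<rho> (lifted_field B A \<pi>M \<theta> Z X a) \<theta>W S \<psi> \<and>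
       twisted_structure C B A \<pi>W \<pi>M \<theta>W \<phi>W
         (elementary_deformation gW IW JW KW XW hW) IW JW KW g I J K \<and>
       vector_related C B A \<pi>W \<pi>M \<theta>W X (\<lambda>x. (- (1 / aW x)) *\<^sub>R XW x))"
proof -
  interpret elementary_twist A B C g I J K T \<phi> X h a lam F \<pi>M \<pi>W S R \<psi> \<rho> Z \<theta> gW IW JW KW XW
    using assms unfolding hyperkaehler_def by unfold_locales blast+
  show ?thesis
  proof (intro exI conjI)
    show "fun_related \<pi>M \<pi>W hW (\<lambda>x. - (lam\<^sup>2 * h x))" by (simp add: fun_related_def hW)
    show "fun_related \<pi>M \<pi>W (\<lambda>_. 1 / lam) (\<lambda>_. 1 / lam)" by (simp add: fun_related_def)
    show "fun_related \<pi>M \<pi>W aW (\<lambda>x. 1 / a x)" by (simp add: fun_related_def aW)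
    show "tensor2_related A B C \<pi>M \<pi>W \<theta> FW (\<lambda>x u v. (1 / a x) * F x u v)"
      unfolding tensor2_related_iff using FW_\<Phi> by blast
    show "elementary_twist_data C gW IW JW KW XW hW (1 / lam) aW FW" by (rule elementary_twist_data_W)
    show "\<forall>p u. \<theta>W p u = 0 \<longleftrightarrow> \<theta> p u = 0" using \<theta>W_zero_iff by blast
    show "invariant_structure C \<phi>W gW IW JW KW" by (rule invariant_structure_W)
    show "is_twist C B A \<pi>W \<pi>M S \<phi>W XW aW FW R \<rho> (lifted_field B A \<pi>M \<theta> Z X a) \<theta>W S \<psi>" by (rule is_twist_W)
    show "twisted_structure C B A \<pi>W \<pi>M \<theta>W \<phi>W
         (elementary_deformation gW IW JW KW XW hW) IW JW KW g I J K" by (rule twisted_structure_W)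
    show "vector_related C B A \<pi>W \<pi>M \<theta>W X (\<lambda>x. (- (1 / aW x)) *\<^sub>R XW x)" by (rule vector_related_W)
  qed
qed

end
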